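(* Let $p$ be a prime with $p\equiv 1\pmod 3$. Let $\mathcal{E}$ be the set of $(x,y,z)\in\mathbb{F}_p^3$ with $y^2=x^3+z^2$ and $z\neq 0$, let $\chi_\tau\colon\mathcal{E}\to\mathbb{C}^*$ be the fiberwise-defined cubic character attached to the family of $3$-isogenies $\tau_d$ (defined in the context, for any choice of the auxiliary points $Q$ in the fibers), and let $$\mathcal{S}_\tau=\sum_{P=(x,y,z)\in\mathcal{E}}\{x\}\,\chi_\tau(P).$$ Then $$\frac{1}{p}\,\mathcal{S}_\tau=h_p^*-\frac{p-1}{2},$$ where $h_p^*=h(\mathbb{Q}(\sqrt{-p}))$ (the class number of $\mathbb{Q}(\sqrt{-p})$) if $p\equiv 3\pmod 4$, and $h_p^*=0$ otherwise.
   Context: For $a\in\mathbb{F}_p$, $\{a\}$ denotes the unique integer with $0\le\{a\}\le p-1$ whose residue class mod $p$ is $a$. $\zeta$ is a fixed primitive complex cube root of unity. For $d\in\mathbb{F}_p^*$ let $E_d$ be the elliptic curve $y^2=x^3+d$ over $\mathbb{F}_p$, and put $d'=-27d$. The map $$\tau_d(x,y)=\left(\frac{y^2+3d}{x^2},\ \frac{y(x^3-8d)}{x^3}\right)$$ defines a $3$-isogeny $\tau_d\colon E_d\to E_{d'}$ over $\mathbb{F}_p$. Below, $E(\mathbb{F}_p)$ is the full group of rational points including $\infty$. When $d$ is a nonzero square in $\mathbb{F}_p$ (and $p\equiv1\pmod 3$) one has $E_{d'}(\mathbb{F}_p)/\tau_d(E_d(\mathbb{F}_p))\cong\mathbb{Z}/3\mathbb{Z}$.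 Choose $Q\in E_{d'}(\mathbb{F}_p)\setminus\tau_d(E_d(\mathbb{F}_p))$. For $P\in E_{d'}(\mathbb{F}_p)$ define $\chi_{\tau_d}(P)=\zeta^k$, where $k\in\{0,1,2\}$ is the unique value with $P-kQ\in\tau_d(E_d(\mathbb{F}_p))$. $\mathcal{E}$ is the disjoint union over $z\in\mathbb{F}_p^*$ of its fibers, the fiber over $z$ being the set of affine rational points of $E_{z^2}$. For $P=(x,y,z)\in\mathcal{E}$ put $d=-z^2/27$, which is a nonzero square in $\mathbb{F}_p$ because $-3$ is a square mod $p$; then $d'=z^2$, so $(x,y)\in E_{d'}(\mathbb{F}_p)$, and one defines $\chi_\tau(P)=\chi_{\tau_d}(x,y)$, where a point $Q$ has been chosen for each fiber. *)

theory Defs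
  imports
    Complex_Main
    "HOL-Algebra.Ideal"
    "HOL-Number_Theory.Cong"
    "Berlekamp_Zassenhaus.Finite_Field"
begin

section \<open>The curves \<open>y\<^sup>2 = x\<^sup>3 + d\<close> and the 3-isogenies between them\<close>

datatype 'a point = Infinity | Affine 'a 'a

definition curve :: "'a::field \<Rightarrow> 'a point set" where
  "curve d = {Infinity} \<union> {Affine x y | x y. y ^ 2 = x ^ 3 + d}"

fun neg_point :: "'a::field point \<Rightarrow> 'a point" where
  "neg_point Infinity = Infinity"
| "neg_point (Affine x y) = Affine x (- y)"

text \<open>
  The chord-tangent law. The formulas do not involve \<open>d\<close>; they give the group law of
  \<open>curve d\<close> when both arguments lie on it, \<open>d \<noteq> 0\<close> and the characteristic is not 2 or 3.
\<close>

fun add_point :: "'a::field point \<Rightarrow> 'a point \<Rightarrow> 'a point" where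
  "add_point Infinity Q = Q"
| "add_point P Infinity = P"
| "add_point (Affine x1 y1) (Affine x2 y2) =
    (if x1 = x2 \<and> y1 = - y2 then Infinity
     else
       let m = (if x1 = x2 then 3 * x1 ^ 2 / (2 * y1) else (y2 - y1) / (x2 - x1));
           x3 = m ^ 2 - x1 - x2
       in Affine x3 (m * (x1 - x3) - y1))"

definition mult_point :: "nat \<Rightarrow> 'a::field point \<Rightarrow> 'a point" where
  "mult_point k P = (add_point P ^^ k) Infinity"

text \<open>The kernel of the isogeny consists of \<open>Infinity\<close> and the points with \<open>x = 0\<close>.\<close>

fun tau :: "'a::field \<Rightarrow> 'a point \<Rightarrow> 'a point" where
  "tau d Infinity = Infinity"
| "tau d (Affine x y) =
    (if x = 0 then Infinity
     else Affine ((y ^ 2 + 3 * d) / x ^ 2) (y * (x ^ 3 - 8 * d) / x ^ 3))"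

text \<open>The cubic character of \<open>curve (- 27 * d)\<close> with auxiliary point \<open>Q\<close> and cube root of unity \<open>\<zeta>\<close>.\<close>

definition chi_tau_fiber :: "complex \<Rightarrow> 'a::field \<Rightarrow> 'a point \<Rightarrow> 'a point \<Rightarrow> complex" where
  "chi_tau_fiber \<zeta> d Q P =
    \<zeta> ^ (THE k. k \<in> {0, 1, 2} \<and> add_point P (neg_point (mult_point k Q)) \<in> tau d ` curve d)"

section \<open>The surface and the sum over it\<close>

definition surface :: "('a::field \<times> 'a \<times> 'a) set" where
  "surface = {(x, y, z). y ^ 2 = x ^ 3 + z ^ 2 \<and> z \<noteq> 0}"

definition fiber_param :: "'a::field \<Rightarrow> 'a" where
  "fiber_param z = - (z ^ 2) / 27"

text \<open>\<open>Q z\<close> is the auxiliary point chosen in the fiber over \<open>z\<close>.\<close>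

definition chi_tau :: "complex \<Rightarrow> ('a::field \<Rightarrow> 'a point) \<Rightarrow> 'a \<times> 'a \<times> 'a \<Rightarrow> complex" where
  "chi_tau \<zeta> Q = (\<lambda>(x, y, z). chi_tau_fiber \<zeta> (fiber_param z) (Q z) (Affine x y))"

definition S_tau :: "complex \<Rightarrow> ('p::prime_card mod_ring \<Rightarrow> 'p mod_ring point) \<Rightarrow> complex" where
  "S_tau \<zeta> Q = (\<Sum>(x, y, z)\<in>surface. of_int (to_int_mod_ring x) * chi_tau \<zeta> Q (x, y, z))"

section \<open>Class numbers\<close>

definition ring_of_integers :: "complex set \<Rightarrow> complex ring" where
  "ring_of_integers K =
    \<lparr>carrier = {x \<in> K. algebraic_int x}, monoid.mult = (*), one = 1, zero = 0, add = (+)\<rparr>"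

definition nonzero_ideals :: "complex ring \<Rightarrow> complex set set" where
  "nonzero_ideals R = {I. ideal I R \<and> I \<noteq> {0}}"

definition ideal_class_rel :: "complex ring \<Rightarrow> (complex set \<times> complex set) set" where
  "ideal_class_rel R =
    {(I, J). I \<in> nonzero_ideals R \<and> J \<in> nonzero_ideals R \<and>
       (\<exists>a\<in>carrier R - {0}. \<exists>b\<in>carrier R - {0}. (*) a ` I = (*) b ` J)}"

text \<open>For a number field \<open>K\<close> embedded in the complex numbers.\<close>

definition class_number :: "complex set \<Rightarrow> nat" where
  "class_number K =
    (let R = ring_of_integers K in card (nonzero_ideals R // ideal_class_rel R))"

definition quadratic_field :: "int \<Rightarrow> complex set" where
  "quadratic_field D = {a + b * csqrt (of_int D) | a b. a \<in> \<rat> \<and> b \<in> \<rat>}"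

definition h_star :: "nat \<Rightarrow> nat" where
  "h_star p = (if [p = 3] (mod 4) then class_number (quadratic_field (- int p)) else 0)"

end

theory Submission
  imports
    Defs
    "HOL-Analysis.Analysis"
    "HOL-Number_Theory.Number_Theory"
    "HOL-Real_Asymp.Real_Asymp"
begin

text \<open>
  Writing \<open>u = y + z\<close> and \<open>v = y - z\<close>, the points of a fibre with \<open>x \<noteq> 0\<close> satisfy \<open>u v = x\<^sup>3\<close>, and up to
  inversion \<open>\<chi>\<^sub>\<tau>\<close> is the cubic residue character of \<open>u\<close>; inversion is harmless because of the symmetry
  \<open>y \<mapsto> - y\<close>. Summing over all \<open>u \<noteq> 0\<close> gives 0, so only the pairs with \<open>u = v\<close>, which are excluded
  from the surface, contribute: the sum is minus the sum of the residues of \<open>t\<^sup>2\<close> over \<open>t \<noteq> 0\<close>. This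
  reduces the claim to Dirichlet's formula \<open>p h = - (\<Sum>a<p. a (a/p))\<close> for \<open>p \<equiv> 3 (mod 4)\<close>.

  Dirichlet's formula is proved without Gauss sums, by comparing constant terms as \<open>t \<rightarrow> 0\<close>. Let \<open>G(t)\<close>
  be the sum of \<open>exp (- t N(I))\<close> over the nonzero ideals. There are \<open>\<Sum>d|n. (d/p)\<close> ideals of norm \<open>n\<close>, so
  \<open>G(t) - 2 G(2t) = (\<Sum>d. (d/p) / (1 + exp (d t)))\<close>, and summation by parts with the convexity of
  \<open>1 / (1 + exp x)\<close> yields the limit \<open>- (\<Sum>a<p. a (a/p)) / (2p)\<close>. On the other hand each ideal class
  contributes \<open>(\<theta>(t) - 1) / 2\<close> to \<open>G(t)\<close> for the theta series of a binary quadratic form, and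
  \<open>\<theta>(t) = c/t + o(1)\<close>, so that \<open>G(t) - 2 G(2t)\<close> tends to \<open>h/2\<close>.
\<close>

section \<open>The cubic character of a fibre\<close>

text \<open>Cubic residues enter because the isogeny is a cubing in suitable coordinates: with
  \<open>s\<^sup>2 = - 3\<close>, \<open>z = 3 * s * e\<close> and \<open>d = e\<^sup>2\<close>, a
  point \<open>(X, Y)\<close> is sent to \<open>(x, y)\<close> with
  \<open>y + z = ((Y + s * e) / X) ^ 3\<close> and \<open>y - z = ((Y - s * e) / X) ^ 3\<close>. The
  combination \<open>G(t) - 2 G(2t)\<close> does two things at once. It removes the pole
  \<open>c/t\<close> whatever \<open>c\<close> is, and with \<open>q = exp (- d t)\<close> it turns
  \<open>q / (1 - q)\<close> into
  \<open>q / (1 - q) - 2 q\<^sup>2 / (1 - q\<^sup>2) = q / (1 + q)\<close>, which stays bounded as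
  \<open>t\<close> tends to 0. The obstacle is the error term of the theta series. It is summed row
  by row, and about \<open>1 / sqrt t\<close> rows matter, so a Gaussian sum over the integers is
  needed with an error of smaller order than \<open>sqrt t\<close>, uniformly in the shift of the
  row. Euler-Maclaurin of order \<open>k\<close> leaves \<open>t ^ ((k - 1) / 2)\<close>; order
  three is the first that suffices. The 2 in \<open>(\<theta>(t) - 1) / 2\<close> is the number of
  units, so \<open>p = 3\<close> has to be kept out; the congruence modulo 3 does this.\<close>

locale cubic_character =
  fixes c :: "'a::field \<Rightarrow> complex"
  assumes c_mult: "u \<noteq> 0 \<Longrightarrow> v \<noteq> 0 \<Longrightarrow> c (u * v) = c u * c v"
    and c_eq_1_iff: "u \<noteq> 0 \<Longrightarrow> c u = 1 \<longleftrightarrow> (\<exists>w. u = w ^ 3)"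
    and two_nz: "(2::'a) \<noteq> 0" and three_nz: "(3::'a) \<noteq> 0"
    and sqrt_minus_3: "\<exists>s::'a. s\<^sup>2 = - 3"
begin

lemma c_cube: "w \<noteq> 0 \<Longrightarrow> c (w ^ 3) = 1"
  using c_eq_1_iff[of "w ^ 3"] power_not_zero[of w 3] by blast

lemma c_1 [simp]: "c 1 = 1" using c_cube[of 1] by simp

lemma c_nz: "u \<noteq> 0 \<Longrightarrow> c u \<noteq> 0"
  using c_mult[of u "inverse u"] by auto

lemma c_pow3: "u \<noteq> 0 \<Longrightarrow> c u ^ 3 = 1"
  using c_cube[of u] c_mult[of u u] c_mult[of u "u * u"] by (simp add: power3_eq_cube mult.assoc)

lemma c_minus: "u \<noteq> 0 \<Longrightarrow> c (- u) = c u"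
  using c_mult[of "-1" u] c_cube[of "-1"] by simp

lemma c_prod_cube:
  assumes "u * v = w ^ 3" "u \<noteq> 0" "v \<noteq> 0"
  shows "c u * c v = 1"
  using c_mult[of u v] c_cube[of w] assms by (metis mult_eq_0_iff power_zero_numeral)

text \<open>On points with \<open>x \<noteq> 0\<close> the two branches agree, because
  \<open>(y + z) * (y - z) = x ^ 3\<close>.\<close>

fun pt_char :: "'a \<Rightarrow> 'a point \<Rightarrow> complex" where
  "pt_char z Infinity = 1"
| "pt_char z (Affine x y) = (if y + z \<noteq> 0 then c (y + z) else inverse (c (y - z)))"

lemma pt_char_alt:
  assumes "y\<^sup>2 = x ^ 3 + z\<^sup>2" "y - z \<noteq> 0"
  shows "pt_char z (Affine x y) = inverse (c (y - z))"
proof (cases "y + z = 0")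
  case False
  have "(y + z) * (y - z) = x ^ 3" using assms(1) by (simp add: algebra_simps power2_eq_square)
  then have "c (y + z) * c (y - z) = 1" using False assms(2) by (intro c_prod_cube)
  then show ?thesis using False c_nz[OF assms(2)] by (simp add: field_simps)
qed simp

lemma pt_char_neg:
  assumes "P \<in> curve (z\<^sup>2)" "z \<noteq> 0"
  shows "pt_char z (neg_point P) * pt_char z P = 1"
proof (cases P)
  case (Affine x y)
  then have xy: "y\<^sup>2 = x ^ 3 + z\<^sup>2" using assms by (auto simp: curve_def)
  show ?thesis
  proof (cases "y + z = 0")
    case False
    have "(- y)\<^sup>2 = x ^ 3 + z\<^sup>2" "- y - z \<noteq> 0" using xy False by (auto simp: algebra_simps add_eq_0_iff)
    from pt_char_alt[OF this] have "pt_char z (neg_point P) = inverse (c (- (y + z)))" by (simp add: Affine)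
    then show ?thesis using False c_minus[OF False] c_nz[OF False] by (simp add: Affine)
  next
    case True
    then have y: "y = - z" by (simp add: add_eq_0_iff2)
    have "z + z \<noteq> 0" using two_nz assms(2) by (metis mult_2 mult_eq_0_iff)
    then show ?thesis using c_nz[of "z + z"] c_minus[of "z + z"] by (simp add: Affine y)
  qed
qed simp

lemma neg_point_curve: "P \<in> curve d \<Longrightarrow> neg_point P \<in> curve d"
  by (cases P) (auto simp: curve_def)

text \<open>The line \<open>y = m * x + k\<close> meets the curve where
  \<open>x ^ 3 - (m * x + k)\<^sup>2 + z\<^sup>2\<close> vanishes, and the last three conclusions
  are Vieta's formulas for the roots \<open>x1\<close>, \<open>x2\<close>, \<open>x3\<close>. For a
  chord they follow by cancelling \<open>x1 - x2\<close>, for a tangent from the equation of the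
  slope.\<close>

lemma add_point_line:
  fixes x1 y1 x2 y2 z :: 'a
  assumes 1: "y1\<^sup>2 = x1 ^ 3 + z\<^sup>2" and 2: "y2\<^sup>2 = x2 ^ 3 + z\<^sup>2" and ne: "\<not> (x1 = x2 \<and> y1 = - y2)"
  obtains m k x3 where "y1 = m * x1 + k" "y2 = m * x2 + k"
    "add_point (Affine x1 y1) (Affine x2 y2) = Affine x3 (- (m * x3 + k))"
    "x1 + x2 + x3 = m\<^sup>2" "x1 * x2 + x1 * x3 + x2 * x3 = - 2 * m * k" "x1 * x2 * x3 = k\<^sup>2 - z\<^sup>2"
proof -
  define m where "m = (if x1 = x2 then 3 * x1 ^ 2 / (2 * y1) else (y2 - y1) / (x2 - x1))"
  define k where "k = y1 - m * x1"
  define x3 where "x3 = m\<^sup>2 - x1 - x2"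
  have y1: "y1 = m * x1 + k" by (simp add: k_def)
  have *: "y2 = m * x2 + k \<and> x1 * x2 + x1 * x3 + x2 * x3 = - 2 * m * k"
  proof (cases "x1 = x2")
    case True
    have "(y1 - y2) * (y1 + y2) = 0" using 1 2 True by (simp add: algebra_simps power2_eq_square)
    then have y: "y2 = y1" using ne True by (auto simp: add_eq_0_iff2)
    have "y1 \<noteq> 0" using ne True y by auto
    then have "2 * y1 \<noteq> 0" using two_nz by (metis mult_eq_0_iff)
    then have "2 * y1 * m = 3 * x1\<^sup>2" using True by (simp add: m_def)
    then have "2 * (m * x1 + k) * m = 3 * x1\<^sup>2" by (simp only: y1[symmetric])
    then have "x1 * x1 + x1 * x3 + x1 * x3 = - 2 * m * k"
      unfolding x3_def True[symmetric] by Groebner_Basis.algebra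
    then show ?thesis using True y y1 by simp
  next
    case False
    then have "m * (x2 - x1) = y2 - y1" by (simp add: m_def)
    then have y2: "y2 = m * x2 + k" using y1 by Groebner_Basis.algebra
    have "(x1 - x2) * (x1 * x1 + x1 * x2 + x2 * x2 - m\<^sup>2 * (x1 + x2) - 2 * m * k) = 0"
      using 1 2 unfolding y1 y2 by Groebner_Basis.algebra
    then have "x1 * x1 + x1 * x2 + x2 * x2 - m\<^sup>2 * (x1 + x2) - 2 * m * k = 0" using False by auto
    then show ?thesis using y2 unfolding x3_def by Groebner_Basis.algebra
  qed
  have "x1 * x2 * x3 = k\<^sup>2 - z\<^sup>2"
    using * 1 y1 unfolding x3_def by Groebner_Basis.algebra
  moreover have "add_point (Affine x1 y1) (Affine x2 y2) = Affine x3 (- (m * x3 + k))"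
    using ne by (simp add: m_def[symmetric] x3_def Let_def k_def algebra_simps)
  ultimately show thesis using that[of m k x3] y1 * by (simp add: x3_def)
qed

text \<open>At three collinear points the values of \<open>y + w\<close>, with \<open>w = z\<close>
  or \<open>w = - z\<close>, have product \<open>(k + w) ^ 3\<close>, so the three characters
  multiply to 1. Since \<open>k + z\<close> and \<open>k - z\<close> cannot both vanish, one of the
  two branches of \<open>pt_char\<close> is usable at all three points.\<close>

lemma add_point_curve_char:
  assumes P: "P \<in> curve (z\<^sup>2)" and Q: "Q \<in> curve (z\<^sup>2)" and z: "z \<noteq> 0"
  shows "add_point P Q \<in> curve (z\<^sup>2) \<and> pt_char z (add_point P Q) = pt_char z P * pt_char z Q"
proof (cases P)
  case Infinity then show ?thesis using Q by simp
next
  case P1: (Affine x1 y1)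
  show ?thesis
  proof (cases Q)
    case Infinity then show ?thesis using P P1 by simp
  next
    case Q1: (Affine x2 y2)
    have c1: "y1\<^sup>2 = x1 ^ 3 + z\<^sup>2" and c2: "y2\<^sup>2 = x2 ^ 3 + z\<^sup>2" using P Q P1 Q1 by (auto simp: curve_def)
    show ?thesis
    proof (cases "x1 = x2 \<and> y1 = - y2")
      case True
      then have "P = neg_point Q" using P1 Q1 by simp
      then show ?thesis using pt_char_neg[OF Q z] P1 Q1 True by (simp add: curve_def)
    next
      case False
      obtain m k x3 where l: "y1 = m * x1 + k" "y2 = m * x2 + k"
        "add_point (Affine x1 y1) (Affine x2 y2) = Affine x3 (- (m * x3 + k))" and
        e: "x1 + x2 + x3 = m\<^sup>2" "x1 * x2 + x1 * x3 + x2 * x3 = - 2 * m * k" "x1 * x2 * x3 = k\<^sup>2 - z\<^sup>2"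
        using add_point_line[OF c1 c2 False] by blast
      define y3 where "y3 = m * x3 + k"
      have c3: "y3\<^sup>2 = x3 ^ 3 + z\<^sup>2" using e unfolding y3_def by Groebner_Basis.algebra
      have prod: "(y1 + w) * (y2 + w) * (y3 + w) = (k + w) ^ 3" if "w\<^sup>2 = z\<^sup>2" for w
        using e that unfolding y3_def l(1,2) by Groebner_Basis.algebra
      have R: "Affine x3 y3 \<in> curve (z\<^sup>2)" using c3 by (simp add: curve_def)
      have "pt_char z P * pt_char z Q * pt_char z (Affine x3 y3) = 1"
      proof (cases "y1 + z = 0 \<or> y2 + z = 0 \<or> y3 + z = 0")
        case False
        have "c (y1 + z) * c (y2 + z) * c (y3 + z) = c ((k + z) ^ 3)"
          using False c_mult[of "y1 + z" "y2 + z"] c_mult[of "(y1 + z) * (y2 + z)" "y3 + z"]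
          by (simp flip: prod)
        moreover have "k + z \<noteq> 0" using False prod[of z] by auto
        ultimately show ?thesis using False c_cube P1 Q1 by simp
      next
        case True
        then have "k + z = 0" using prod[of z] by auto
        then have "k + (- z) \<noteq> 0" using z two_nz by (auto simp: add_eq_0_iff2 simp flip: mult_2)
        then have nz: "k + (- z) \<noteq> 0" "y1 - z \<noteq> 0" "y2 - z \<noteq> 0" "y3 - z \<noteq> 0" using prod[of "- z"] by auto
        have "c (y1 - z) * c (y2 - z) * c (y3 - z) = c ((k + (- z)) ^ 3)"
          using nz c_mult[of "y1 - z" "y2 - z"] c_mult[of "(y1 - z) * (y2 - z)" "y3 - z"] prod[of "- z"]
          by simp
        then have "inverse (c (y1 - z)) * inverse (c (y2 - z)) * inverse (c (y3 - z)) = 1"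
          using c_cube[OF nz(1)] by (simp flip: inverse_mult_distrib)
        then show ?thesis unfolding P1 Q1
          using pt_char_alt[OF c1] pt_char_alt[OF c2] pt_char_alt[OF c3] nz by simp
      qed
      then have "pt_char z (neg_point (Affine x3 y3)) = pt_char z P * pt_char z Q"
        using pt_char_neg[OF R z] by (metis mult.assoc mult.commute mult.left_neutral)
      moreover have "add_point P Q = neg_point (Affine x3 y3)" using l(3) P1 Q1 by (simp add: y3_def)
      ultimately show ?thesis using neg_point_curve[OF R] by simp
    qed
  qed
qed

lemma mult_point_curve_char:
  assumes Q: "Q \<in> curve (z\<^sup>2)" and z: "z \<noteq> 0"
  shows "mult_point k Q \<in> curve (z\<^sup>2) \<and> pt_char z (mult_point k Q) = pt_char z Q ^ k"
proof (induction k)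
  case 0 show ?case by (simp add: mult_point_def curve_def)
next
  case (Suc k)
  have "mult_point (Suc k) Q = add_point Q (mult_point k Q)" by (simp add: mult_point_def)
  then show ?case using add_point_curve_char[OF Q _ z, of "mult_point k Q"] Suc by simp
qed

lemma pt_char_pow3:
  assumes "P \<in> curve (z\<^sup>2)" "z \<noteq> 0"
  shows "pt_char z P ^ 3 = 1"
proof (cases P)
  case (Affine x y)
  show ?thesis
  proof (cases "y + z = 0")
    case True
    then have "y = - z" by (simp add: add_eq_0_iff2)
    then have "y - z = - (2 * z)" by simp
    then have "y - z \<noteq> 0" using two_nz assms(2) by (metis mult_eq_0_iff neg_equal_0_iff_equal)
    then show ?thesis using True c_pow3 by (simp add: Affine power_inverse)
  qed (simp add: Affine c_pow3)
qed simp

text \<open>An image point has \<open>y + z\<close> and \<open>y - z\<close> equal to the cubes of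
  \<open>(Y + s * e) / X\<close> and \<open>(Y - s * e) / X\<close>. Conversely, cube roots
  \<open>w\<close>, \<open>v\<close> of \<open>y + z\<close>, \<open>y - z\<close> with
  \<open>w * v = x\<close> determine a preimage through the linear equations
  \<open>X * w = Y + s * e\<close> and \<open>X * v = Y - s * e\<close>.\<close>

lemma in_tau_image_iff:
  assumes P: "P \<in> curve (z\<^sup>2)" and z: "z \<noteq> 0" and d: "27 * d = - (z\<^sup>2)"
  shows "P \<in> tau d ` curve d \<longleftrightarrow> pt_char z P = 1"
proof -
  obtain s :: 'a where s: "s\<^sup>2 = - 3" using sqrt_minus_3 by blast
  have s0: "s \<noteq> 0" using s three_nz by auto
  \<comment> \<open>This scaling makes \<open>d = e\<^sup>2\<close>:
    \<open>27 d = - z\<^sup>2 = - 9 s\<^sup>2 e\<^sup>2 = 27 e\<^sup>2\<close>.\<close>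
  define e where "e = z / (3 * s)"
  have ze: "z = 3 * s * e" using s0 three_nz by (simp add: e_def)
  have e0: "e \<noteq> 0" using z s0 three_nz by (simp add: e_def)
  have n27: "(27::'a) \<noteq> 0"
  proof -
    have "(27::'a) = 3 ^ 3" by simp
    then show ?thesis using three_nz by (metis power_eq_0_iff)
  qed
  have "27 * d = 27 * e\<^sup>2" using d s unfolding ze by Groebner_Basis.algebra
  then have de: "d = e\<^sup>2" using n27 by simp
  have z2: "y + z \<noteq> 0 \<or> y - z \<noteq> 0" for y
  proof (rule ccontr)
    assume "\<not> ?thesis"
    then have "2 * z = 0" by Groebner_Basis.algebra
    then show False using two_nz z by simp
  qed
  show ?thesis
  proof (cases P)
    case Infinity
    have "Infinity \<in> curve d" by (simp add: curve_def)
    then have "tau d Infinity \<in> tau d ` curve d" by (rule imageI)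
    then show ?thesis using Infinity by simp
  next
    case (Affine x y)
    then have xy: "y\<^sup>2 = x ^ 3 + z\<^sup>2" using P by (auto simp: curve_def)
    show ?thesis
    proof
      assume "P \<in> tau d ` curve d"
      then obtain R where R: "R \<in> curve d" "tau d R = Affine x y" unfolding Affine by (metis imageE)
      obtain X Y where XY: "R = Affine X Y" using R by (cases R) auto
      have X0: "X \<noteq> 0" using R XY by (auto split: if_splits)
      have Yc: "Y\<^sup>2 = X ^ 3 + e\<^sup>2" using R XY de by (auto simp: curve_def)
      have y: "y * X ^ 3 = Y * (X ^ 3 - 8 * e\<^sup>2)" using R XY X0 by (auto simp: de split: if_splits)
      have p: "(y + z) * X ^ 3 = (Y + s * e) ^ 3" using y Yc s unfolding ze by Groebner_Basis.algebra
      have m: "(y - z) * X ^ 3 = (Y - s * e) ^ 3" using y Yc s unfolding ze by Groebner_Basis.algebra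
      have p': "y + z = ((Y + s * e) / X) ^ 3" using p X0 by (simp add: power_divide nonzero_eq_divide_eq)
      have m': "y - z = ((Y - s * e) / X) ^ 3" using m X0 by (simp add: power_divide nonzero_eq_divide_eq)
      show "pt_char z P = 1"
      proof (cases "y + z = 0")
        case False
        then have "c (y + z) = 1" using c_eq_1_iff p' by blast
        then show ?thesis using False Affine by simp
      next
        case True
        then have "c (y - z) = 1" using z2 c_eq_1_iff m' by blast
        then show ?thesis using True Affine by simp
      qed
    next
      assume ch: "pt_char z P = 1"
      \<comment> \<open>Independent cube roots would satisfy \<open>w * v = x\<close> only up to a
        cube root of unity, hence the choice \<open>v = x / w\<close>.\<close>
      obtain w v where wv: "y + z = w ^ 3" "y - z = v ^ 3" "w * v = x"
      proof (cases "y + z = 0")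
        case False
        then have "c (y + z) = 1" using ch Affine by simp
        then obtain w where w: "y + z = w ^ 3" using c_eq_1_iff False by blast
        have w0: "w \<noteq> 0" using w False by auto
        have "(y + z) * (y - z) = x ^ 3" using xy by Groebner_Basis.algebra
        then have "y - z = (x / w) ^ 3" using w w0 by (simp add: power_divide nonzero_eq_divide_eq mult.commute)
        then show thesis using that[of w "x / w"] w w0 by simp
      next
        case True
        have "y - z \<noteq> 0" using z2[of y] True by blast
        moreover have "c (y - z) = 1" using ch Affine True by simp
        ultimately obtain v where v: "y - z = v ^ 3" using c_eq_1_iff by blast
        have "x ^ 3 = (y + z) * (y - z)" using xy by Groebner_Basis.algebra
        then have "x = 0" using True by simp
        then show thesis using that[of 0 v] v True by simp
      qed
      have diff: "w ^ 3 - v ^ 3 = 6 * s * e" using wv(1,2) unfolding ze by Groebner_Basis.algebra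
      have six: "6 * s * e \<noteq> 0"
      proof -
        have "6 * s * e = 2 * (3 * (s * e))" by simp
        then show ?thesis using two_nz three_nz s0 e0 by (metis mult_eq_0_iff)
      qed
      have "w \<noteq> v" using diff six by auto
      \<comment> \<open>Both come from the difference and the sum of
        \<open>X * w = Y + s * e\<close> and \<open>X * v = Y - s * e\<close>.\<close>
      define X where "X = 2 * s * e / (w - v)"
      define Y where "Y = X * (w + v) / 2"
      have X1: "X * (w - v) = 2 * s * e" using \<open>w \<noteq> v\<close> by (simp add: X_def)
      have X0: "X \<noteq> 0" using \<open>w \<noteq> v\<close> s0 e0 two_nz by (simp add: X_def)
      have Y1: "2 * Y = X * (w + v)" using two_nz by (simp add: Y_def)
      \<comment> \<open>Here \<open>w ^ 3 - v ^ 3 = 2 z = 6 s e = 3 X (w - v)\<close>.\<close>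
      have "(w - v) * (w * w + w * v + v * v) = (w - v) * (3 * X)" using diff X1 by Groebner_Basis.algebra
      then have X3: "w * w + w * v + v * v = 3 * X" using \<open>w \<noteq> v\<close> unfolding mult_cancel_left right_minus_eq by blast
      have "12 * (Y\<^sup>2 - (X ^ 3 + e\<^sup>2)) = 0" using Y1 X3 X1 s by Groebner_Basis.algebra
      moreover have "(12::'a) \<noteq> 0"
      proof -
        have "(12::'a) = 2 * (2 * 3)" by simp
        then show ?thesis using two_nz three_nz by (metis mult_eq_0_iff)
      qed
      ultimately have Yc: "Y\<^sup>2 = X ^ 3 + e\<^sup>2" by (metis mult_eq_0_iff right_minus_eq)
      have ex: "Y\<^sup>2 + 3 * e\<^sup>2 = x * X\<^sup>2"
      proof -
        have "4 * ((Y\<^sup>2 + 3 * e\<^sup>2) - x * X\<^sup>2) = 0" using Y1 X1 s wv(3) by Groebner_Basis.algebra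
        moreover have "(4::'a) \<noteq> 0"
        proof -
          have "(4::'a) = 2 * 2" by simp
          then show ?thesis using two_nz by (metis mult_eq_0_iff)
        qed
        ultimately show ?thesis by (metis mult_eq_0_iff right_minus_eq)
      qed
      have w': "X * w = Y + s * e" and v': "X * v = Y - s * e"
      proof -
        have "2 * (X * w - (Y + s * e)) = 0" "2 * (X * v - (Y - s * e)) = 0" using Y1 X1 by Groebner_Basis.algebra+
        then show "X * w = Y + s * e" "X * v = Y - s * e" using two_nz by (metis mult_eq_0_iff right_minus_eq)+
      qed
      have "2 * y = w ^ 3 + v ^ 3" using wv(1,2) by Groebner_Basis.algebra
      then have "2 * (y * X ^ 3) = (X * w) ^ 3 + (X * v) ^ 3" by Groebner_Basis.algebra
      also have "\<dots> = 2 * (Y * (X ^ 3 - 8 * e\<^sup>2))" unfolding w' v' using Yc s by Groebner_Basis.algebra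
      finally have ey: "y * X ^ 3 = Y * (X ^ 3 - 8 * e\<^sup>2)" using two_nz by simp
      have "tau d (Affine X Y) = Affine x y" using X0 ex ey by (simp add: de nonzero_divide_eq_eq)
      moreover have "Affine X Y \<in> curve d" using Yc by (simp add: curve_def de)
      ultimately show "P \<in> tau d ` curve d" unfolding Affine by (metis imageI)
    qed
  qed
qed

text \<open>The exponent \<open>k\<close> is the logarithm of \<open>pt_char z P\<close> to the base
  \<open>q = pt_char z Q\<close>, and \<open>q\<close> is \<open>\<zeta>\<close> or
  \<open>\<zeta>\<^sup>2\<close>. In the second case \<open>\<zeta> = q\<^sup>2\<close>, so
  \<open>\<zeta> ^ k = (q ^ k)\<^sup>2\<close>: the auxiliary point influences the character only up
  to squaring.\<close>

lemma chi_tau_fiber_eq: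
  assumes P: "P \<in> curve (z\<^sup>2)" and z: "z \<noteq> 0" and d: "27 * d = - (z\<^sup>2)"
    and Q: "Q \<in> curve (z\<^sup>2) - tau d ` curve d" and \<zeta>: "\<zeta> ^ 3 = 1" "\<zeta> \<noteq> 1"
  shows "chi_tau_fiber \<zeta> d Q P = (if pt_char z Q = \<zeta> then pt_char z P else pt_char z P ^ 2)"
proof -
  have Qc: "Q \<in> curve (z\<^sup>2)" using Q by simp
  have Q1: "pt_char z Q \<noteq> 1" using in_tau_image_iff[OF Qc z d] Q by simp
  have iff: "add_point P (neg_point (mult_point k Q)) \<in> tau d ` curve d \<longleftrightarrow> pt_char z P = pt_char z Q ^ k" for k
  proof -
    have m: "mult_point k Q \<in> curve (z\<^sup>2)" "pt_char z (mult_point k Q) = pt_char z Q ^ k"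
      using mult_point_curve_char[OF Qc z] by auto
    have n: "neg_point (mult_point k Q) \<in> curve (z\<^sup>2)" using m(1) by (rule neg_point_curve)
    have "pt_char z (neg_point (mult_point k Q)) * pt_char z Q ^ k = 1" using pt_char_neg[OF m(1) z] m(2) by simp
    moreover have "pt_char z Q ^ k \<noteq> 0" using calculation by (metis mult_zero_right zero_neq_one)
    ultimately have "pt_char z P * pt_char z (neg_point (mult_point k Q)) = 1 \<longleftrightarrow> pt_char z P = pt_char z Q ^ k"
      by (metis mult.commute mult.right_neutral mult_cancel_left mult_zero_left one_neq_zero)
    then show ?thesis using add_point_curve_char[OF P n z] in_tau_image_iff[OF _ z d] by simp
  qed
  have cube: "u = 1 \<or> u = \<zeta> \<or> u = \<zeta>\<^sup>2" if "u ^ 3 = 1" for u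
  proof -
    have "\<zeta>\<^sup>2 + \<zeta> + 1 = 0"
    proof -
      have "(\<zeta> - 1) * (\<zeta>\<^sup>2 + \<zeta> + 1) = 0" using \<zeta>(1) by Groebner_Basis.algebra
      then show ?thesis using \<zeta>(2) by simp
    qed
    then have "(u - 1) * (u - \<zeta>) * (u - \<zeta>\<^sup>2) = 0" using that \<zeta>(1) by Groebner_Basis.algebra
    then show ?thesis by auto
  qed
  have z0: "\<zeta> \<noteq> 0" using \<zeta> by auto
  have z21: "\<zeta>\<^sup>2 \<noteq> 1" "\<zeta>\<^sup>2 \<noteq> \<zeta>"
  proof -
    show "\<zeta>\<^sup>2 \<noteq> 1" using \<zeta> by (metis mult_1 power2_eq_square power3_eq_cube)
    show "\<zeta>\<^sup>2 \<noteq> \<zeta>" using \<zeta>(2) z0 by (metis power2_eq_square mult_cancel_right1)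
  qed
  have Pz: "pt_char z P = 1 \<or> pt_char z P = \<zeta> \<or> pt_char z P = \<zeta>\<^sup>2" by (rule cube[OF pt_char_pow3[OF P z]])
  have Qz: "pt_char z Q = \<zeta> \<or> pt_char z Q = \<zeta>\<^sup>2" using cube[OF pt_char_pow3[OF Qc z]] Q1 by (elim disjE) simp_all
  define q where "q = pt_char z Q"
  have q3: "q ^ 3 = 1" and q1: "q \<noteq> 1" using pt_char_pow3[OF Qc z] Q1 unfolding q_def .
  have q0: "q \<noteq> 0" using q3 by (metis power_zero_numeral zero_neq_one)
  have q2: "q * q \<noteq> 1" using q1 q3 by (metis mult_1 power3_eq_cube)
  have q2': "q * q \<noteq> q" using q0 q1 by (metis mult_cancel_right1)
  have q_inj: "i = j" if "q ^ i = q ^ j" "i \<in> {0, 1, 2}" "j \<in> {0, 1, 2}" for i j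
  proof -
    have "i = 0 \<or> i = 1 \<or> i = 2" "j = 0 \<or> j = 1 \<or> j = 2" using that by auto
    moreover have "q ^ 0 = 1" "q ^ 1 = q" "q ^ 2 = q * q" by (simp_all add: power2_eq_square)
    ultimately show ?thesis using that(1) q1 q2 q2' by metis
  qed
  have the: "(THE k. k \<in> {0, 1, 2} \<and> pt_char z P = pt_char z Q ^ k) = j"
    if "j \<in> {0, 1, 2}" "pt_char z P = pt_char z Q ^ j" for j
  proof (rule the_equality)
    fix k assume k: "k \<in> {0, 1, 2} \<and> pt_char z P = pt_char z Q ^ k"
    then have "q ^ k = q ^ j" using that(2) unfolding q_def by metis
    then show "k = j" using k that(1) q_inj by metis
  qed (use that in blast)
  have zz: "(\<zeta>\<^sup>2)\<^sup>2 = \<zeta>" using \<zeta>(1) by Groebner_Basis.algebra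
  have val: "chi_tau_fiber \<zeta> d Q P = \<zeta> ^ j" if "j \<in> {0, 1, 2}" "pt_char z P = pt_char z Q ^ j" for j
    unfolding chi_tau_fiber_def iff the[OF that] ..
  show ?thesis
  proof (cases "pt_char z Q = \<zeta>")
    case True
    from Pz show ?thesis
    proof (elim disjE)
      assume P1: "pt_char z P = 1" show ?thesis unfolding True P1 using val[of 0] P1 by simp
    next
      assume P1: "pt_char z P = \<zeta>" show ?thesis unfolding True P1 using val[of 1] P1 True by simp
    next
      assume P1: "pt_char z P = \<zeta>\<^sup>2" show ?thesis unfolding True P1 using val[of 2] P1 True by simp
    qed
  next
    case False
    then have Q2: "pt_char z Q = \<zeta>\<^sup>2" using Qz by (elim disjE) simp_all
    from Pz show ?thesis
    proof (elim disjE)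
      assume P1: "pt_char z P = 1" show ?thesis unfolding if_not_P[OF False] P1 using val[of 0] P1 by simp
    next
      assume P1: "pt_char z P = \<zeta>"
      then have "pt_char z P = pt_char z Q ^ 2" unfolding Q2 zz by assumption
      from val[OF _ this] show ?thesis unfolding if_not_P[OF False] P1 by simp
    next
      assume P1: "pt_char z P = \<zeta>\<^sup>2"
      then have "pt_char z P = pt_char z Q ^ 1" unfolding Q2 power_one_right by assumption
      from val[OF _ this] show ?thesis unfolding if_not_P[OF False] P1 zz by simp
    qed
  qed
qed

end

section \<open>Existence of a cubic character of the prime field\<close>

text \<open>For a primitive root \<open>g\<close>, the value at \<open>g ^ i\<close> is
  \<open>\<zeta> ^ i\<close>. Exponents are determined modulo \<open>p - 1\<close>, a multiple of 3,
  so the value does not depend on the exponent chosen.\<close>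

lemma cubic_character_exists:
  fixes \<zeta> :: complex
  assumes p: "CARD('p::prime_card) mod 3 = 1" and \<zeta>: "\<zeta> ^ 3 = 1" "\<zeta> \<noteq> 1"
  obtains c :: "'p::prime_card mod_ring \<Rightarrow> complex" where "cubic_character c" "\<exists>v. v \<noteq> 0 \<and> c v \<noteq> 1"
proof -
  define p where "p = CARD('p)"
  have prime: "prime p" using prime_card[where 'a = 'p] by (simp add: p_def)
  have p3: "p mod 3 = 1" using p by (simp add: p_def)
  have p2: "p > 3"
    using prime_gt_1_nat[OF prime] p3 by (cases "p = 2 \<or> p = 3") auto
  have podd: "odd p" using prime p2 prime_odd_nat by auto
  have eq: "(of_nat a :: 'p mod_ring) = of_nat b \<longleftrightarrow> [a = b] (mod p)" for a b
    by (simp add: of_nat_eq_iff_cong_CHAR p_def)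
  obtain g0 where g0: "residue_primroot p g0"
    using prime_primitive_root_exists[of p] prime prime_gt_1_nat[OF prime] by auto
  have ord: "ord p g0 = p - 1" "coprime p g0" using g0 prime by (auto simp: residue_primroot_def totient_prime)
  define g :: "'p mod_ring" where "g = of_nat g0"
  have geq: "g ^ i = g ^ j \<longleftrightarrow> [i = j] (mod (p - 1))" for i j
  proof -
    have "g ^ i = g ^ j \<longleftrightarrow> [g0 ^ i = g0 ^ j] (mod p)"
      unfolding g_def eq[symmetric] by simp
    then show ?thesis using order_divides_expdiff[OF ord(2)] ord(1) by simp
  qed
  have g_nz: "g \<noteq> 0"
  proof
    assume "g = 0"
    then have "of_nat g0 = (of_nat 0 :: 'p mod_ring)" by (simp add: g_def)
    then have "p dvd g0" unfolding eq by (simp add: cong_0_iff)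
    then show False using ord(2) prime by (metis coprime_absorb_left not_prime_unit)
  qed
  have gen: "\<exists>i. u = g ^ i" if "u \<noteq> 0" for u
  proof -
    obtain a where a: "u = of_nat a" "a < p" using surj_of_nat_mod_ring[of u] by (auto simp: p_def)
    have "a \<noteq> 0" using a that by (intro notI) auto
    then have "a \<in> totatives p" using a prime
      by (auto simp: totatives_def coprime_commute prime_nat_iff'' intro!: prime_imp_coprime dest: dvd_imp_le)
    then obtain i where "a = g0 ^ i mod p"
      using residue_primroot_is_generator[OF prime_gt_1_nat[OF prime] g0] by (auto simp: bij_betw_def)
    then have "[a = g0 ^ i] (mod p)" by (simp add: unique_euclidean_semiring_class.cong_def)
    then show ?thesis using a(1) eq[of a "g0 ^ i"] by (auto simp: g_def)
  qed
  have p13: "3 dvd p - 1" using p3 p2 by presburger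
  have cong3: "[i = j] (mod 3)" if "g ^ i = g ^ j" for i j
    using that p13 unfolding geq by (rule cong_dvd_modulus_nat)
  define idx where "idx u = (SOME i. u = g ^ i)" for u
  have idx: "g ^ idx u = u" if "u \<noteq> 0" for u
    using someI_ex[OF gen[OF that]] by (simp add: idx_def)
  define c where "c u = \<zeta> ^ idx u" for u
  have z3: "\<zeta> ^ i = \<zeta> ^ (i mod 3)" for i
  proof -
    have "\<zeta> ^ i = \<zeta> ^ (3 * (i div 3) + i mod 3)" by simp
    also have "\<dots> = \<zeta> ^ (i mod 3)" unfolding power_add power_mult \<zeta>(1) by simp
    finally show ?thesis .
  qed
  have zc: "\<zeta> ^ i = \<zeta> ^ j" if "[i = j] (mod 3)" for i j
    using z3[of i] z3[of j] that by (simp add: unique_euclidean_semiring_class.cong_def)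
  have z1: "\<zeta> ^ i = 1 \<longleftrightarrow> 3 dvd i" for i
  proof -
    have "i mod 3 = 0 \<or> i mod 3 = 1 \<or> i mod 3 = 2" by presburger
    moreover have "\<zeta> * \<zeta> \<noteq> 1" using \<zeta> by (metis mult_1 power3_eq_cube)
    moreover have "\<zeta> ^ 0 = 1" "\<zeta> ^ 1 = \<zeta>" "\<zeta> ^ 2 = \<zeta> * \<zeta>" by (simp_all add: power2_eq_square)
    moreover have "3 dvd i \<longleftrightarrow> i mod 3 = 0" by (rule dvd_eq_mod_eq_0)
    ultimately show ?thesis using z3[of i] \<zeta>(2) by (metis one_neq_zero zero_neq_numeral)
  qed
  have "cubic_character c"
  proof
    fix u v :: "'p mod_ring" assume uv: "u \<noteq> 0" "v \<noteq> 0"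
    have "g ^ idx (u * v) = g ^ (idx u + idx v)" using uv by (simp add: idx power_add)
    then have "[idx (u * v) = idx u + idx v] (mod 3)" by (rule cong3)
    then show "c (u * v) = c u * c v" unfolding c_def power_add[symmetric] by (rule zc)
  next
    fix u :: "'p mod_ring" assume u: "u \<noteq> 0"
    show "c u = 1 \<longleftrightarrow> (\<exists>w. u = w ^ 3)"
    proof
      assume "c u = 1"
      then obtain k where "idx u = 3 * k" using z1 by (auto simp: c_def)
      then have "u = g ^ (k * 3)" using idx[OF u] by (simp only: mult.commute)
      then have "u = (g ^ k) ^ 3" unfolding power_mult .
      then show "\<exists>w. u = w ^ 3" ..
    next
      assume "\<exists>w. u = w ^ 3"
      then obtain w where w: "u = w ^ 3" ..
      then have "w \<noteq> 0" using u by auto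
      then have "g ^ (idx w * 3) = u" unfolding power_mult w by (subst idx) auto
      then have "g ^ idx u = g ^ (3 * idx w)" unfolding idx[OF u] by (simp only: mult.commute)
      then have "[idx u = 3 * idx w] (mod 3)" by (rule cong3)
      then show "c u = 1" unfolding c_def z1 by (simp add: unique_euclidean_semiring_class.cong_def dvd_eq_mod_eq_0)
    qed
  next
    have nz: "(of_nat n :: 'p mod_ring) \<noteq> 0" if "0 < n" "n < p" for n
      using that eq[of n 0] by (auto simp: cong_0_iff dest: dvd_imp_le)
    show "(2::'p mod_ring) \<noteq> 0" "(3::'p mod_ring) \<noteq> 0" using nz[of 2] nz[of 3] p2 by auto
  next
    \<comment> \<open>A primitive cube root of unity in the field; \<open>2 * w + 1\<close> is then
      a square root of \<open>- 3\<close>.\<close>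
    define w where "w = g ^ ((p - 1) div 3)"
    have "w ^ 3 = g ^ (p - 1)" using p13 by (simp add: w_def flip: power_mult)
    then have w3: "w ^ 3 = 1" using geq[of "p - 1" 0] by (simp add: cong_0_iff)
    have "w \<noteq> 1"
    proof
      assume "w = 1"
      then have "p - 1 dvd (p - 1) div 3" using geq[of "(p - 1) div 3" 0] by (simp add: w_def cong_0_iff)
      then have "p - 1 \<le> (p - 1) div 3" using p2 p13 by (intro dvd_imp_le) auto
      then show False using p2 by linarith
    qed
    moreover have "(w - 1) * (w\<^sup>2 + w + 1) = 0" using w3 by Groebner_Basis.algebra
    ultimately have "w\<^sup>2 + w + 1 = 0" by simp
    then have "(2 * w + 1)\<^sup>2 = - 3" by Groebner_Basis.algebra
    then show "\<exists>s::'p mod_ring. s\<^sup>2 = - 3" by blast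
  qed
  moreover have "c g \<noteq> 1"
  proof
    assume "c g = 1"
    then have "3 dvd idx g" using z1 by (simp add: c_def)
    moreover have "[idx g = 1] (mod 3)" using idx[OF g_nz] by (intro cong3) simp
    ultimately show False by (simp add: unique_euclidean_semiring_class.cong_def dvd_eq_mod_eq_0)
  qed
  ultimately show thesis using that g_nz by blast
qed

section \<open>The sum over the surface as a sum over squares\<close>

lemma diff_half_sum: "(y + z) - (y - z) = z + (z :: 'a :: ab_group_add)"
  by simp

lemma sum_half_sum: "(y + z) + (y - z) = y + (y :: 'a :: ab_group_add)"
  by simp

lemma (in cubic_character) character_sum_zero:
  assumes "finite (UNIV :: 'a set)" "\<exists>v. v \<noteq> 0 \<and> c v \<noteq> 1"
  shows "(\<Sum>u\<in>-{0}. c u) = 0"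
proof -
  obtain v where v: "v \<noteq> 0" "c v \<noteq> 1" using assms by blast
  have "(\<Sum>u\<in>-{0}. c u) = (\<Sum>u\<in>-{0}. c (v * u))"
    by (rule sum.reindex_bij_witness[of _ "\<lambda>u. v * u" "\<lambda>u. u / v"]) (use v in auto)
  also have "\<dots> = (\<Sum>u\<in>-{0}. c v * c u)" using v by (intro sum.cong refl c_mult) auto
  also have "\<dots> = c v * (\<Sum>u\<in>-{0}. c u)" by (simp add: sum_distrib_left)
  finally show ?thesis using v(2) by (metis mult_cancel_right1)
qed

lemma S_tau_eq_sum_squares:
  fixes \<zeta> :: complex and Q :: "'p::prime_card mod_ring \<Rightarrow> 'p mod_ring point"
  assumes p: "CARD('p) mod 3 = 1" and \<zeta>: "\<zeta> ^ 3 = 1" "\<zeta> \<noteq> 1"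
    and Q: "\<And>z. z \<noteq> 0 \<Longrightarrow> Q z \<in> curve (- 27 * fiber_param z) - tau (fiber_param z) ` curve (fiber_param z)"
  shows "S_tau \<zeta> Q = - (\<Sum>t\<in>-{0}. of_int (to_int_mod_ring ((t :: 'p mod_ring)\<^sup>2)))"
proof -
  obtain c :: "'p mod_ring \<Rightarrow> complex" where c: "cubic_character c" and cv: "\<exists>v. v \<noteq> 0 \<and> c v \<noteq> 1"
    by (rule cubic_character_exists[OF p \<zeta>])
  interpret cubic_character c by (rule c)
  define X :: "'p mod_ring \<Rightarrow> complex" where "X x = of_int (to_int_mod_ring x)" for x
  have X0: "X 0 = 0" by (simp add: X_def)
  have fin: "finite (A :: ('p mod_ring) set)" "finite (B :: ('p mod_ring \<times> 'p mod_ring) set)"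
    "finite (C :: ('p mod_ring \<times> 'p mod_ring \<times> 'p mod_ring) set)" for A B C by simp_all
  have n27: "(27::'p mod_ring) \<noteq> 0"
  proof -
    have "(27::'p mod_ring) = 3 ^ 3" by simp
    then show ?thesis using three_nz by (metis power_eq_0_iff)
  qed
  define C where "C = (\<lambda>(x, y, z). pt_char z (Affine x y))"
  define q where "q z \<longleftrightarrow> pt_char z (Q z) = \<zeta>" for z
  have chi: "chi_tau \<zeta> Q (x, y, z) = (if q z then C (x, y, z) else C (x, y, z) ^ 2)"
    if "(x, y, z) \<in> surface" for x y z
  proof -
    have z: "z \<noteq> 0" and P: "Affine x y \<in> curve (z\<^sup>2)" using that by (auto simp: surface_def curve_def)
    have d: "27 * fiber_param z = - (z\<^sup>2)" using n27 by (simp add: fiber_param_def)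
    then have "- 27 * fiber_param z = z\<^sup>2" by simp
    then have "Q z \<in> curve (z\<^sup>2) - tau (fiber_param z) ` curve (fiber_param z)" using Q[OF z] by metis
    from chi_tau_fiber_eq[OF P z d this \<zeta>] show ?thesis by (simp add: chi_tau_def C_def q_def)
  qed
  \<comment> \<open>On fibres whose auxiliary point produces the squared, hence inverse, character,
    the involution \<open>y \<mapsto> - y\<close> undoes the inversion while keeping
    \<open>x\<close>.\<close>
  define h where "h = (\<lambda>(x, y, z). (x :: 'p mod_ring, if q z then y else - (y :: 'p mod_ring), z :: 'p mod_ring))"
  have hh: "h (h s) = s" for s by (cases s) (simp add: h_def)
  have hs: "h s \<in> surface" if "s \<in> surface" for s using that by (cases s) (auto simp: h_def surface_def)
  have Ch: "C (h (x, y, z)) = chi_tau \<zeta> Q (x, y, z)" if "(x, y, z) \<in> surface" for x y z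
  proof -
    have z: "z \<noteq> 0" and P: "Affine x y \<in> curve (z\<^sup>2)" using that by (auto simp: surface_def curve_def)
    have "pt_char z (Affine x (- y)) * pt_char z (Affine x y) = 1" "pt_char z (Affine x y) ^ 3 = 1"
      using pt_char_neg[OF P z] pt_char_pow3[OF P z] by simp_all
    then have e: "pt_char z (Affine x (- y)) = pt_char z (Affine x y) ^ 2" by Groebner_Basis.algebra
    show ?thesis unfolding chi[OF that] h_def C_def prod.case
      by (cases "q z") (simp_all only: if_True if_False e)
  qed
  have "S_tau \<zeta> Q = (\<Sum>(x, y, z)\<in>surface. X x * C (h (x, y, z)))"
    unfolding S_tau_def X_def by (intro sum.cong refl) (auto simp: Ch)
  also have "\<dots> = (\<Sum>(x, y, z)\<in>surface. X x * C (x, y, z))"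
    by (rule sum.reindex_bij_witness[of _ h h]) (use hh hs in \<open>auto simp: h_def\<close>)
  \<comment> \<open>The weight is 0 at \<open>x = 0\<close>, the only place where
    \<open>y + z\<close> can vanish; afterwards the first branch of \<open>pt_char\<close> always
    applies.\<close>
  also have "\<dots> = (\<Sum>(x, y, z)\<in>{s \<in> surface. fst s \<noteq> 0}. X x * C (x, y, z))"
    by (rule sum.mono_neutral_right) (auto simp: X0 fin)
  also have "\<dots> = (\<Sum>(x, y, z)\<in>{s \<in> surface. fst s \<noteq> 0}. X x * c (y + z))"
  proof (intro sum.cong refl)
    fix s assume s: "s \<in> {s :: 'p mod_ring \<times> 'p mod_ring \<times> 'p mod_ring. s \<in> surface \<and> fst s \<noteq> 0}"
    obtain x y z where [simp]: "s = (x, y, z)" by (cases s)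
    have "y + z \<noteq> 0"
    proof
      assume "y + z = 0"
      moreover have "(y + z) * (y - z) = x ^ 3" using s by (simp add: surface_def algebra_simps power2_eq_square)
      ultimately show False using s by simp
    qed
    then show "(case s of (x, y, z) \<Rightarrow> X x * C (x, y, z)) = (case s of (x, y, z) \<Rightarrow> X x * c (y + z))"
      by (simp add: C_def)
  qed
  \<comment> \<open>With \<open>u = y + z\<close> one has \<open>y - z = x ^ 3 / u\<close>, so the
    condition \<open>z \<noteq> 0\<close> becomes \<open>u \<noteq> x ^ 3 / u\<close>.\<close>
  also have "\<dots> = (\<Sum>(x, u)\<in>{(x, u). x \<noteq> 0 \<and> u \<noteq> 0 \<and> u\<^sup>2 \<noteq> x ^ 3}. X x * c u)"
  proof (rule sum.reindex_bij_witness[of _ "\<lambda>(x, u). (x, (u + x ^ 3 / u) / 2, (u - x ^ 3 / u) / 2)" "\<lambda>(x, y, z). (x, y + z)"])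
    fix s :: "'p mod_ring \<times> 'p mod_ring \<times> 'p mod_ring" assume s: "s \<in> {s \<in> surface. fst s \<noteq> 0}"
    obtain x y z where [simp]: "s = (x, y, z)" by (cases s)
    have e: "(y + z) * (y - z) = x ^ 3" "x \<noteq> 0" "z \<noteq> 0" using s by (auto simp: surface_def algebra_simps power2_eq_square)
    then have u: "y + z \<noteq> 0" by auto
    have v: "x ^ 3 / (y + z) = y - z" using e(1) u by (simp add: divide_eq_eq mult.commute)
    have "(y + z + (y - z)) / 2 = y" "(y + z - (y - z)) / 2 = z"
      unfolding sum_half_sum diff_half_sum mult_2[symmetric] nonzero_mult_div_cancel_left[OF two_nz] by (rule refl)+
    then show "(case case s of (x, y, z) \<Rightarrow> (x, y + z) of (x, u) \<Rightarrow> (x, (u + x ^ 3 / u) / 2, (u - x ^ 3 / u) / 2)) = s"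
      using v by simp
    have "(y + z)\<^sup>2 \<noteq> x ^ 3"
    proof
      assume "(y + z)\<^sup>2 = x ^ 3"
      then have "(y + z) * (y + z) = (y + z) * (y - z)" using e(1) by (metis power2_eq_square)
      then have "y + z = y - z" using u by (metis mult_cancel_left)
      then have "(y + z) - (y - z) = 0" unfolding right_minus_eq .
      moreover have "(y + z) - (y - z) = 2 * z" unfolding mult_2 by (rule diff_half_sum)
      ultimately have "2 * z = 0" by (rule back_subst[of "\<lambda>w. w = 0"])
      then show False using two_nz e(3) by (metis mult_eq_0_iff)
    qed
    then show "(case s of (x, y, z) \<Rightarrow> (x, y + z)) \<in> {(x, u). x \<noteq> 0 \<and> u \<noteq> 0 \<and> u\<^sup>2 \<noteq> x ^ 3}" using e(2) u by simp
    show "(case case s of (x, y, z) \<Rightarrow> (x, y + z) of (x, u) \<Rightarrow> X x * c u) = (case s of (x, y, z) \<Rightarrow> X x * c (y + z))"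
      by (simp only: \<open>s = (x, y, z)\<close> prod.case)
  next
    fix r :: "'p mod_ring \<times> 'p mod_ring" assume r: "r \<in> {(x, u). x \<noteq> 0 \<and> u \<noteq> 0 \<and> u\<^sup>2 \<noteq> x ^ 3}"
    obtain x u where [simp]: "r = (x, u)" by (cases r)
    have xu: "x \<noteq> 0" "u \<noteq> 0" "u\<^sup>2 \<noteq> x ^ 3" using r by auto
    define v where "v = x ^ 3 / u"
    have uv: "u * v = x ^ 3" using xu by (simp add: v_def)
    have "v \<noteq> u"
    proof
      assume "v = u"
      then have "u * u = x ^ 3" using uv by metis
      then show False using xu(3) by (simp only: power2_eq_square simp_thms)
    qed
    then have z: "(u - v) / 2 \<noteq> 0" using two_nz by simp
    have half: "(a + b) / 2 + (a - b) / 2 = a \<and> (a + b) / 2 - (a - b) / 2 = b" for a b :: "'p mod_ring"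
    proof -
      have "(a + b) / 2 + (a - b) / 2 = (2 * a) / 2"
        unfolding add_divide_distrib[symmetric] mult_2 sum_half_sum ..
      moreover have "(a + b) / 2 - (a - b) / 2 = (2 * b) / 2"
        unfolding diff_divide_distrib[symmetric] mult_2 diff_half_sum ..
      ultimately show ?thesis unfolding nonzero_mult_div_cancel_left[OF two_nz] by (rule conjI)
    qed
    have s1: "(u + v) / 2 + (u - v) / 2 = u" and s2: "(u + v) / 2 - (u - v) / 2 = v" using half by blast+
    have "((u + v) / 2)\<^sup>2 - ((u - v) / 2)\<^sup>2 = x ^ 3"
      using uv s1 s2 by (metis mult.commute square_diff_square_factored power2_eq_square)
    then have "((u + v) / 2)\<^sup>2 = x ^ 3 + ((u - v) / 2)\<^sup>2" by (simp add: algebra_simps)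
    then show "(case r of (x, u) \<Rightarrow> (x, (u + x ^ 3 / u) / 2, (u - x ^ 3 / u) / 2)) \<in> {s \<in> surface. fst s \<noteq> 0}"
      using z xu by (simp add: surface_def v_def)
    show "(case case r of (x, u) \<Rightarrow> (x, (u + x ^ 3 / u) / 2, (u - x ^ 3 / u) / 2) of (x, y, z) \<Rightarrow> (x, y + z)) = r"
      using s1 by (simp add: v_def)
  qed
  also have "\<dots> = (\<Sum>(x, u)\<in>(-{0}) \<times> (-{0}). X x * c u) - (\<Sum>(x, u)\<in>{(x, u). x \<noteq> 0 \<and> u \<noteq> 0 \<and> u\<^sup>2 = x ^ 3}. X x * c u)"
    unfolding eq_diff_eq by (subst sum.union_disjoint[symmetric]) (auto simp: fin intro!: sum.cong)
  also have "(\<Sum>(x, u)\<in>(-{0}) \<times> (-{0}). X x * c u) = 0"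
    using character_sum_zero[OF _ cv] by (simp add: sum.cartesian_product[symmetric] sum_distrib_left[symmetric])
  \<comment> \<open>The excluded pairs form the cuspidal cubic \<open>u\<^sup>2 = x ^ 3\<close>,
    parametrised by \<open>t = u / x\<close>; on it \<open>u = t ^ 3\<close> is a cube and the
    character is 1.\<close>
  also have "(\<Sum>(x, u)\<in>{(x, u). x \<noteq> 0 \<and> u \<noteq> 0 \<and> u\<^sup>2 = x ^ 3}. X x * c u) = (\<Sum>t\<in>-{0}. X (t\<^sup>2))"
  proof (rule sum.reindex_bij_witness[of _ "\<lambda>t. (t\<^sup>2, t ^ 3)" "\<lambda>(x, u). u / x"])
    fix r :: "'p mod_ring \<times> 'p mod_ring" assume r: "r \<in> {(x, u). x \<noteq> 0 \<and> u \<noteq> 0 \<and> u\<^sup>2 = x ^ 3}"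
    obtain x u where [simp]: "r = (x, u)" by (cases r)
    have xu: "x \<noteq> 0" "u \<noteq> 0" "u\<^sup>2 = x ^ 3" using r by auto
    define t where "t = u / x"
    have t: "u = t * x" "t \<noteq> 0" using xu by (auto simp: t_def)
    have "(t * x)\<^sup>2 = x ^ 3" using xu(3) unfolding t(1) .
    then have "(x * x) * t\<^sup>2 = (x * x) * x" by (simp only: power_mult_distrib power2_eq_square power3_eq_cube mult_ac)
    then have tx: "t\<^sup>2 = x" using xu(1) by (metis mult_cancel_left mult_eq_0_iff)
    have tu: "t ^ 3 = u" unfolding t(1) using tx by (metis power3_eq_cube power2_eq_square mult.commute)
    show "((case r of (x, u) \<Rightarrow> u / x)\<^sup>2, (case r of (x, u) \<Rightarrow> u / x) ^ 3) = r"
      by (simp only: \<open>r = (x, u)\<close> prod.case t_def[symmetric] tx tu)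
    show "(case r of (x, u) \<Rightarrow> u / x) \<in> - {0}" using xu by simp
    have "c u = 1" using c_cube[OF t(2)] unfolding tu .
    then show "X ((case r of (x, u) \<Rightarrow> u / x)\<^sup>2) = (case r of (x, u) \<Rightarrow> X x * c u)"
      by (simp only: \<open>r = (x, u)\<close> prod.case t_def[symmetric] tx mult_1_right)
  next
    fix t :: "'p mod_ring" assume "t \<in> - {0}"
    then show "(case (t\<^sup>2, t ^ 3) of (x, u) \<Rightarrow> u / x) = t"
      "(t\<^sup>2, t ^ 3) \<in> {(x, u). x \<noteq> 0 \<and> u \<noteq> 0 \<and> u\<^sup>2 = x ^ 3}"
      by (simp_all add: power2_eq_square power3_eq_cube mult_ac)
  qed
  finally show ?thesis by (simp add: X_def)
qed

lemma sum_squares_mod_ring: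
  assumes "CARD('p::prime_card) = p"
  shows "(\<Sum>t\<in>-{0}. to_int_mod_ring ((t :: 'p mod_ring)\<^sup>2)) = (\<Sum>k\<in>{1..<p}. int (k\<^sup>2 mod p))"
proof (rule sum.reindex_bij_witness[of _ "\<lambda>k. of_nat k" "\<lambda>t. nat (to_int_mod_ring t)"])
  have p: "p > 1" using assms prime_card[where 'a = 'p] prime_gt_1_nat by auto
  have rng: "0 \<le> to_int_mod_ring t \<and> to_int_mod_ring t < int p" for t :: "'p mod_ring"
    using rangeI[of to_int_mod_ring t] unfolding range_to_int_mod_ring assms by simp
  have of_nat: "(of_nat k :: 'p mod_ring) = of_int_mod_ring (int k)" for k
    by (simp add: of_nat_of_int_mod_ring)
  have to: "to_int_mod_ring (of_int_mod_ring k :: 'p mod_ring) = k mod int p" for k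
  proof -
    have "(of_int_mod_ring k :: 'p mod_ring) = of_int_mod_ring (k mod int p)"
      using of_int_mod_CHAR[where 'a = "'p mod_ring", of k] assms by (simp add: of_int_of_int_mod_ring)
    then show ?thesis using to_int_mod_ring_of_int_mod_ring[where 'a = 'p, of "k mod int p"] p assms by simp
  qed
  fix t :: "'p mod_ring" assume t: "t \<in> - {0}"
  show "of_nat (nat (to_int_mod_ring t)) = t" using rng[of t] by (simp add: of_nat)
  have "to_int_mod_ring t \<noteq> 0" using t by simp
  then have "to_int_mod_ring t > 0" using rng[of t] by linarith
  then show "nat (to_int_mod_ring t) \<in> {1..<p}" using rng[of t] by (simp add: Suc_le_eq nat_less_iff)
  define k where "k = to_int_mod_ring t"
  have "t = of_int_mod_ring k" by (simp add: k_def)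
  then have "t\<^sup>2 = of_int_mod_ring (k\<^sup>2)" by (simp add: of_int_of_int_mod_ring[symmetric])
  then have "to_int_mod_ring (t\<^sup>2) = k\<^sup>2 mod int p" using to by simp
  then show "int ((nat (to_int_mod_ring t))\<^sup>2 mod p) = to_int_mod_ring (t\<^sup>2)"
    using rng[of t] by (simp add: k_def zmod_int)
next
  have p: "p > 1" using assms prime_card[where 'a = 'p] prime_gt_1_nat by auto
  have of_nat: "(of_nat k :: 'p mod_ring) = of_int_mod_ring (int k)" for k
    by (simp add: of_nat_of_int_mod_ring)
  fix k assume k: "k \<in> {1..<p}"
  then have e: "to_int_mod_ring (of_nat k :: 'p mod_ring) = int k" unfolding of_nat using assms by (intro to_int_mod_ring_of_int_mod_ring) auto
  then show "nat (to_int_mod_ring (of_nat k :: 'p mod_ring)) = k" by simp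
  have "(of_nat k :: 'p mod_ring) \<noteq> 0" using e k by auto
  then show "(of_nat k :: 'p mod_ring) \<in> - {0}" by simp
qed

section \<open>Theta series of binary quadratic forms\<close>

lemma mono_bdd_tendsto_at_top:
  fixes f :: "real \<Rightarrow> real"
  assumes "mono f" "\<And>x. f x \<le> B"
  obtains L where "(f \<longlongrightarrow> L) at_top"
proof -
  have "incseq (\<lambda>n. f (real n))" using assms(1) by (auto simp: incseq_def mono_def)
  moreover have "bdd_above (range (\<lambda>n. f (real n)))" using assms(2) by (auto intro!: bdd_aboveI)
  ultimately have "(\<lambda>n. f (real n)) \<longlonglongrightarrow> (SUP n. f (real n))"
    by (intro LIMSEQ_incseq_SUP)
  then have "(f \<longlongrightarrow> (SUP n. f (real n))) at_top"
    using assms(1) by (intro tendsto_at_topI_sequentially_real)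
  then show thesis by (rule that)
qed

text \<open>From \<open>exp (- x\<^sup>2) \<le> 1 / (1 + x\<^sup>2)\<close> both
  \<open>\<Phi>\<close> and \<open>arctan - \<Phi>\<close> are increasing, so \<open>\<Phi>\<close>
  is monotone and bounded.\<close>

lemma gaussian_antiderivative:
  obtains \<Phi> :: "real \<Rightarrow> real" and L1 L2 where
    "\<And>x. (\<Phi> has_real_derivative exp (- x\<^sup>2)) (at x)" "(\<Phi> \<longlongrightarrow> L1) at_top" "(\<Phi> \<longlongrightarrow> L2) at_bot"
proof -
  obtain \<Phi> :: "real \<Rightarrow> real" where \<Phi>: "\<And>x. (\<Phi> has_vector_derivative exp (- x\<^sup>2)) (at x)"
    using einterval_antiderivative[of "-\<infinity>" "\<infinity>" "\<lambda>x. exp (- x\<^sup>2)"] by auto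
  then have d: "(\<Phi> has_real_derivative exp (- x\<^sup>2)) (at x)" for x
    by (simp add: has_real_derivative_iff_has_vector_derivative)
  have mono: "mono \<Phi>"
    by (rule monoI, erule DERIV_nonneg_imp_nondecreasing[where f = \<Phi>]) (metis d exp_ge_zero)
  have ge: "exp (x\<^sup>2) \<ge> 1 + x\<^sup>2" for x :: real by simp
  have mono2: "mono (\<lambda>x. arctan x - \<Phi> x)"
  proof (rule monoI, erule DERIV_nonneg_imp_nondecreasing)
    fix a b x :: real
    have "((\<lambda>x. arctan x - \<Phi> x) has_real_derivative inverse (1 + x\<^sup>2) - exp (- x\<^sup>2)) (at x)"
      by (rule derivative_eq_intros d refl)+ auto
    moreover have "inverse (1 + x\<^sup>2) - exp (- x\<^sup>2) \<ge> 0"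
      using ge[of x] by (auto simp: exp_minus intro!: le_imp_inverse_le add_pos_nonneg)
    ultimately show "\<exists>y. ((\<lambda>x. arctan x - \<Phi> x) has_real_derivative y) (at x) \<and> 0 \<le> y" by blast
  qed
  have pi: "pi \<le> 4" using pi_less_4 by simp
  have up: "\<Phi> x \<le> \<Phi> 0 + 2" for x
  proof (cases "x \<ge> 0")
    case True
    then show ?thesis using monoD[OF mono2, of 0 x] arctan_ubound[of x] pi by auto
  qed (use monoD[OF mono, of x 0] in auto)
  have lo: "- \<Phi> x \<le> - \<Phi> 0 + 2" for x
  proof (cases "x \<le> 0")
    case True
    then show ?thesis using monoD[OF mono2, of x 0] arctan_lbound[of x] pi by auto
  qed (use monoD[OF mono, of 0 x] in auto)
  obtain L1 where 1: "(\<Phi> \<longlongrightarrow> L1) at_top" using mono_bdd_tendsto_at_top[OF mono up] by blast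
  have "mono (\<lambda>x. - \<Phi> (- x))" using mono by (auto simp: mono_def)
  then obtain L2 where 2: "((\<lambda>x. - \<Phi> (- x)) \<longlongrightarrow> L2) at_top"
    using mono_bdd_tendsto_at_top[of "\<lambda>x. - \<Phi> (- x)" "- \<Phi> 0 + 2"] lo by blast
  have "(\<Phi> \<longlongrightarrow> - L2) at_bot"
    using tendsto_minus[OF 2] by (simp add: filterlim_at_bot_mirror)
  then show thesis using that d 1 by blast
qed

definition gaussian_third_deriv :: "real \<Rightarrow> real" where
  "gaussian_third_deriv y = (12 * y - 8 * y ^ 3) * exp (- y\<^sup>2)"

text \<open>The majorant is chosen because its antiderivative is a multiple of
  \<open>arctan\<close>. The constant comes from comparing coefficients with
  \<open>28 * (1 + z + z\<^sup>2 / 2 + z ^ 3 / 6) \<le> 28 * exp z\<close> at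
  \<open>z = y\<^sup>2\<close>: the coefficient 14 of \<open>z\<^sup>2\<close> requires
  \<open>28 / 2\<close>.\<close>

lemma gaussian_third_deriv_bound: "\<bar>gaussian_third_deriv y\<bar> \<le> 28 / (1 + y\<^sup>2)"
proof -
  define z where "z = y\<^sup>2"
  have z: "z \<ge> 0" by (simp add: z_def)
  have "(\<Sum>k<4. z ^ k / fact k) \<le> exp z"
  proof -
    have "(\<lambda>k. z ^ k / fact k) sums exp z" using exp_converges[of z] by (simp add: field_simps)
    then show ?thesis using z by (intro sum_le_suminf[THEN order_trans]) (auto simp: sums_iff)
  qed
  then have e: "1 + z + z ^ 2 / 2 + z ^ 3 / 6 \<le> exp z" by (simp add: eval_nat_numeral)
  have "0 \<le> (1 - \<bar>y\<bar>)\<^sup>2" by simp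
  then have y: "\<bar>y\<bar> \<le> (1 + z) / 2" by (simp add: z_def power2_eq_square algebra_simps)
  have "\<bar>12 * y - 8 * y ^ 3\<bar> \<le> 12 * \<bar>y\<bar> + 8 * \<bar>y\<bar> * z"
    by (rule abs_triangle_ineq4[THEN order_trans])
      (simp add: z_def abs_mult power_abs power2_eq_square power3_eq_cube)
  also have "\<dots> \<le> 12 * ((1 + z) / 2) + 8 * ((1 + z) / 2) * z"
    using y z by (intro add_mono mult_mono) auto
  finally have "\<bar>12 * y - 8 * y ^ 3\<bar> * (1 + z) \<le> (12 * ((1 + z) / 2) + 8 * ((1 + z) / 2) * z) * (1 + z)"
    using z by (intro mult_right_mono) auto
  also have "\<dots> = 6 + 16 * z + 14 * z ^ 2 + 4 * z ^ 3"
    by (simp add: field_simps power2_eq_square power3_eq_cube)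
  also have "\<dots> \<le> 28 * (1 + z + z ^ 2 / 2 + z ^ 3 / 6)"
  proof -
    have aux: "6 + 16 * z + 14 * A + 4 * B \<le> 28 * (1 + z + A / 2 + B / 6)" if "0 \<le> z" "0 \<le> B" for z A B :: real
      using that by (simp add: field_simps)
    show ?thesis by (rule aux) (use z in auto)
  qed
  also have "\<dots> \<le> 28 * exp z" using e by simp
  finally have "\<bar>12 * y - 8 * y ^ 3\<bar> / exp z \<le> 28 / (1 + z)"
    using z by (simp add: divide_simps add_pos_nonneg mult.commute)
  then show ?thesis by (simp add: gaussian_third_deriv_def abs_mult z_def exp_minus divide_inverse)
qed

text \<open>The numerator is the third Bernoulli polynomial; divided by \<open>3!\<close> it is the
  kernel of the Euler-Maclaurin remainder.\<close>

lemma bernoulli3_bound: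
  fixes t :: real assumes "0 \<le> t" "t \<le> 1"
  shows "\<bar>(t ^ 3 - 3 / 2 * t\<^sup>2 + t / 2) / 6\<bar> \<le> 1"
proof -
  have "\<bar>(a - 3 / 2 * b + t / 2) / 6\<bar> \<le> 1" if "0 \<le> a" "a \<le> 1" "0 \<le> b" "b \<le> 1" for a b :: real
    using that assms by (simp add: abs_le_iff field_simps)
  then show ?thesis using assms by (auto simp: power_le_one)
qed

text \<open>Euler--Maclaurin of third order on a unit interval; the remainder is dominated by the
  increment of an arctangent, so that it telescopes.\<close>

lemma gaussian_euler_maclaurin:
  fixes u x :: real and \<Phi> :: "real \<Rightarrow> real"
  assumes u: "u > 0" and \<Phi>: "\<And>x. (\<Phi> has_real_derivative exp (- x\<^sup>2)) (at x)"
  defines "g \<equiv> \<lambda>x. exp (- u * x\<^sup>2)" and "s \<equiv> sqrt u"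
  defines "A \<equiv> \<lambda>x. - u * x * exp (- u * x\<^sup>2) / 6 + \<Phi> (s * x) / s"
  shows "\<bar>(g (x + 1) + g x) / 2 - (A (x + 1) - A x)\<bar> \<le>
           28 * u * arctan (s * (x + 1)) - 28 * u * arctan (s * x)"
proof -
  have s: "s > 0" "s\<^sup>2 = u" using u by (auto simp: s_def)
  define g1 where "g1 y = - 2 * u * y * g y" for y
  define g2 where "g2 y = (4 * u\<^sup>2 * y\<^sup>2 - 2 * u) * g y" for y
  define g3 where "g3 y = (12 * u\<^sup>2 * y - 8 * u ^ 3 * y ^ 3) * g y" for y
  have dg: "(g has_real_derivative g1 y) (at y)" for y
    unfolding g_def g1_def by (auto intro!: derivative_eq_intros)
  have dg1: "(g1 has_real_derivative g2 y) (at y)" for y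
    unfolding g1_def [abs_def] g2_def
    by (auto intro!: derivative_eq_intros dg simp: g1_def algebra_simps power2_eq_square)
  have dg2: "(g2 has_real_derivative g3 y) (at y)" for y
    unfolding g2_def [abs_def] g3_def
    by (auto intro!: derivative_eq_intros dg simp: g1_def algebra_simps power2_eq_square power3_eq_cube)
  have g3: "g3 y = u * s * gaussian_third_deriv (s * y)" for y
  proof -
    have "u * s * gaussian_third_deriv (s * y)
        = (12 * u * (s\<^sup>2 * y) - 8 * u * (s\<^sup>2 * s\<^sup>2 * y ^ 3)) * exp (- (s\<^sup>2 * y\<^sup>2))"
      unfolding gaussian_third_deriv_def
      by (simp add: power_mult_distrib power3_eq_cube power2_eq_square algebra_simps)
    then show ?thesis unfolding s g3_def g_def by (simp add: power2_eq_square power3_eq_cube algebra_simps)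
  qed
  \<comment> \<open>Bernoulli polynomials divided by factorials, so that \<open>b3' = b2\<close>,
    \<open>b2' = b1\<close> and \<open>b1' = 1\<close>.\<close>
  define b3 b2 b1 :: "real \<Rightarrow> real" where
    "b3 t = (t ^ 3 - 3 / 2 * t\<^sup>2 + t / 2) / 6" and "b2 t = (t\<^sup>2 - t + 1 / 6) / 2" and "b1 t = t - 1 / 2" for t
  \<comment> \<open>The outcome of integrating by parts three times: in the derivative all mixed
    terms cancel and \<open>b3 * g3\<close> remains.\<close>
  define H where "H t = b3 t * g2 (x + t) - b2 t * g1 (x + t) + b1 t * g (x + t) - \<Phi> (s * (x + t)) / s" for t
  have shift: "((\<lambda>t. f (x + t)) has_real_derivative f' (x + t)) (at t)"
    if "\<And>y. (f has_real_derivative f' y) (at y)" for f f' t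
    using DERIV_shift[of f "f' (x + t)" t x] that[of "x + t"] by (simp add: add.commute)
  have d\<Phi>: "((\<lambda>t. \<Phi> (s * (x + t)) / s) has_real_derivative g (x + t)) (at t)" for t
    using s by (auto intro!: derivative_eq_intros DERIV_chain2[OF \<Phi>] simp: g_def power_mult_distrib)
  have db: "(b3 has_real_derivative b2 t) (at t)" "(b2 has_real_derivative b1 t) (at t)"
           "(b1 has_real_derivative 1) (at t)" for t
    unfolding b3_def [abs_def] b2_def [abs_def] b1_def [abs_def]
    by (auto intro!: derivative_eq_intros simp: field_simps power2_eq_square)
  have dH: "(H has_real_derivative b3 t * g3 (x + t)) (at t)" for t
  proof -
    have "(H has_real_derivative
        (b2 t * g2 (x + t) + g3 (x + t) * b3 t) - (b1 t * g1 (x + t) + g2 (x + t) * b2 t)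
        + (1 * g (x + t) + g1 (x + t) * b1 t) - g (x + t)) (at t)"
      unfolding H_def [abs_def]
      by (intro DERIV_add DERIV_diff DERIV_mult db shift[OF dg] shift[OF dg1] shift[OF dg2] d\<Phi>)
    then show ?thesis by (simp add: algebra_simps)
  qed
  have dat: "((\<lambda>t. 28 * u * arctan (s * (x + t))) has_real_derivative
      28 * u * s / (1 + (s * (x + t))\<^sup>2)) (at t)" for t
    by (auto intro!: derivative_eq_intros simp: field_simps)
  have bd: "\<bar>b3 t * g3 (x + t)\<bar> \<le> 28 * u * s / (1 + (s * (x + t))\<^sup>2)" if "0 \<le> t" "t \<le> 1" for t
  proof -
    have "\<bar>b3 t * g3 (x + t)\<bar> \<le> 1 * (u * s * (28 / (1 + (s * (x + t))\<^sup>2)))"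
      unfolding abs_mult g3 using bernoulli3_bound[OF that] gaussian_third_deriv_bound[of "s * (x + t)"] u s
      by (intro mult_mono) (auto simp: b3_def)
    then show ?thesis by (simp add: mult_ac)
  qed
  have m1: "28 * u * arctan (s * (x + 0)) - H 0 \<le> 28 * u * arctan (s * (x + 1)) - H 1"
  proof (rule DERIV_nonneg_imp_nondecreasing[of 0 1 "\<lambda>t. 28 * u * arctan (s * (x + t)) - H t"])
    fix t :: real assume "0 \<le> t" "t \<le> 1"
    then have "0 \<le> 28 * u * s / (1 + (s * (x + t))\<^sup>2) - b3 t * g3 (x + t)"
      using bd[of t] by auto
    then show "\<exists>y. ((\<lambda>t. 28 * u * arctan (s * (x + t)) - H t) has_real_derivative y) (at t) \<and> 0 \<le> y"
      by (intro exI[of _ "28 * u * s / (1 + (s * (x + t))\<^sup>2) - b3 t * g3 (x + t)"] conjI DERIV_diff dat dH)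
  qed simp
  have m2: "28 * u * arctan (s * (x + 0)) + H 0 \<le> 28 * u * arctan (s * (x + 1)) + H 1"
  proof (rule DERIV_nonneg_imp_nondecreasing[of 0 1 "\<lambda>t. 28 * u * arctan (s * (x + t)) + H t"])
    fix t :: real assume "0 \<le> t" "t \<le> 1"
    then have "0 \<le> 28 * u * s / (1 + (s * (x + t))\<^sup>2) + b3 t * g3 (x + t)"
      using bd[of t] by auto
    then show "\<exists>y. ((\<lambda>t. 28 * u * arctan (s * (x + t)) + H t) has_real_derivative y) (at t) \<and> 0 \<le> y"
      by (intro exI[of _ "28 * u * s / (1 + (s * (x + t))\<^sup>2) + b3 t * g3 (x + t)"] conjI DERIV_add dat dH)
  qed simp
  \<comment> \<open>\<open>b3\<close> vanishes at 0 and 1, \<open>b2\<close> is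
    \<open>1 / 12\<close> at both ends, and \<open>b1\<close> goes from \<open>- 1 / 2\<close> to
    \<open>1 / 2\<close>. The \<open>b2\<close> part becomes the summand
    \<open>- u * x * exp (- u * x\<^sup>2) / 6\<close> of \<open>A\<close>.\<close>
  have "H 1 - H 0 = (g (x + 1) + g x) / 2 - (A (x + 1) - A x)"
    by (simp add: H_def b1_def b2_def b3_def A_def g1_def g_def field_simps)
  then show ?thesis using m1 m2 by auto
qed

lemma sum_int_telescope:
  fixes f :: "int \<Rightarrow> 'a::ab_group_add"
  shows "(\<Sum>j\<in>{- int N..<int N}. f (j + 1) - f j) = f (int N) - f (- int N)"
proof (induction N)
  case (Suc N)
  have "{- int (Suc N)..<int (Suc N)} = insert (- int N - 1) (insert (int N) {- int N..<int N})" by auto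
  moreover have "- int N - 1 = - 1 - int N" "- (1 + int N) = - 1 - int N" by simp_all
  ultimately show ?case using Suc by (simp only: of_nat_Suc) (simp add: algebra_simps)
qed simp

text \<open>Over all integers the arctangent increments telescope to at most
  \<open>28 * pi * u\<close> and the main part to \<open>\<Lambda> / sqrt u\<close>, where
  \<open>\<Lambda>\<close> is the integral of \<open>exp (- x\<^sup>2)\<close>. The bound has to be
  uniform in \<open>\<alpha>\<close>, since the rows of a binary form carry different
  shifts.\<close>

lemma gaussian_sum_int:
  obtains \<Lambda> where "\<Lambda> \<ge> 0"
    "\<And>u \<alpha> :: real. u > 0 \<Longrightarrow> (\<lambda>j::int. exp (- u * (of_int j + \<alpha>)\<^sup>2)) summable_on UNIV"
    "\<And>u \<alpha> :: real. u > 0 \<Longrightarrow> \<bar>(\<Sum>\<^sub>\<infinity>j::int. exp (- u * (of_int j + \<alpha>)\<^sup>2)) - \<Lambda> / sqrt u\<bar> \<le> 28 * pi * u"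
proof -
  obtain \<Phi> :: "real \<Rightarrow> real" and L1 L2 where
    \<Phi>: "\<And>x. (\<Phi> has_real_derivative exp (- x\<^sup>2)) (at x)" and
    L1: "(\<Phi> \<longlongrightarrow> L1) at_top" and L2: "(\<Phi> \<longlongrightarrow> L2) at_bot"
    using gaussian_antiderivative by blast
  define \<Lambda> where "\<Lambda> = L1 - L2"
  have main: "(\<lambda>j::int. exp (- u * (of_int j + \<alpha>)\<^sup>2)) summable_on UNIV \<and>
      \<bar>(\<Sum>\<^sub>\<infinity>j::int. exp (- u * (of_int j + \<alpha>)\<^sup>2)) - \<Lambda> / sqrt u\<bar> \<le> 28 * pi * u" if u: "u > 0" for u \<alpha> :: real
  proof -
    define g where "g x = exp (- u * x\<^sup>2)" for x
    define s where "s = sqrt u"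
    have s: "s > 0" using u by (simp add: s_def)
    define A where "A x = - u * x * exp (- u * x\<^sup>2) / 6 + \<Phi> (s * x) / s" for x
    define G A' R where "G j = g (of_int j + \<alpha>)" and "A' j = A (of_int j + \<alpha>)"
      and "R j = 28 * u * arctan (s * (of_int j + \<alpha>))" for j :: int
    have step: "\<bar>(G (j + 1) + G j) / 2 - (A' (j + 1) - A' j)\<bar> \<le> R (j + 1) - R j" for j
      using gaussian_euler_maclaurin[OF u \<Phi>, of "of_int j + \<alpha>"]
      by (simp add: G_def A'_def R_def g_def A_def s_def add_ac)
    define I where "I N = {- int N..<int N}" for N
    define a b where "a N = - real N + \<alpha>" and "b N = real N + \<alpha>" for N :: nat
    define P where "P N = (\<Sum>j\<in>I N. (G (j + 1) + G j) / 2)" for N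
    have bd: "\<bar>P N - (A (b N) - A (a N))\<bar> \<le> R (int N) - R (- int N)" for N
    proof -
      have "P N - (A' (int N) - A' (- int N)) = (\<Sum>j\<in>I N. (G (j + 1) + G j) / 2 - (A' (j + 1) - A' j))"
        unfolding P_def I_def sum_int_telescope[symmetric] by (simp add: sum_subtractf)
      moreover have "\<bar>\<Sum>j\<in>I N. (G (j + 1) + G j) / 2 - (A' (j + 1) - A' j)\<bar> \<le> (\<Sum>j\<in>I N. R (j + 1) - R j)"
        by (rule order_trans[OF sum_abs sum_mono]) (rule step)
      moreover have "(\<Sum>j\<in>I N. R (j + 1) - R j) = R (int N) - R (- int N)"
        unfolding I_def by (rule sum_int_telescope)
      ultimately show ?thesis by (simp add: A'_def a_def b_def)
    qed
    have bd2: "\<bar>P N - (A (b N) - A (a N))\<bar> \<le> 28 * u * pi" for N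
    proof -
      have "arctan x - arctan y \<le> pi" for x y
        using arctan_ubound[of x] arctan_lbound[of y] by linarith
      then have "R (int N) - R (- int N) \<le> 28 * u * pi"
        using u unfolding R_def right_diff_distrib[symmetric] by (intro mult_left_mono) auto
      then show ?thesis using bd[of N] by linarith
    qed
    have bt: "filterlim b at_top sequentially"
    proof -
      have "filterlim (\<lambda>N. \<alpha> + real N) at_top sequentially"
        by (intro filterlim_tendsto_add_at_top[OF tendsto_const] filterlim_real_sequentially)
      then show ?thesis unfolding b_def by (simp add: add.commute)
    qed
    have at: "filterlim a at_bot sequentially"
    proof -
      have "filterlim (\<lambda>N. - \<alpha> + real N) at_top sequentially"
        by (intro filterlim_tendsto_add_at_top[OF tendsto_const] filterlim_real_sequentially)
      then show ?thesis unfolding a_def filterlim_uminus_at_top by (simp add: algebra_simps)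
    qed
    have e0: "((\<lambda>x. - u * x * exp (- u * x\<^sup>2) / 6) \<longlongrightarrow> 0) at_top"
      using u by real_asymp
    have e1: "((\<lambda>x. - u * x * exp (- u * x\<^sup>2) / 6) \<longlongrightarrow> 0) at_bot"
      using u by real_asymp
    have At: "(A \<longlongrightarrow> 0 + L1 / s) at_top" unfolding A_def [abs_def]
      using s by (intro tendsto_intros e0 filterlim_compose[OF L1]
          filterlim_tendsto_pos_mult_at_top[OF tendsto_const] filterlim_ident) auto
    have Ab: "(A \<longlongrightarrow> 0 + L2 / s) at_bot" unfolding A_def [abs_def]
      using s by (intro tendsto_intros e1 filterlim_compose[OF L2]
          filterlim_tendsto_pos_mult_at_bot[OF tendsto_const] filterlim_ident) auto
    have Alim: "(\<lambda>N. A (b N) - A (a N)) \<longlonglongrightarrow> \<Lambda> / s"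
      using tendsto_diff[OF filterlim_compose[OF At bt] filterlim_compose[OF Ab at]]
      by (simp add: \<Lambda>_def diff_divide_distrib)
    obtain K where K: "\<And>N. \<bar>A (b N) - A (a N)\<bar> \<le> K"
      using convergent_imp_Bseq[OF convergentI[OF Alim]] by (auto simp: Bseq_def)
    have summ: "(G) summable_on UNIV"
    proof (rule nonneg_bdd_above_summable_on)
      show "bdd_above (sum (G) ` {F. F \<subseteq> UNIV \<and> finite F})"
      proof (rule bdd_aboveI2)
        fix F :: "int set" assume "F \<in> {F. F \<subseteq> UNIV \<and> finite F}"
        then have F: "finite F" by simp
        define N where "N = Suc (nat (Max (insert 0 (abs ` F))))"
        have "\<bar>j\<bar> < int N" if "j \<in> F" for j
        proof -
          have "\<bar>j\<bar> \<le> Max (insert 0 (abs ` F))" using F that by (intro Max_ge) auto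
          then show ?thesis unfolding N_def by linarith
        qed
        then have "F \<subseteq> I N" by (force simp: I_def)
        then have "sum (G) F \<le> sum (G) (I N)"
          by (intro sum_mono2) (auto simp: I_def G_def g_def)
        also have "\<dots> \<le> 2 * P N"
          unfolding P_def sum_distrib_left by (intro sum_mono) (auto simp: G_def g_def)
        also have "\<dots> \<le> 2 * (K + 28 * u * pi)" using bd2[of N] K[of N] unfolding abs_le_iff by simp
        finally show "sum (G) F \<le> 2 * (K + 28 * u * pi)" .
      qed
    qed (auto simp: G_def g_def)
    \<comment> \<open>Shifting the index permutes the integers, so the trapezoidal averages have the
      same total as \<open>G\<close>.\<close>
    have shift: "((\<lambda>j::int. G (j + 1)) has_sum (\<Sum>\<^sub>\<infinity>j. G j)) UNIV"
    proof -
      have "((G) has_sum (\<Sum>\<^sub>\<infinity>j. G j)) ((\<lambda>j. j + 1) ` UNIV)"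
        using summ by simp
      then show ?thesis by (subst (asm) has_sum_reindex) (auto simp: o_def algebra_simps)
    qed
    have "((\<lambda>j::int. (G (j + 1) + G j) / 2) has_sum
        ((\<Sum>\<^sub>\<infinity>j. G j) + (\<Sum>\<^sub>\<infinity>j. G j)) / 2) UNIV"
      unfolding divide_inverse
      by (intro has_sum_cmult_left has_sum_add shift has_sum_infsum summ)
    then have "(sum (\<lambda>j::int. (G (j + 1) + G j) / 2) \<longlongrightarrow>
        (\<Sum>\<^sub>\<infinity>j. G j)) (finite_subsets_at_top UNIV)"
      by (simp add: has_sum_def)
    moreover have "filterlim I (finite_subsets_at_top UNIV) sequentially"
      unfolding filterlim_finite_subsets_at_top
    proof (intro allI impI)
      fix F :: "int set" assume "finite F \<and> F \<subseteq> UNIV"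
      then have F: "finite F" by simp
      define N where "N = Suc (nat (Max (insert 0 (abs ` F))))"
      have N: "\<bar>j\<bar> < int N" if "j \<in> F" for j
      proof -
        have "\<bar>j\<bar> \<le> Max (insert 0 (abs ` F))" using F that by (intro Max_ge) auto
        then show ?thesis unfolding N_def by linarith
      qed
      show "\<forall>\<^sub>F n in sequentially. finite (I n) \<and> F \<subseteq> I n \<and> I n \<subseteq> UNIV"
        using eventually_ge_at_top[of N]
      proof eventually_elim
        case (elim n)
        then show ?case using N by (force simp: I_def)
      qed
    qed
    ultimately have "P \<longlonglongrightarrow> (\<Sum>\<^sub>\<infinity>j. G j)"
      unfolding P_def [abs_def] by (rule filterlim_compose)
    then have "(\<lambda>N. P N - (A (b N) - A (a N))) \<longlonglongrightarrow> (\<Sum>\<^sub>\<infinity>j. G j) - \<Lambda> / s"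
      by (intro tendsto_diff Alim)
    then have "\<bar>(\<Sum>\<^sub>\<infinity>j. G j) - \<Lambda> / s\<bar> \<le> 28 * u * pi"
      by (intro LIMSEQ_le_const2[OF tendsto_rabs]) (use bd2 in auto)
    then show ?thesis using summ by (simp add: G_def [abs_def] g_def s_def mult_ac)
  qed
  have \<Lambda>: "\<Lambda> \<ge> 0"
  proof -
    have "\<Phi> x \<le> \<Phi> y" if "x \<le> y" for x y
      using that by (rule DERIV_nonneg_imp_nondecreasing) (metis \<Phi> exp_ge_zero)
    then have "\<Phi> 0 \<le> L1" "L2 \<le> \<Phi> 0"
      by (auto intro!: tendsto_lowerbound[OF L1] tendsto_upperbound[OF L2] eventually_at_top_linorderI[of 0]
          eventually_at_bot_linorderI[of 0] simp: eventually_at_bot_linorder)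
    then show ?thesis by (simp add: \<Lambda>_def)
  qed
  show thesis
    by (rule that[OF \<Lambda>]; use main in simp)
qed


section \<open>Binary theta series near the origin\<close>

text \<open>After completing the square the form is
  \<open>a * (x + b * y / (2 * a))\<^sup>2 + D / (4 * a) * y\<^sup>2\<close>. The Gaussian estimate
  is applied to every row with its own shift, and once more to the sum of the row weights. For a
  fixed form the resulting error is \<open>O(sqrt t)\<close>.\<close>

lemma theta_summable_asymp:
  obtains \<Lambda> C :: real where "\<Lambda> \<ge> 0" "C \<ge> 0"
    "\<And>a b c D t :: real. a > 0 \<Longrightarrow> D > 0 \<Longrightarrow> 4 * a * c - b\<^sup>2 = D \<Longrightarrow> t > 0 \<Longrightarrow>
       (\<lambda>(x::int, y::int). exp (- t * (a * of_int x ^ 2 + b * of_int x * of_int y + c * of_int y ^ 2))) summable_on UNIV"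
    "\<And>a b c D t :: real. a > 0 \<Longrightarrow> D > 0 \<Longrightarrow> 4 * a * c - b\<^sup>2 = D \<Longrightarrow> t > 0 \<Longrightarrow>
       \<bar>(\<Sum>\<^sub>\<infinity>(x::int, y::int). exp (- t * (a * of_int x ^ 2 + b * of_int x * of_int y + c * of_int y ^ 2)))
          - \<Lambda>\<^sup>2 / sqrt (D / 4) / t\<bar>
       \<le> C * (t * a) * (\<Lambda> / sqrt (t * (D / (4 * a))) + C * (t * (D / (4 * a)))) + \<Lambda> / sqrt (t * a) * (C * (t * (D / (4 * a))))"
proof -
  obtain \<Lambda> where \<Lambda>: "\<Lambda> \<ge> 0" and
    sm: "\<And>u \<alpha> :: real. u > 0 \<Longrightarrow> (\<lambda>j::int. exp (- u * (of_int j + \<alpha>)\<^sup>2)) summable_on UNIV" and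
    bd: "\<And>u \<alpha> :: real. u > 0 \<Longrightarrow> \<bar>(\<Sum>\<^sub>\<infinity>j::int. exp (- u * (of_int j + \<alpha>)\<^sup>2)) - \<Lambda> / sqrt u\<bar> \<le> 28 * pi * u"
    using gaussian_sum_int by blast
  define C where "C = 28 * pi"
  have C: "C \<ge> 0" by (simp add: C_def)
  have main: "(\<lambda>(x::int, y::int). exp (- t * (a * of_int x ^ 2 + b * of_int x * of_int y + c * of_int y ^ 2))) summable_on UNIV
      \<and> \<bar>(\<Sum>\<^sub>\<infinity>(x::int, y::int). exp (- t * (a * of_int x ^ 2 + b * of_int x * of_int y + c * of_int y ^ 2)))
          - \<Lambda>\<^sup>2 / sqrt (D / 4) / t\<bar>
       \<le> C * (t * a) * (\<Lambda> / sqrt (t * (D / (4 * a))) + C * (t * (D / (4 * a)))) + \<Lambda> / sqrt (t * a) * (C * (t * (D / (4 * a))))"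
    if a: "a > 0" and D: "D > 0" and disc: "4 * a * c - b\<^sup>2 = D" and t: "t > 0" for a b c D t :: real
  proof -
    define u v where "u = t * a" and "v = t * (D / (4 * a))"
    have uv: "u > 0" "v > 0" using a D t by (auto simp: u_def v_def)
    define \<alpha> where "\<alpha> y = b * of_int y / (2 * a)" for y :: int
    have expq: "exp (- t * (a * of_int x ^ 2 + b * of_int x * of_int y + c * of_int y ^ 2)) =
        exp (- v * (of_int y + 0)\<^sup>2) * exp (- u * (of_int x + \<alpha> y)\<^sup>2)" for x y :: int
    proof -
      have "a * of_int x ^ 2 + b * of_int x * of_int y + c * of_int y ^ 2 =
          (4 * a * c - b\<^sup>2) / (4 * a) * of_int y ^ 2 + a * (of_int x + \<alpha> y)\<^sup>2"
        using a by (simp add: \<alpha>_def field_simps power2_eq_square)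
      then show ?thesis unfolding disc u_def v_def
        by (simp add: exp_add[symmetric] algebra_simps)
    qed
    define w where "w y = exp (- v * (of_int y + 0)\<^sup>2)" for y :: int
    define F where "F y = (\<Sum>\<^sub>\<infinity>x::int. exp (- u * (of_int x + \<alpha> y)\<^sup>2))" for y :: int
    define V where "V = (\<Sum>\<^sub>\<infinity>y. w y)"
    have w: "w summable_on UNIV" using sm[OF uv(2), of 0] by (simp add: w_def [abs_def])
    have w0: "w y \<ge> 0" for y by (simp add: w_def)
    have V: "\<bar>V - \<Lambda> / sqrt v\<bar> \<le> C * v" using bd[OF uv(2), of 0] by (simp add: V_def w_def [abs_def] C_def)
    have V0: "V \<ge> 0" unfolding V_def by (intro infsum_nonneg w0)
    have F: "\<bar>F y - \<Lambda> / sqrt u\<bar> \<le> C * u" for y using bd[OF uv(1), of "\<alpha> y"] by (simp add: F_def C_def)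
    have F0: "F y \<ge> 0" for y unfolding F_def by (intro infsum_nonneg) auto
    have row: "((\<lambda>x. w y * exp (- u * (of_int x + \<alpha> y)\<^sup>2)) has_sum w y * F y) UNIV" for y
      unfolding F_def by (intro has_sum_cmult_right has_sum_infsum sm uv)
    have wF: "(\<lambda>y. w y * F y) summable_on UNIV"
    proof (rule summable_on_comparison_test)
      show "(\<lambda>y. w y * (\<Lambda> / sqrt u + C * u)) summable_on UNIV" by (intro summable_on_cmult_left w)
      show "w y * F y \<le> w y * (\<Lambda> / sqrt u + C * u)" for y
        using F[of y] w0[of y] by (auto intro!: mult_left_mono)
    qed (use F0 w0 in auto)
    define f where "f = (\<lambda>(y::int, x::int). w y * exp (- u * (of_int x + \<alpha> y)\<^sup>2))"
    have fs: "f summable_on (SIGMA y:UNIV. UNIV)"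
      by (rule summable_on_SigmaI[where g = "\<lambda>y. w y * F y"]) (use row wF w0 in \<open>auto simp: f_def\<close>)
    have fsum: "(f has_sum (\<Sum>\<^sub>\<infinity>y. w y * F y)) (SIGMA y:UNIV. UNIV)"
      by (rule has_sum_SigmaI[where g = "\<lambda>y. w y * F y"])
        (use row wF fs in \<open>auto simp: f_def intro: has_sum_infsum\<close>)
    then have fsum': "(f has_sum (\<Sum>\<^sub>\<infinity>y. w y * F y)) (prod.swap ` UNIV)" by simp
    have th: "((\<lambda>(x::int, y::int). exp (- t * (a * of_int x ^ 2 + b * of_int x * of_int y + c * of_int y ^ 2)))
        has_sum (\<Sum>\<^sub>\<infinity>y. w y * F y)) UNIV"
    proof -
      have "(f \<circ> prod.swap has_sum (\<Sum>\<^sub>\<infinity>y. w y * F y)) UNIV"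
        using fsum' by (subst (asm) has_sum_reindex) auto
      moreover have "f \<circ> prod.swap = (\<lambda>(x::int, y::int). exp (- t * (a * of_int x ^ 2 + b * of_int x * of_int y + c * of_int y ^ 2)))"
        unfolding expq by (auto simp: f_def w_def fun_eq_iff)
      ultimately show ?thesis by metis
    qed
    \<comment> \<open>Replacing every row sum by \<open>\<Lambda> / sqrt u\<close> costs at most
      \<open>C * u\<close> per unit of the weight \<open>w\<close>, whose total is
      \<open>V\<close>.\<close>
    have 1: "\<bar>(\<Sum>\<^sub>\<infinity>y. w y * F y) - \<Lambda> / sqrt u * V\<bar> \<le> C * u * V"
    proof -
      have wV: "((\<lambda>y. w y * k) has_sum V * k) UNIV" for k
        unfolding V_def by (intro has_sum_infsum has_sum_cmult_left w)
      have wF': "((\<lambda>y. w y * F y) has_sum (\<Sum>\<^sub>\<infinity>y. w y * F y)) UNIV" using wF by simp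
      have "(\<Sum>\<^sub>\<infinity>y. w y * F y) \<le> V * (\<Lambda> / sqrt u + C * u)"
      proof (rule has_sum_mono[OF wF' wV])
        fix y show "w y * F y \<le> w y * (\<Lambda> / sqrt u + C * u)"
          using F[of y] w0[of y] unfolding abs_le_iff by (intro mult_left_mono) linarith+
      qed
      moreover have "V * (\<Lambda> / sqrt u - C * u) \<le> (\<Sum>\<^sub>\<infinity>y. w y * F y)"
      proof (rule has_sum_mono[OF wV wF'])
        fix y show "w y * (\<Lambda> / sqrt u - C * u) \<le> w y * F y"
          using F[of y] w0[of y] unfolding abs_le_iff by (intro mult_left_mono) linarith+
      qed
      ultimately show ?thesis by (simp add: abs_le_iff algebra_simps)
    qed
    have 2: "\<bar>\<Lambda> / sqrt u * V - \<Lambda> / sqrt u * (\<Lambda> / sqrt v)\<bar> \<le> \<Lambda> / sqrt u * (C * v)"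
      unfolding right_diff_distrib[symmetric] abs_mult using V \<Lambda> uv by (intro mult_mono) auto
    have "C * u * V \<le> C * u * (\<Lambda> / sqrt v + C * v)"
      using V C uv by (intro mult_left_mono) auto
    moreover have "\<Lambda> / sqrt u * (\<Lambda> / sqrt v) = \<Lambda>\<^sup>2 / sqrt (D / 4) / t"
    proof -
      have "u * v = (D / 4) * t\<^sup>2" using a by (simp add: u_def v_def power2_eq_square)
      then have "sqrt u * sqrt v = sqrt (D / 4) * t"
        using t by (metis real_sqrt_mult real_sqrt_unique less_imp_le real_sqrt_abs abs_of_pos)
      then show ?thesis by (simp add: power2_eq_square)
    qed
    ultimately have "\<bar>(\<Sum>\<^sub>\<infinity>y. w y * F y) - \<Lambda>\<^sup>2 / sqrt (D / 4) / t\<bar> \<le>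
        C * u * (\<Lambda> / sqrt v + C * v) + \<Lambda> / sqrt u * (C * v)"
      using 1 2 abs_triangle_ineq4 by (smt (verit))
    then show ?thesis using th by (auto simp: u_def v_def infsumI has_sum_imp_summable)
  qed
  show thesis by (rule that[OF \<Lambda> C]; use main in blast)
qed

text \<open>A term \<open>k / t\<close> equals twice its value at \<open>2 * t\<close>, so the main
  terms cancel exactly and only the errors, which tend to 0, survive.\<close>

lemma theta_scaling_limit:
  fixes a b c D :: real
  assumes a: "a > 0" and D: "D > 0" and disc: "4 * a * c - b\<^sup>2 = D"
  defines "\<theta> \<equiv> \<lambda>t. \<Sum>\<^sub>\<infinity>(x::int, y::int). exp (- t * (a * of_int x ^ 2 + b * of_int x * of_int y + c * of_int y ^ 2))"
  shows "((\<lambda>t. \<theta> t - 2 * \<theta> (2 * t)) \<longlongrightarrow> 0) (at_right 0)"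
proof -
  obtain \<Lambda> C where L: "\<Lambda> \<ge> 0" "C \<ge> 0" and
    bd: "\<And>t. t > 0 \<Longrightarrow> \<bar>\<theta> t - \<Lambda>\<^sup>2 / sqrt (D / 4) / t\<bar>
       \<le> C * (t * a) * (\<Lambda> / sqrt (t * (D / (4 * a))) + C * (t * (D / (4 * a)))) + \<Lambda> / sqrt (t * a) * (C * (t * (D / (4 * a))))"
    by (rule theta_summable_asymp) (use a D disc in \<open>auto simp: \<theta>_def\<close>)
  define d where "d = D / (4 * a)"
  have d: "d > 0" using a D by (simp add: d_def)
  define E where "E t = C * (t * a) * (\<Lambda> / sqrt (t * d) + C * (t * d)) + \<Lambda> / sqrt (t * a) * (C * (t * d))" for t
  have E: "(E \<longlongrightarrow> 0) (at_right 0)"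
    unfolding E_def [abs_def] using a d by real_asymp
  have "((\<lambda>t. E (2 * t)) \<longlongrightarrow> 0) (at_right 0)"
    unfolding E_def [abs_def] using a d by real_asymp
  then have E2: "((\<lambda>t. E t + 2 * E (2 * t)) \<longlongrightarrow> 0) (at_right 0)"
    using tendsto_add[OF E tendsto_mult[OF tendsto_const[of 2]]] by fastforce
  show ?thesis
  proof (rule Lim_null_comparison[OF _ E2])
    have "norm (\<theta> t - 2 * \<theta> (2 * t)) \<le> E t + 2 * E (2 * t)" if "t > 0" for t
    proof -
      have "\<Lambda>\<^sup>2 / sqrt (D / 4) / t = 2 * (\<Lambda>\<^sup>2 / sqrt (D / 4) / (2 * t))" by simp
      moreover have "\<bar>\<theta> t - \<Lambda>\<^sup>2 / sqrt (D / 4) / t\<bar> \<le> E t" using bd[OF that] by (simp add: E_def d_def)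
      moreover have "\<bar>\<theta> (2 * t) - \<Lambda>\<^sup>2 / sqrt (D / 4) / (2 * t)\<bar> \<le> E (2 * t)"
        using bd[of "2 * t"] that by (simp add: E_def d_def)
      moreover have "\<bar>x - 2 * y\<bar> \<le> e + 2 * e'" if "k = 2 * k'" "\<bar>x - k\<bar> \<le> e" "\<bar>y - k'\<bar> \<le> e'"
        for x y k k' e e' :: real
        using that by linarith
      ultimately show ?thesis unfolding real_norm_def by blast
    qed
    then show "\<forall>\<^sub>F t in at_right 0. norm (\<theta> t - 2 * \<theta> (2 * t)) \<le> E t + 2 * E (2 * t)"
      by (auto simp: eventually_at_right_field intro!: exI[of _ 1])
  qed
qed

section \<open>Periodic sums against a convex sequence\<close>

lemma summation_by_parts_less:
  fixes c a :: "nat \<Rightarrow> real"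
  shows "(\<Sum>d<n. c d * a d) = (\<Sum>d<n. c d) * a n + (\<Sum>d<n. (\<Sum>j\<le>d. c j) * (a d - a (Suc d)))"
proof (induction n)
  case (Suc n)
  have "(\<Sum>j\<le>n. c j) = (\<Sum>j<n. c j) + c n" by (simp flip: lessThan_Suc_atMost)
  then show ?case using Suc by (simp add: algebra_simps)
qed simp

lemma periodic_mod:
  fixes f :: "nat \<Rightarrow> 'a"
  assumes "\<And>n. f (n + p) = f n" "p > 0"
  shows "f n = f (n mod p)"
proof -
  have *: "f (m + k * p) = f m" for m k
    by (induction k) (use assms(1)[of "m + _ * p"] in \<open>auto simp: algebra_simps\<close>)
  show ?thesis using *[of "n mod p" "n div p"] by simp
qed

lemma periodic_bounded:
  fixes f :: "nat \<Rightarrow> real"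
  assumes "\<And>n. f (n + p) = f n" "p > 0"
  obtains B where "B \<ge> 0" "\<And>n. \<bar>f n\<bar> \<le> B"
proof
  show "(\<Sum>k<p. \<bar>f k\<bar>) \<ge> 0" by (intro sum_nonneg) auto
  fix n
  have "\<bar>f n\<bar> = \<bar>f (n mod p)\<bar>" using periodic_mod[of f p, OF assms] by metis
  also have "\<dots> \<le> (\<Sum>k<p. \<bar>f k\<bar>)" using assms(2) by (intro member_le_sum) auto
  finally show "\<bar>f n\<bar> \<le> (\<Sum>k<p. \<bar>f k\<bar>)" .
qed

text \<open>Complete periods cancel. What is drawn from this is the boundedness of the partial
  sums.\<close>

lemma periodic_sum_periodic:
  fixes f :: "nat \<Rightarrow> real"
  assumes "\<And>n. f (n + p) = f n" "p > 0" "(\<Sum>k<p. f k) = 0"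
  shows "(\<Sum>k\<le>n + p. f k) = (\<Sum>k\<le>n. f k)"
proof (induction n)
  case 0
  have "(\<Sum>k\<le>0 + p. f k) = (\<Sum>k<p. f k) + f p"
    by (simp add: lessThan_Suc_atMost[symmetric])
  then show ?case using assms(1)[of 0] assms(3) by simp
next
  case (Suc n)
  then show ?case using assms(1)[of "Suc n"] by (simp add: add.commute)
qed

text \<open>Two summations by parts. The first passes from \<open>c\<close> to its periodic partial
  sums \<open>S\<close>, of mean \<open>M\<close>; the second passes from \<open>S - M\<close> to
  its partial sums \<open>T\<close>, again periodic and so bounded, against the second differences
  of \<open>a\<close>. Convexity makes those nonnegative, so their absolute values telescope. The
  constant \<open>B\<close> depends on \<open>c\<close> alone, which permits a sequence
  \<open>a\<close> varying with a parameter.\<close>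

lemma periodic_summation_convex:
  fixes c a :: "nat \<Rightarrow> real"
  assumes per: "\<And>n. c (n + p) = c n" "p > 0" and zero: "(\<Sum>k<p. c k) = 0"
  defines "M \<equiv> (\<Sum>d<p. \<Sum>j\<le>d. c j) / real p"
  shows "\<exists>B\<ge>0. \<forall>a s. (\<forall>d. 0 \<le> a d - a (Suc d)) \<longrightarrow>
      (\<forall>d. a (Suc d) - a (Suc (Suc d)) \<le> a d - a (Suc d)) \<longrightarrow> a \<longlonglongrightarrow> 0 \<longrightarrow>
      (\<lambda>d. c d * a d) sums s \<longrightarrow> \<bar>s - M * a 0\<bar> \<le> B * (a 0 - a 1)"
proof -
  define S where "S d = (\<Sum>j\<le>d. c j)" for d
  have perS: "S (n + p) = S n" for n
    unfolding S_def by (rule periodic_sum_periodic) (use per zero in auto)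
  have "(\<Sum>k<p. S k - M) = 0"
    using per(2) by (simp add: sum_subtractf M_def S_def)
  then have perT: "(\<Sum>k\<le>n + p. S k - M) = (\<Sum>k\<le>n. S k - M)" for n
    by (intro periodic_sum_periodic) (use per perS in auto)
  define T where "T n = (\<Sum>k\<le>n. S k - M)" for n
  have perT': "T (n + p) = T n" for n using perT by (simp add: T_def)
  obtain B where B: "B \<ge> 0" "\<And>n. \<bar>T n\<bar> \<le> B"
    using periodic_bounded[of T p, OF perT' per(2)] by blast
  obtain B' where B': "B' \<ge> 0" "\<And>n. \<bar>S n\<bar> \<le> B'"
    using periodic_bounded[of S p, OF perS per(2)] by blast
  show ?thesis
  proof (intro exI[of _ B] conjI allI impI B)
    fix a :: "nat \<Rightarrow> real" and s :: real
    assume dec: "\<forall>d. 0 \<le> a d - a (Suc d)"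
      and conv: "\<forall>d. a (Suc d) - a (Suc (Suc d)) \<le> a d - a (Suc d)"
      and lim: "a \<longlonglongrightarrow> 0" and s: "(\<lambda>d. c d * a d) sums s"
    define g where "g d = a d - a (Suc d)" for d
    have glim: "g \<longlonglongrightarrow> 0"
      unfolding g_def using tendsto_diff[OF lim LIMSEQ_Suc[OF lim]] by simp
    have bound: "\<bar>\<Sum>d<n. (S d - M) * g d\<bar> \<le> B * g n + B * (g 0 - g n)" for n
    proof -
      have "(\<Sum>d<n. (S d - M) * g d) =
          (\<Sum>d<n. S d - M) * g n + (\<Sum>d<n. T d * (g d - g (Suc d)))"
        by (subst summation_by_parts_less) (simp add: T_def)
      moreover have "\<bar>\<Sum>d<n. S d - M\<bar> \<le> B"
        using B by (cases n) (auto simp: T_def lessThan_Suc_atMost)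
      then have "\<bar>(\<Sum>d<n. S d - M) * g n\<bar> \<le> B * g n"
        using dec by (auto simp: abs_mult g_def intro!: mult_mono)
      moreover have "\<bar>T d * (g d - g (Suc d))\<bar> \<le> B * (g d - g (Suc d))" for d
      proof -
        have "0 \<le> g d - g (Suc d)" using conv[rule_format, of d] by (simp add: g_def)
        then show ?thesis using B by (auto simp: abs_mult intro!: mult_right_mono)
      qed
      then have "\<bar>\<Sum>d<n. T d * (g d - g (Suc d))\<bar> \<le> (\<Sum>d<n. B * (g d - g (Suc d)))"
        by (intro sum_abs[THEN order_trans] sum_mono)
      moreover have "(\<Sum>d<n. B * (g d - g (Suc d))) = B * (g 0 - g n)"
        by (simp add: sum_distrib_left[symmetric] sum_lessThan_telescope')
      ultimately show ?thesis by linarith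
    qed
    have "(\<Sum>d<n. c d * a d) - (\<Sum>d<n. c d) * a n - M * (a 0 - a n) = (\<Sum>d<n. (S d - M) * g d)" for n
    proof -
      have "(\<Sum>d<n. c d * a d) = (\<Sum>d<n. c d) * a n + (\<Sum>d<n. S d * g d)"
        by (subst summation_by_parts_less) (simp add: S_def g_def)
      moreover have "(\<Sum>d<n. g d) = a 0 - a n" by (simp add: g_def sum_lessThan_telescope')
      moreover have "(\<Sum>d<n. (S d - M) * g d) = (\<Sum>d<n. S d * g d) - M * (\<Sum>d<n. g d)"
        by (simp add: left_diff_distrib sum_subtractf sum_distrib_left)
      ultimately show ?thesis by simp
    qed
    then have bd: "\<bar>(\<Sum>d<n. c d * a d) - (\<Sum>d<n. c d) * a n - M * (a 0 - a n)\<bar> \<le> B * g 0" for n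
      using bound[of n] by (simp add: algebra_simps)
    have l1: "(\<lambda>n. (\<Sum>d<n. c d * a d)) \<longlonglongrightarrow> s" using s by (simp add: sums_def)
    have "(\<lambda>n. (\<Sum>d<n. c d) * a n) \<longlonglongrightarrow> 0"
    proof (rule Lim_null_comparison[OF always_eventually])
      show "\<forall>n. norm ((\<Sum>d<n. c d) * a n) \<le> B' * \<bar>a n\<bar>"
      proof
        fix n have "\<bar>\<Sum>d<n. c d\<bar> \<le> B'"
          using B' by (cases n) (auto simp: S_def lessThan_Suc_atMost)
        then show "norm ((\<Sum>d<n. c d) * a n) \<le> B' * \<bar>a n\<bar>"
          by (auto simp: abs_mult intro!: mult_right_mono)
      qed
      show "(\<lambda>n. B' * \<bar>a n\<bar>) \<longlonglongrightarrow> 0"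
        using tendsto_mult_right_zero[OF tendsto_rabs_zero[OF lim]] by simp
    qed
    then have "(\<lambda>n. (\<Sum>d<n. c d * a d) - (\<Sum>d<n. c d) * a n - M * (a 0 - a n)) \<longlonglongrightarrow> s - 0 - M * (a 0 - 0)"
      by (intro tendsto_intros l1 lim)
    then have "\<bar>s - 0 - M * (a 0 - 0)\<bar> \<le> B * g 0"
      by (intro LIMSEQ_le_const2[OF tendsto_rabs]) (use bd in auto)
    then show "\<bar>s - M * a 0\<bar> \<le> B * (a 0 - a 1)" by (simp add: g_def)
  qed
qed

text \<open>Convexity of \<open>1 / (1 + exp x)\<close> on \<open>x \<ge> 0\<close> at three
  equidistant points, with \<open>E = exp x\<close> at the first and \<open>z\<close> the
  exponential of the spacing. Clearing denominators leaves
  \<open>(z - 1)\<^sup>2 * E * (E * z - 1)\<close>, which is nonnegative.\<close>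

lemma logistic_convex:
  fixes E z :: real
  assumes "E \<ge> 1" "z \<ge> 1"
  shows "1 / (1 + E * z) - 1 / (1 + E * z * z) \<le> 1 / (1 + E) - 1 / (1 + E * z)"
proof -
  have Ez: "E * z \<ge> 1" using assms mult_mono[of 1 E 1 z] by simp
  have Ezz: "E * z * z \<ge> 1" using assms Ez mult_mono[of 1 "E * z" 1 z] by simp
  have "(2 + E + E * z * z) * (1 + E * z) - 2 * (1 + E) * (1 + E * z * z) = (z - 1)\<^sup>2 * E * (E * z - 1)"
    by (simp add: algebra_simps power2_eq_square)
  also have "\<dots> \<ge> 0" using assms Ez by (intro mult_nonneg_nonneg) auto
  finally have "2 * (1 + E) * (1 + E * z * z) \<le> (2 + E + E * z * z) * (1 + E * z)" by simp
  then have "2 / (1 + E * z) \<le> (2 + E + E * z * z) / ((1 + E) * (1 + E * z * z))"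
    using assms Ez Ezz by (simp add: divide_simps) (simp add: algebra_simps)
  also have "\<dots> = 1 / (1 + E) + 1 / (1 + E * z * z)"
    using assms Ez Ezz by (simp add: divide_simps)
  finally show ?thesis by simp
qed

text \<open>For \<open>a d = 1 / (1 + exp (d * t))\<close> the value \<open>a 0\<close> is
  \<open>1 / 2\<close> for every \<open>t\<close>, while the error \<open>a 0 - a 1\<close> tends to
  0 with \<open>t\<close>.\<close>

lemma logistic_series_limit:
  fixes c :: "nat \<Rightarrow> real"
  assumes per: "\<And>n. c (n + p) = c n" "p > 0" and zero: "(\<Sum>k<p. c k) = 0"
  assumes s: "\<And>t. t > 0 \<Longrightarrow> (\<lambda>d. c d / (1 + exp (real d * t))) sums s t"
  shows "(s \<longlongrightarrow> ((\<Sum>d<p. \<Sum>j\<le>d. c j) / real p) / 2) (at_right 0)"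
proof -
  define M where "M = (\<Sum>d<p. \<Sum>j\<le>d. c j) / real p"
  obtain B where B: "B \<ge> 0" and bd: "\<And>a s. (\<And>d. 0 \<le> a d - a (Suc d)) \<Longrightarrow>
      (\<And>d. a (Suc d) - a (Suc (Suc d)) \<le> a d - a (Suc d)) \<Longrightarrow> a \<longlonglongrightarrow> 0 \<Longrightarrow>
      (\<lambda>d. c d * a d) sums s \<Longrightarrow> \<bar>s - M * a 0\<bar> \<le> B * (a 0 - a 1)"
    using periodic_summation_convex[of c p, OF per zero] unfolding M_def by blast
  have main: "\<bar>s t - M / 2\<bar> \<le> B * (1 / 2 - 1 / (1 + exp t))" if t: "t > 0" for t
  proof -
    define a where "a d = 1 / (1 + exp (real d * t))" for d
    have pos: "1 + exp (real d * t) > 0" for d by (simp add: add_pos_pos)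
    have "\<bar>s t - M * a 0\<bar> \<le> B * (a 0 - a 1)"
    proof (rule bd)
      show "0 \<le> a d - a (Suc d)" for d
        unfolding a_def using t pos by (simp add: frac_le)
      show "a (Suc d) - a (Suc (Suc d)) \<le> a d - a (Suc d)" for d
      proof -
        have e: "exp (real (Suc n) * t) = exp (real n * t) * exp t" for n
          by (simp add: ring_distribs exp_add mult_ac)
        show ?thesis using logistic_convex[of "exp (real d * t)" "exp t"] t
          unfolding a_def e by simp
      qed
      have "filterlim (\<lambda>d. 1 + exp (real d * t)) at_top sequentially"
        by (intro filterlim_tendsto_add_at_top[OF tendsto_const] filterlim_compose[OF exp_at_top]
              filterlim_at_top_mult_tendsto_pos[OF tendsto_const t] filterlim_real_sequentially)
      then show "a \<longlonglongrightarrow> 0" unfolding a_def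
        by (intro real_tendsto_divide_at_top[OF tendsto_const])
      show "(\<lambda>d. c d * a d) sums s t" using s[OF t] by (simp add: a_def)
    qed
    then show ?thesis by (simp add: a_def)
  qed
  have "((\<lambda>t. B * (1 / 2 - 1 / (1 + exp t))) \<longlongrightarrow> B * (1 / 2 - 1 / (1 + exp 0))) (at_right (0::real))"
    by (intro tendsto_intros) (simp_all add: tendsto_ident_at)
  then have "((\<lambda>t. B * (1 / 2 - 1 / (1 + exp t))) \<longlongrightarrow> 0) (at_right (0::real))" by simp
  moreover have "eventually (\<lambda>t. norm (s t - M / 2) \<le> B * (1 / 2 - 1 / (1 + exp t))) (at_right 0)"
    using main by (auto simp: eventually_at_right_field intro!: exI[of _ 1])
  ultimately have "((\<lambda>t. s t - M / 2) \<longlongrightarrow> 0) (at_right 0)"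
    by (rule Lim_null_comparison[rotated])
  then show ?thesis using LIM_zero_iff[of s "M/2" "at_right 0"] by (simp add: M_def)
qed

section \<open>Counting ideals of given norm\<close>

lemma multiplicative_eqI:
  fixes f g :: "nat \<Rightarrow> int"
  assumes one: "f 1 = g 1"
    and f: "\<And>a b. a > 0 \<Longrightarrow> b > 0 \<Longrightarrow> coprime a b \<Longrightarrow> f (a * b) = f a * f b"
    and g: "\<And>a b. a > 0 \<Longrightarrow> b > 0 \<Longrightarrow> coprime a b \<Longrightarrow> g (a * b) = g a * g b"
    and pp: "\<And>q k. prime q \<Longrightarrow> f (q ^ k) = g (q ^ k)"
  shows "n > 0 \<Longrightarrow> f n = g n"
proof (induction n rule: less_induct)
  case (less n)
  show ?case
  proof (cases "n = 1")
    case False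
    then obtain q where q: "prime q" "q dvd n" using prime_factor_nat by blast
    obtain y where y: "n = q ^ multiplicity q n * y" "\<not> q dvd y"
      using multiplicity_decompose'[of n q] less.prems q(1) by (metis not_prime_unit not_gr_zero)
    define k where "k = multiplicity q n"
    have k: "n = q ^ k * y" using y(1) by (simp add: k_def)
    have "k > 0" using q less.prems unfolding k_def by (simp add: prime_multiplicity_gt_zero_iff)
    then have "q ^ k > 1" using prime_gt_1_nat[OF q(1)] by (intro one_less_power)
    have "y > 0" using less.prems k by (metis mult_0_right not_gr_zero)
    have "y < n" unfolding k using \<open>q ^ k > 1\<close> \<open>y > 0\<close> by simp
    have "coprime q y" using q(1) y(2) by (rule prime_imp_coprime)
    then have cop: "coprime (q ^ k) y" by simp
    have "0 < q ^ k" using \<open>q ^ k > 1\<close> by linarith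
    then have "f n = f (q ^ k) * f y" unfolding k using cop \<open>y > 0\<close> by (intro f)
    moreover have "g n = g (q ^ k) * g y" unfolding k using cop \<open>y > 0\<close> \<open>0 < q ^ k\<close> by (intro g)
    ultimately show ?thesis using less.IH[OF \<open>y < n\<close> \<open>y > 0\<close>] pp[OF q(1)] by simp
  qed (use one in simp)
qed

text \<open>A divisor of a product of coprime numbers splits uniquely. The exponent covers two uses
  at once: \<open>k = 1\<close> for sums over divisors and \<open>k = 2\<close> for sums over square
  divisors.\<close>

lemma bij_betw_coprime_power_divisors:
  fixes a b :: nat
  assumes ab: "coprime a b" and k: "k > 0"
  shows "bij_betw (\<lambda>(x, y). x * y) ({x. x ^ k dvd a} \<times> {y. y ^ k dvd b}) {g. g ^ k dvd a * b}"
proof -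
  have base: "x dvd a" if "x ^ k dvd a" for x a :: nat
    using that k by (metis dvd_power dvd_trans)
  have uniq: "x dvd x'" if "x * y = x' * y'" "x ^ k dvd a" "y' ^ k dvd b" for x y x' y'
  proof -
    have "coprime x y'" using ab base[OF that(2)] base[OF that(3)] by (metis coprime_divisors)
    moreover have "x dvd x' * y'" using that(1) by (metis dvd_triv_left)
    ultimately show ?thesis by (simp add: coprime_dvd_mult_left_iff)
  qed
  show ?thesis
  proof (rule bij_betwI')
    fix r s assume r: "r \<in> {x. x ^ k dvd a} \<times> {y. y ^ k dvd b}" and s: "s \<in> {x. x ^ k dvd a} \<times> {y. y ^ k dvd b}"
    obtain x y x' y' where [simp]: "r = (x, y)" "s = (x', y')" by (cases r, cases s) blast
    show "((case r of (x, y) \<Rightarrow> x * y) = (case s of (x, y) \<Rightarrow> x * y)) = (r = s)"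
    proof
      assume "(case r of (x, y) \<Rightarrow> x * y) = (case s of (x, y) \<Rightarrow> x * y)"
      then have e: "x * y = x' * y'" by simp
      have m: "x ^ k dvd a" "y ^ k dvd b" "x' ^ k dvd a" "y' ^ k dvd b" using r s by auto
      have "x dvd x'" "x' dvd x" using uniq[OF e m(1,4)] uniq[OF e[symmetric] m(3,2)] by auto
      then have xx: "x = x'" by (rule dvd_antisym)
      show "r = s"
      \<comment> \<open>A zero component occurs only for \<open>a = 0\<close>, and then coprimality
        forces \<open>b = 1\<close>.\<close>
      proof (cases "x = 0")
        case True
        then have "a = 0" using m(1) k by (simp add: zero_power)
        then have "b = 1" using ab by simp
        then have "y = 1" "y' = 1" using m(2,4) k by (auto simp: power_eq_1_iff nat_power_eq_Suc_0_iff)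
        then show ?thesis using xx by simp
      qed (use e xx in simp)
    qed simp
  next
    fix r assume "r \<in> {x. x ^ k dvd a} \<times> {y. y ^ k dvd b}"
    then show "(case r of (x, y) \<Rightarrow> x * y) \<in> {g. g ^ k dvd a * b}"
      by (auto simp: power_mult_distrib intro: mult_dvd_mono)
  next
    fix g assume "g \<in> {g. g ^ k dvd a * b}"
    then have g: "g ^ k dvd a * b" by simp
    then obtain x y where xy: "g = x * y" "x dvd a" "y dvd b" using base[OF g] division_decomp by blast
    have "coprime (x ^ k) b" "coprime (y ^ k) a" using ab xy(2,3)
      by (auto intro: coprime_divisors[of _ a b b] coprime_divisors[of _ b a a] simp: coprime_commute)
    moreover have "x ^ k dvd a * b" "y ^ k dvd b * a" using g xy(1) by (auto simp: power_mult_distrib mult.commute dest: dvd_mult_left dvd_mult_right)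
    ultimately have "x ^ k dvd a" "y ^ k dvd b" by (auto simp: coprime_dvd_mult_left_iff)
    then show "\<exists>r\<in>{x. x ^ k dvd a} \<times> {y. y ^ k dvd b}. g = (case r of (x, y) \<Rightarrow> x * y)"
      using xy(1) by (intro bexI[of _ "(x, y)"]) auto
  qed
qed

lemma sum_power_divisors_mult:
  fixes h h1 h2 :: "nat \<Rightarrow> int"
  assumes "coprime a b" "k > 0"
    and "\<And>x y. x ^ k dvd a \<Longrightarrow> y ^ k dvd b \<Longrightarrow> h (x * y) = h1 x * h2 y"
  shows "(\<Sum>g | g ^ k dvd a * b. h g) = (\<Sum>x | x ^ k dvd a. h1 x) * (\<Sum>y | y ^ k dvd b. h2 y)"
proof -
  have "(\<Sum>g | g ^ k dvd a * b. h g) = (\<Sum>(x, y)\<in>{x. x ^ k dvd a} \<times> {y. y ^ k dvd b}. h (x * y))"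
    using sum.reindex_bij_betw[OF bij_betw_coprime_power_divisors[OF assms(1,2)], of h]
    by (simp add: case_prod_unfold)
  also have "\<dots> = (\<Sum>(x, y)\<in>{x. x ^ k dvd a} \<times> {y. y ^ k dvd b}. h1 x * h2 y)"
    by (intro sum.cong refl) (auto simp: assms(3))
  finally show ?thesis by (simp add: sum_product sum.cartesian_product)
qed

text \<open>\<open>b\<^sup>2 + b + m\<close> is the norm of \<open>b + om\<close>, and
  \<open>a \<int> + (b + om) \<int>\<close> is an ideal when \<open>a\<close> divides it. The number
  is that of the ideals of norm \<open>a\<close> that are not divisible by an integer greater than
  1.\<close>

definition root_count :: "nat \<Rightarrow> nat \<Rightarrow> int" where
  "root_count m a = int (card {b. b < a \<and> a dvd b\<^sup>2 + b + m})"

text \<open>An ideal is uniquely a positive integer \<open>g\<close> times such a primitive ideal,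
  and \<open>g\<close> contributes \<open>g\<^sup>2\<close> to the norm.\<close>

definition ideal_count :: "nat \<Rightarrow> nat \<Rightarrow> int" where
  "ideal_count m n = (\<Sum>g | g\<^sup>2 dvd n. root_count m (n div g\<^sup>2))"

lemma dvd_quadratic_cong:
  fixes x y a m :: nat
  assumes "[x = y] (mod a)"
  shows "a dvd x\<^sup>2 + x + m \<longleftrightarrow> a dvd y\<^sup>2 + y + m"
  by (intro cong_dvd_iff cong_add cong_pow assms cong_refl)

lemma root_count_1 [simp]: "root_count m (Suc 0) = 1"
proof -
  have "{b. b < Suc 0 \<and> Suc 0 dvd b\<^sup>2 + b + m} = {0}" by auto
  then show ?thesis by (simp add: root_count_def)
qed

text \<open>Chinese remainder theorem, applied to the roots of
  \<open>b\<^sup>2 + b + m\<close>.\<close>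

lemma root_count_mult:
  assumes ab: "coprime a b" and pos: "a > 0" "b > 0"
  shows "root_count m (a * b) = root_count m a * root_count m b"
proof -
  define R where "R a = {x. x < a \<and> a dvd x\<^sup>2 + x + m}" for a
  have "bij_betw (\<lambda>x. (x mod a, x mod b)) (R (a * b)) (R a \<times> R b)"
  proof (rule bij_betwI')
    fix x y assume x: "x \<in> R (a * b)" and y: "y \<in> R (a * b)"
    show "((x mod a, x mod b) = (y mod a, y mod b)) = (x = y)"
    proof
      assume "(x mod a, x mod b) = (y mod a, y mod b)"
      then have "[x = y] (mod a * b)" using ab by (intro coprime_cong_mult_nat) (auto simp: unique_euclidean_semiring_class.cong_def)
      then show "x = y" using x y by (auto simp: R_def intro: cong_less_modulus_unique_nat)
    qed simp
  next
    fix x assume x: "x \<in> R (a * b)"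
    then have "a dvd x\<^sup>2 + x + m" "b dvd x\<^sup>2 + x + m" by (auto simp: R_def dest: dvd_mult_left dvd_mult_right)
    then have "a dvd (x mod a)\<^sup>2 + x mod a + m" "b dvd (x mod b)\<^sup>2 + x mod b + m"
      using dvd_quadratic_cong[of "x mod a" x a m] dvd_quadratic_cong[of "x mod b" x b m]
      by (simp_all add: cong_mod_left)
    then show "(x mod a, x mod b) \<in> R a \<times> R b" using pos by (simp add: R_def)
  next
    fix r assume "r \<in> R a \<times> R b"
    then obtain u v where uv: "r = (u, v)" "u \<in> R a" "v \<in> R b" by auto
    obtain x0 where x0: "[x0 = u] (mod a)" "[x0 = v] (mod b)" using binary_chinese_remainder_nat[OF ab] by blast
    define x where "x = x0 mod (a * b)"
    have xa: "[x = u] (mod a)" and xb: "[x = v] (mod b)"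
      using x0 by (auto simp: x_def unique_euclidean_semiring_class.cong_def mod_mod_cancel)
    have "a dvd x\<^sup>2 + x + m" "b dvd x\<^sup>2 + x + m"
      using uv dvd_quadratic_cong[OF xa] dvd_quadratic_cong[OF xb] by (auto simp: R_def)
    then have "a * b dvd x\<^sup>2 + x + m" using ab by (simp add: divides_mult)
    then have "x \<in> R (a * b)" using pos by (simp add: R_def x_def)
    moreover have "r = (x mod a, x mod b)" using uv xa xb by (simp add: R_def unique_euclidean_semiring_class.cong_def)
    ultimately show "\<exists>x\<in>R (a * b). r = (x mod a, x mod b)" by blast
  qed
  then have "card (R (a * b)) = card (R a) * card (R b)"
    by (metis bij_betw_same_card card_cartesian_product)
  then show ?thesis by (simp add: root_count_def R_def)
qed

lemma ideal_count_mult: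
  assumes ab: "coprime a b" and pos: "a > 0" "b > 0"
  shows "ideal_count m (a * b) = ideal_count m a * ideal_count m b"
  unfolding ideal_count_def
proof (rule sum_power_divisors_mult[OF ab])
  fix x y assume xy: "x\<^sup>2 dvd a" "y\<^sup>2 dvd b"
  then obtain a' b' where ab': "a = x\<^sup>2 * a'" "b = y\<^sup>2 * b'" by (auto elim!: dvdE)
  have "x > 0" "y > 0" "a' > 0" "b' > 0" using ab' pos by (auto intro!: Nat.gr0I)
  moreover have "coprime a' b'" using ab unfolding ab' by simp
  moreover have "a * b div (x * y)\<^sup>2 = a' * b'"
  proof -
    have "a * b = (x * y)\<^sup>2 * (a' * b')" by (simp add: ab' power_mult_distrib mult_ac)
    then show ?thesis using \<open>x > 0\<close> \<open>y > 0\<close> by simp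
  qed
  ultimately show "root_count m (a * b div (x * y)\<^sup>2) = root_count m (a div x\<^sup>2) * root_count m (b div y\<^sup>2)"
    by (simp add: root_count_mult ab')
qed simp


text \<open>\<open>2 * b + 1\<close> is the derivative of the polynomial at \<open>b\<close>. By
  \<open>(2 * b + 1)\<^sup>2 + p = 4 * (b\<^sup>2 + b + m)\<close> a multiple root modulo
  \<open>q\<close> would make \<open>q\<close> divide \<open>p\<close>.\<close>

lemma root_unit:
  fixes q p m b :: nat
  assumes "prime q" "prime p" "q \<noteq> p" "p + 1 = 4 * m" "q dvd b\<^sup>2 + b + m"
  shows "\<not> q dvd 2 * b + 1"
proof
  assume "q dvd 2 * b + 1"
  then have "q dvd (2 * b + 1)\<^sup>2" unfolding power2_eq_square by (rule dvd_mult)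
  moreover have "(2 * b + 1)\<^sup>2 + p = 4 * (b\<^sup>2 + b + m)"
    using assms(4) by (simp add: power2_eq_square algebra_simps)
  ultimately have "q dvd p" using assms(5) by (metis dvd_add_right_iff dvd_mult)
  then show False using assms primes_dvd_imp_eq by blast
qed

text \<open>Hensel lifting: roots are simple away from \<open>p\<close>, so each root modulo
  \<open>q ^ k\<close> has exactly one lift modulo \<open>q ^ Suc k\<close>.\<close>

lemma root_count_prime_power_Suc:
  assumes q: "prime q" "prime p" "q \<noteq> p" and m: "p + 1 = 4 * m" and k: "k > 0"
  shows "root_count m (q ^ Suc k) = root_count m (q ^ k)"
proof -
  define N where "N = q ^ k"
  have N: "N > 0" "q dvd N" using q(1) k by (auto simp: N_def prime_gt_0_nat)
  have Q: "q ^ Suc k = q * N" by (simp add: N_def)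
  define R where "R a = {x. x < a \<and> a dvd x\<^sup>2 + x + m}" for a
  have "bij_betw (\<lambda>x. x mod N) (R (q * N)) (R N)"
  proof (rule bij_betwI')
    fix x y assume x: "x \<in> R (q * N)" and y: "y \<in> R (q * N)"
    show "(x mod N = y mod N) = (x = y)"
    proof
      assume xy: "x mod N = y mod N"
      have dx: "int (q * N) dvd (int x)\<^sup>2 + int x + int m" and dy: "int (q * N) dvd (int y)\<^sup>2 + int y + int m"
        using x y unfolding R_def of_nat_power[symmetric] of_nat_add[symmetric] of_nat_dvd_iff by simp_all
      \<comment> \<open>Uniqueness of the lift: in the factorisation of the difference,
        \<open>x + y + 1\<close> is congruent to \<open>2 * x + 1\<close> modulo \<open>q\<close>,
        hence coprime to \<open>q\<close>, and the full power must divide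
        \<open>x - y\<close>.\<close>
      have "int (q * N) dvd ((int x)\<^sup>2 + int x + int m) - ((int y)\<^sup>2 + int y + int m)"
        using dx dy by (rule dvd_diff)
      also have "((int x)\<^sup>2 + int x + int m) - ((int y)\<^sup>2 + int y + int m) = (int x - int y) * (int x + int y + 1)"
        by (simp add: power2_eq_square algebra_simps)
      finally have d: "int (q * N) dvd (int x - int y) * (int x + int y + 1)" .
      have "int N dvd int x - int y" using xy by (metis mod_eq_dvd_iff zmod_int)
      then have qd: "int q dvd int x - int y" using N(2) by (metis dvd_trans of_nat_dvd_iff)
      have "q dvd x\<^sup>2 + x + m" using x by (auto simp: R_def dest: dvd_mult_left)
      then have "\<not> q dvd 2 * x + 1" by (rule root_unit[OF q m])
      then have nd: "\<not> int q dvd int (2 * x + 1)" unfolding of_nat_dvd_iff .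
      have nd': "\<not> int q dvd int x + int y + 1"
      proof
        assume "int q dvd int x + int y + 1"
        then have "int q dvd (int x + int y + 1) + (int x - int y)" using qd by (rule dvd_add)
        moreover have "(int x + int y + 1) + (int x - int y) = int (2 * x + 1)" by simp
        ultimately show False using nd by metis
      qed
      have "coprime (int q) (int x + int y + 1)" using nd' q(1) by (intro prime_imp_coprime) auto
      then have "coprime (int (q * N)) (int x + int y + 1)" by (simp add: N_def)
      then have "int (q * N) dvd int x - int y" using d by (simp add: coprime_dvd_mult_left_iff)
      then have "[int x = int y] (mod int (q * N))" by (simp add: cong_iff_dvd_diff)
      then have "[x = y] (mod q * N)" by (simp only: cong_int_iff)
      then show "x = y" using x y by (auto simp: R_def intro: cong_less_modulus_unique_nat)
    qed simp
  next
    fix x assume x: "x \<in> R (q * N)"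
    then have "N dvd x\<^sup>2 + x + m" by (auto simp: R_def dest: dvd_mult_right)
    then have "N dvd (x mod N)\<^sup>2 + x mod N + m"
      using dvd_quadratic_cong[of "x mod N" x N m] by (simp add: cong_mod_left)
    then show "x mod N \<in> R N" using N by (simp add: R_def)
  next
    fix b assume b: "b \<in> R N"
    then obtain f where f: "b\<^sup>2 + b + m = N * f" by (auto simp: R_def elim!: dvdE)
    have "q dvd b\<^sup>2 + b + m" unfolding f using N(2) by simp
    then have "\<not> q dvd 2 * b + 1" by (rule root_unit[OF q m])
    then have "coprime (2 * b + 1) q" using q(1) by (metis prime_imp_coprime coprime_commute)
    then obtain i where i: "[(2 * b + 1) * i = Suc 0] (mod q)" using cong_solve_coprime_nat by blast
    \<comment> \<open>The lift \<open>b + N * s\<close> requires \<open>f + (2 * b + 1) * s\<close>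
      to be divisible by \<open>q\<close>; \<open>i\<close> inverts \<open>2 * b + 1\<close>, and
      \<open>q - 1\<close> plays the role of \<open>- 1\<close> in the natural numbers.\<close>
    define s where "s = (i * ((q - 1) * f)) mod q"
    have q1: "q > 1" using q(1) prime_gt_1_nat by blast
    have "[(2 * b + 1) * s = (2 * b + 1) * (i * ((q - 1) * f))] (mod q)"
      by (intro cong_mult cong_refl) (simp add: s_def cong_mod_left)
    also have "(2 * b + 1) * (i * ((q - 1) * f)) = ((2 * b + 1) * i) * ((q - 1) * f)" by (simp only: mult_ac)
    also have "[((2 * b + 1) * i) * ((q - 1) * f) = Suc 0 * ((q - 1) * f)] (mod q)"
      by (intro cong_mult cong_refl i)
    finally have "[f + (2 * b + 1) * s = f + Suc 0 * ((q - 1) * f)] (mod q)" by (intro cong_add cong_refl)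
    moreover have "f + Suc 0 * ((q - 1) * f) = q * f" using q1 by (simp add: algebra_simps diff_mult_distrib)
    ultimately have "q dvd f + (2 * b + 1) * s" by (metis cong_dvd_iff dvd_triv_left)
    then have 1: "q * N dvd N * (f + (2 * b + 1) * s)" by (metis mult.commute mult_dvd_mono dvd_refl)
    define x where "x = b + N * s"
    have "x\<^sup>2 + x + m = (b\<^sup>2 + b + m) + N * ((2 * b + 1) * s) + N * (N * s\<^sup>2)"
      by (simp add: x_def power2_eq_square algebra_simps)
    also have "\<dots> = N * (f + (2 * b + 1) * s) + N * (N * s\<^sup>2)"
      unfolding f by (simp only: distrib_left)
    also have "q * N dvd N * (f + (2 * b + 1) * s) + N * (N * s\<^sup>2)"
      using 1 N(2) by (intro dvd_add) (auto simp: mult.commute intro!: mult_dvd_mono dvd_mult2)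
    finally have "q * N dvd x\<^sup>2 + x + m" .
    moreover have "x < q * N"
    proof -
      have "s < q" using q1 by (simp add: s_def)
      then have "N * Suc s \<le> N * q" by (intro mult_le_mono2) simp
      then show ?thesis using b by (simp add: x_def R_def mult.commute)
    qed
    ultimately have "x \<in> R (q * N)" by (simp add: R_def)
    moreover have "b = x mod N" using b by (simp add: x_def R_def)
    ultimately show "\<exists>x\<in>R (q * N). b = x mod N" by blast
  qed
  then have "card (R (q * N)) = card (R N)" by (rule bij_betw_same_card)
  then show ?thesis unfolding Q by (simp add: root_count_def R_def N_def)
qed

lemma root_count_prime:
  assumes q: "prime q" "prime p" "q \<noteq> p" and m: "p + 1 = 4 * m"
  shows "root_count m q = (if \<exists>b. q dvd b\<^sup>2 + b + m then 2 else 0)"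
proof (cases "\<exists>b. q dvd b\<^sup>2 + b + m")
  case False
  then have "{b. b < q \<and> q dvd b\<^sup>2 + b + m} = {}" by auto
  then show ?thesis using False by (simp only: root_count_def card.empty if_False of_nat_0)
next
  case True
  have q1: "q > 1" using q(1) prime_gt_1_nat by blast
  obtain b0 where b0: "q dvd b0\<^sup>2 + b0 + m" using True by blast
  define b where "b = b0 mod q"
  have b: "q dvd b\<^sup>2 + b + m" "b < q"
    using b0 dvd_quadratic_cong[of b b0 q m] q1 by (simp_all add: b_def cong_mod_left)
  \<comment> \<open>The two roots add up to \<open>- 1\<close>; this is \<open>- 1 - b\<close>
    reduced modulo \<open>q\<close>.\<close>
  define c where "c = q - 1 - b"
  have c: "c < q" "int c = int q - 1 - int b" using b(2) by (auto simp: c_def)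
  have dint: "q dvd x\<^sup>2 + x + m \<longleftrightarrow> int q dvd (int x)\<^sup>2 + int x + int m" for x
    unfolding of_nat_power[symmetric] of_nat_add[symmetric] of_nat_dvd_iff ..
  have diff: "((int x)\<^sup>2 + int x + int m) - ((int b)\<^sup>2 + int b + int m) = (int x - int b) * (int x + int b + 1)" for x
    by (simp add: power2_eq_square algebra_simps)
  have iff: "q dvd x\<^sup>2 + x + m \<longleftrightarrow> int q dvd int x - int b \<or> int q dvd int x + int b + 1" for x
  proof -
    have "q dvd x\<^sup>2 + x + m \<longleftrightarrow> int q dvd (int x - int b) * (int x + int b + 1)"
      unfolding dint diff[symmetric] using b(1)[unfolded dint] by (metis dvd_diff dvd_diff_right_iff dvd_diff_left_iff)
    then show ?thesis using q(1) by (simp add: prime_dvd_mult_iff)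
  qed
  have "{x. x < q \<and> q dvd x\<^sup>2 + x + m} = {b, c}"
  proof (intro equalityI subsetI)
    fix x assume x: "x \<in> {x. x < q \<and> q dvd x\<^sup>2 + x + m}"
    then consider "int q dvd int x - int b" | "int q dvd int x + int b + 1" using iff by blast
    then show "x \<in> {b, c}"
    proof cases
      case 1
      then have "[int x = int b] (mod int q)" by (simp add: cong_iff_dvd_diff)
      then have "x = b" using x b(2) by (auto simp: cong_int_iff intro: cong_less_modulus_unique_nat)
      then show ?thesis by simp
    next
      case 2
      then have "int q dvd int x - int c" unfolding c(2) using dvd_diff[OF 2 dvd_refl[of "int q"]]
        by (simp add: algebra_simps)
      then have "[int x = int c] (mod int q)" by (simp add: cong_iff_dvd_diff)
      then have "x = c" using x c(1) by (auto simp: cong_int_iff intro: cong_less_modulus_unique_nat)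
      then show ?thesis by simp
    qed
  next
    fix x assume "x \<in> {b, c}"
    then show "x \<in> {x. x < q \<and> q dvd x\<^sup>2 + x + m}"
      using b c iff[of c] by (auto simp: algebra_simps)
  qed
  moreover have "b \<noteq> c"
  proof
    assume "b = c"
    then have "2 * b + 1 = q" using b(2) q1 unfolding c_def by linarith
    then show False using root_unit[OF q m b(1)] by simp
  qed
  ultimately have "card {x. x < q \<and> q dvd x\<^sup>2 + x + m} = 2" by simp
  then show ?thesis using True by (simp add: root_count_def)
qed

text \<open>Four times the polynomial is \<open>(2 * b + 1)\<^sup>2\<close> modulo \<open>p\<close>,
  so there is a single double root \<open>(p - 1) div 2\<close>. A root modulo
  \<open>p\<^sup>2\<close> would make both \<open>(2 * b + 1)\<^sup>2\<close> and
  \<open>(2 * b + 1)\<^sup>2 + p\<close> multiples of \<open>p\<^sup>2\<close>.\<close>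

lemma root_count_ramified:
  assumes p: "prime p" and m: "p + 1 = 4 * m"
  shows "root_count m p = 1" "k \<ge> 2 \<Longrightarrow> root_count m (p ^ k) = 0"
proof -
  have p2: "p > 2" using p m prime_gt_1_nat[OF p] by presburger
  have disc: "(2 * b + 1)\<^sup>2 + p = 4 * (b\<^sup>2 + b + m)" for b
    using m by (simp add: power2_eq_square algebra_simps)
  have podd: "odd p" using p p2 prime_odd_nat by blast
  then have "coprime p (4::nat)" using coprime_power_right_iff[of p 2 2] by (simp add: coprime_right_2_iff_odd)
  then have iff: "p dvd b\<^sup>2 + b + m \<longleftrightarrow> p dvd 2 * b + 1" for b
    using disc[of b] p by (metis coprime_dvd_mult_right_iff dvd_add_left_iff dvd_refl dvd_triv_right prime_dvd_power_iff zero_less_numeral)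
  have "{b. b < p \<and> p dvd b\<^sup>2 + b + m} = {(p - 1) div 2}"
  proof (intro equalityI subsetI)
    fix b assume "b \<in> {b. b < p \<and> p dvd b\<^sup>2 + b + m}"
    then have b: "b < p" "p dvd 2 * b + 1" by (simp_all add: iff)
    then obtain j where j: "2 * b + 1 = p * j" by (auto elim: dvdE)
    have "j < 2"
    proof (rule ccontr)
      assume "\<not> j < 2"
      then have "p * 2 \<le> p * j" by (intro mult_le_mono2) simp
      then show False using j b(1) by linarith
    qed
    moreover have "j \<noteq> 0" using j by (intro notI) simp
    ultimately have "j = 1" by simp
    then show "b \<in> {(p - 1) div 2}" using j by simp
  next
    fix b assume "b \<in> {(p - 1) div 2}"
    then have "2 * b + 1 = p" "b < p" using podd p2 by (auto elim!: oddE)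
    then show "b \<in> {b. b < p \<and> p dvd b\<^sup>2 + b + m}" by (simp add: iff)
  qed
  then show "root_count m p = 1" by (simp add: root_count_def)
  assume k: "k \<ge> 2"
  have "\<not> p ^ k dvd b\<^sup>2 + b + m" for b
  proof
    assume d: "p ^ k dvd b\<^sup>2 + b + m"
    have "p\<^sup>2 dvd p ^ k" using k by (rule le_imp_power_dvd)
    then have d2: "p\<^sup>2 dvd b\<^sup>2 + b + m" using d dvd_trans by blast
    then have "p dvd b\<^sup>2 + b + m" by (metis dvd_mult_left power2_eq_square)
    then have "p\<^sup>2 dvd (2 * b + 1)\<^sup>2" by (simp add: iff)
    moreover have "p\<^sup>2 dvd (2 * b + 1)\<^sup>2 + p" unfolding disc using d2 by (rule dvd_mult)
    ultimately have "p\<^sup>2 dvd p" by (metis dvd_add_right_iff)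
    then have "p\<^sup>2 \<le> p" using p2 by (intro dvd_imp_le) auto
    then show False using p2 by (simp add: power2_eq_square)
  qed
  then have "{b. b < p ^ k \<and> p ^ k dvd b\<^sup>2 + b + m} = {}" by blast
  then show "root_count m (p ^ k) = 0" by (simp only: root_count_def card.empty of_nat_0)
qed

section \<open>Legendre symbols and the splitting of primes\<close>

text \<open>Euler's criterion gives the equation modulo \<open>p\<close>, and the two sides differ
  by at most 2, which is less than \<open>p\<close>.\<close>

lemma Legendre_mult:
  fixes p :: nat
  assumes p: "prime p" "2 < p"
  shows "Legendre (a * b) (int p) = Legendre a (int p) * Legendre b (int p)"
proof -
  define e where "e = (p - 1) div 2"
  have E: "[Legendre a (int p) = a ^ e] (mod int p)" for a
    using euler_criterion[OF p] by (simp add: e_def)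
  have "[Legendre a (int p) * Legendre b (int p) = a ^ e * b ^ e] (mod int p)"
    by (intro cong_mult E)
  then have "[Legendre (a * b) (int p) = Legendre a (int p) * Legendre b (int p)] (mod int p)"
    using E[of "a * b"] unfolding power_mult_distrib by (metis cong_sym cong_trans)
  then have d: "int p dvd Legendre (a * b) (int p) - Legendre a (int p) * Legendre b (int p)"
    by (simp add: cong_iff_dvd_diff)
  have L: "Legendre c (int p) \<in> {-1, 0, 1}" for c by (simp add: Legendre_def)
  have "\<bar>Legendre (a * b) (int p) - Legendre a (int p) * Legendre b (int p)\<bar> \<le> 2"
    using L[of "a * b"] L[of a] L[of b] by auto
  then show ?thesis using d p(2) zdvd_imp_le[of "int p" "\<bar>Legendre (a * b) (int p) - Legendre a (int p) * Legendre b (int p)\<bar>"]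
    by (cases "Legendre (a * b) (int p) - Legendre a (int p) * Legendre b (int p) = 0") auto
qed

lemma Legendre_minus_one:
  fixes p :: nat
  assumes p: "prime p" "2 < p"
  shows "Legendre (- 1) (int p) = (- 1) ^ ((p - 1) div 2)"
proof -
  have "[Legendre (- 1) (int p) = (- 1) ^ ((p - 1) div 2)] (mod int p)"
    using euler_criterion[OF p] by simp
  then have d: "int p dvd Legendre (- 1) (int p) - (- 1) ^ ((p - 1) div 2)" by (simp add: cong_iff_dvd_diff)
  have L: "Legendre (- 1) (int p) \<in> {-1, 0, 1}" by (simp add: Legendre_def)
  have M: "(- 1 :: int) ^ ((p - 1) div 2) \<in> {-1, 1}" by (cases "even ((p - 1) div 2)") auto
  have "\<bar>Legendre (- 1) (int p) - (- 1) ^ ((p - 1) div 2)\<bar> \<le> 2" using L M by auto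
  then show ?thesis using d p(2) zdvd_imp_le[of "int p" "\<bar>Legendre (- 1) (int p) - (- 1) ^ ((p - 1) div 2)\<bar>"]
    by (cases "Legendre (- 1) (int p) - (- 1) ^ ((p - 1) div 2) = 0") auto
qed

text \<open>Gauss's lemma: half of \<open>p - 1\<close> is \<open>2 * m - 1\<close>, and the doubles
  that exceed it are those of \<open>m, ..., 2 * m - 1\<close>, exactly \<open>m\<close> in
  number.\<close>

lemma Legendre_two:
  fixes p m :: nat
  assumes p: "prime p" and m: "p + 1 = 4 * m"
  shows "Legendre 2 (int p) = (- 1) ^ m"
proof -
  have p2: "2 < p" using m prime_gt_1_nat[OF p] by presburger
  have h: "(int p - 1) div 2 = 2 * int m - 1" using m by presburger
  interpret GAUSS p 2
    by unfold_locales (use p p2 in \<open>auto simp: cong_0_iff dest: zdvd_imp_le\<close>)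
  have "E = (\<lambda>x. x * 2) ` {int m..2 * int m - 1}"
  proof (intro equalityI subsetI)
    fix y assume "y \<in> E"
    then obtain x where x: "0 < x" "x \<le> 2 * int m - 1" "y = (x * 2) mod int p" "2 * int m - 1 < y"
      unfolding E_def C_def B_def A_def h by auto
    have "x * 2 < int p" using x(2) m by linarith
    then have "y = x * 2" using x by simp
    then show "y \<in> (\<lambda>x. x * 2) ` {int m..2 * int m - 1}" using x by auto
  next
    fix y assume "y \<in> (\<lambda>x. x * 2) ` {int m..2 * int m - 1}"
    then obtain x where x: "int m \<le> x" "x \<le> 2 * int m - 1" "y = x * 2" by auto
    have "x * 2 < int p" "0 < x" using x m by linarith+
    then have "y = (x * 2) mod int p" using x by simp
    then show "y \<in> E" using x \<open>0 < x\<close> unfolding E_def C_def B_def A_def h by auto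
  qed
  then have "card E = card {int m..2 * int m - 1}" by (simp add: card_image inj_on_def)
  then have "card E = m" by simp
  then show ?thesis using gauss_lemma by simp
qed

text \<open>As \<open>(p - 1) div 2\<close> is odd, the sign in quadratic reciprocity is the symbol
  of \<open>- 1\<close> modulo \<open>q\<close>, which is absorbed into
  \<open>- int p\<close>.\<close>

lemma Legendre_reciprocity_3_mod_4:
  fixes p q m :: nat
  assumes p: "prime p" and m: "p + 1 = 4 * m" and q: "prime q" "2 < q" "q \<noteq> p"
  shows "Legendre (int q) (int p) = Legendre (- int p) (int q)"
proof -
  have p2: "2 < p" using m prime_gt_1_nat[OF p] by presburger
  define k where "k = (q - 1) div 2"
  have "odd ((p - 1) div 2)" using m by presburger
  then have e: "(- 1 :: int) ^ ((p - 1) div 2 * k) = (- 1) ^ k" by (simp add: power_mult)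
  have "Legendre (int p) (int q) * Legendre (int q) (int p) = (- 1) ^ k"
    using Quadratic_Reciprocity[OF p p2 q(1,2)] q(3) e by (simp add: k_def)
  moreover have "Legendre (- int p) (int q) = (- 1) ^ k * Legendre (int p) (int q)"
    using Legendre_mult[OF q(1,2), of "- 1" "int p"] Legendre_minus_one[OF q(1,2)] by (simp add: k_def)
  moreover have "Legendre (int p) (int q) \<in> {-1, 0, 1}" "Legendre (int q) (int p) \<in> {-1, 0, 1}" by (simp_all add: Legendre_def)
  moreover have "(- 1 :: int) ^ k = 1 \<or> (- 1 :: int) ^ k = - 1" by (cases "even k") auto
  ultimately show ?thesis by auto
qed

text \<open>For odd \<open>q\<close> a root exists iff the discriminant \<open>- p\<close> is a
  square modulo \<open>q\<close>, and reciprocity rewrites this as a condition on \<open>q\<close>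
  modulo \<open>p\<close>. For \<open>q = 2\<close> the number \<open>b\<^sup>2 + b\<close> is even,
  so the parity of \<open>m\<close> decides, as it does for the symbol of 2.\<close>

lemma root_count_prime_Legendre:
  fixes p q m :: nat
  assumes p: "prime p" and m: "p + 1 = 4 * m" and q: "prime q" "q \<noteq> p"
  shows "root_count m q = 1 + Legendre (int q) (int p)"
proof -
  have p2: "2 < p" using m prime_gt_1_nat[OF p] by presburger
  have nd: "\<not> [int q = 0] (mod int p)"
    using q p primes_dvd_imp_eq[of p q] unfolding cong_0_iff of_nat_dvd_iff by metis
  have L: "Legendre (int q) (int p) = 1 \<or> Legendre (int q) (int p) = - 1"
    using nd by (simp add: Legendre_def)
  have "(\<exists>b. q dvd b\<^sup>2 + b + m) \<longleftrightarrow> Legendre (int q) (int p) = 1"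
  proof (cases "q = 2")
    case True
    have "2 dvd b\<^sup>2 + b + m \<longleftrightarrow> even m" for b :: nat by (simp add: power2_eq_square)
    moreover have "Legendre (int q) (int p) = (- 1) ^ m" using Legendre_two[OF p m] True by simp
    ultimately show ?thesis using True by (cases "even m") auto
  next
    case False
    then have q2: "2 < q" using prime_gt_1_nat[OF q(1)] by linarith
    have nd': "\<not> [- int p = 0] (mod int q)"
      using q p primes_dvd_imp_eq[of q p] unfolding cong_0_iff dvd_minus_iff of_nat_dvd_iff by metis
    have "(\<exists>b. q dvd b\<^sup>2 + b + m) \<longleftrightarrow> QuadRes (int q) (- int p)"
    proof
      assume "\<exists>b. q dvd b\<^sup>2 + b + m"
      then obtain b where "q dvd b\<^sup>2 + b + m" by blast
      then have "int q dvd 4 * int (b\<^sup>2 + b + m)" by (simp only: of_nat_dvd_iff dvd_mult)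
      also have "4 * int (b\<^sup>2 + b + m) = (2 * int b + 1)\<^sup>2 - (- int p)"
        using m by (simp add: power2_eq_square algebra_simps)
      finally have "[(2 * int b + 1)\<^sup>2 = - int p] (mod int q)" by (simp only: cong_iff_dvd_diff)
      then show "QuadRes (int q) (- int p)" unfolding QuadRes_def by blast
    next
      assume "QuadRes (int q) (- int p)"
      then obtain y where y: "[y\<^sup>2 = - int p] (mod int q)" unfolding QuadRes_def by blast
      have oq: "odd q" using q(1) q2 prime_odd_nat by blast
      define y1 where "y1 = y mod int q"
      have y1: "0 \<le> y1" "[y1\<^sup>2 = - int p] (mod int q)"
        using y q2 unfolding y1_def by (auto simp: unique_euclidean_semiring_class.cong_def power_mod)
      \<comment> \<open>An odd square root can be written as \<open>2 * b + 1\<close>; adding the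
        odd number \<open>q\<close> corrects the parity.\<close>
      define y2 where "y2 = (if odd y1 then y1 else y1 + int q)"
      have y2: "odd y2" "y2 \<ge> 0" using y1 oq by (auto simp: y2_def)
      have "[y2 = y1] (mod int q)" by (simp add: y2_def unique_euclidean_semiring_class.cong_def)
      then have y2c: "[y2\<^sup>2 = - int p] (mod int q)" using y1(2) by (metis cong_pow cong_trans)
      obtain b where b: "y2 = 2 * b + 1" using y2(1) by (elim oddE)
      have b0: "b \<ge> 0" using b y2(2) by linarith
      define n where "n = nat b"
      have bn: "b = int n" using b0 by (simp add: n_def)
      have "int q dvd y2\<^sup>2 - (- int p)" using y2c by (simp only: cong_iff_dvd_diff)
      also have "y2\<^sup>2 - (- int p) = 4 * int (n\<^sup>2 + n + m)"
        using m by (simp add: b bn power2_eq_square algebra_simps)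
      finally have "int q dvd 4 * int (n\<^sup>2 + n + m)" .
      then have "int q dvd int (4 * (n\<^sup>2 + n + m))" by simp
      then have "q dvd 4 * (n\<^sup>2 + n + m)" by (simp only: of_nat_dvd_iff)
      moreover have "coprime q 4" using oq coprime_power_right_iff[of q 2 2] by (simp add: coprime_right_2_iff_odd)
      ultimately have "q dvd n\<^sup>2 + n + m" by (metis coprime_dvd_mult_right_iff)
      then show "\<exists>b. q dvd b\<^sup>2 + b + m" by blast
    qed
    also have "\<dots> \<longleftrightarrow> Legendre (int q) (int p) = 1"
      unfolding Legendre_reciprocity_3_mod_4[OF p m q(1) q2 q(2)] using nd' by (simp add: Legendre_def)
    finally show ?thesis .
  qed
  then show ?thesis using root_count_prime[OF q(1) p q(2) m] L by auto
qed

text \<open>For \<open>k \<ge> 2\<close> the \<open>g\<close> with \<open>g\<^sup>2\<close> dividing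
  \<open>q ^ k\<close> are 1 and \<open>q\<close> times those for \<open>q ^ (k - 2)\<close>. Thus
  two more factors \<open>q\<close> add \<open>root_count m (q ^ k)\<close>, which is
  \<open>\<kappa> ^ (k - 1) + \<kappa> ^ k\<close> whether \<open>q\<close> splits
  (\<open>\<kappa> = 1\<close>), is inert (\<open>\<kappa> = - 1\<close>) or ramifies
  (\<open>\<kappa> = 0\<close>).\<close>

lemma ideal_count_prime_power:
  fixes p q m :: nat
  assumes p: "prime p" and m: "p + 1 = 4 * m" and q: "prime q"
  shows "ideal_count m (q ^ k) = (\<Sum>i\<le>k. Legendre (int q) (int p) ^ i)"
proof (induction k rule: less_induct)
  case (less k)
  define \<kappa> where "\<kappa> = Legendre (int q) (int p)"
  have q1: "q > 1" using q prime_gt_1_nat by blast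
  have \<kappa>: "\<kappa> = 1 \<or> \<kappa> = - 1 \<or> \<kappa> = 0" by (simp add: \<kappa>_def Legendre_def)
  have \<kappa>p: "\<kappa> = 0" if "q = p" using that by (simp add: \<kappa>_def Legendre_def cong_0_iff)
  have rc1: "root_count m q = 1 + \<kappa>"
    using root_count_prime_Legendre[OF p m q] root_count_ramified(1)[OF p m] \<kappa>p
    by (cases "q = p") (auto simp: \<kappa>_def)
  have rc: "root_count m (q ^ Suc j) = \<kappa> ^ j + \<kappa> ^ Suc j" if "j > 0" for j
  proof (cases "q = p")
    case True
    then show ?thesis using root_count_ramified(2)[OF p m, of "Suc j"] \<kappa>p that by (simp add: zero_power)
  next
    case False
    have "root_count m (q ^ Suc j) = root_count m q" for j
    proof (induction j)
      case (Suc j)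
      have "root_count m (q ^ Suc (Suc j)) = root_count m (q ^ Suc j)"
        by (rule root_count_prime_power_Suc[OF q p False m]) simp
      then show ?case using Suc by (rule trans)
    qed simp
    moreover have "\<kappa> \<noteq> 0"
    proof
      assume "\<kappa> = 0"
      then have "p dvd q" by (simp add: \<kappa>_def Legendre_def cong_0_iff split: if_splits)
      then show False using False p q primes_dvd_imp_eq by blast
    qed
    ultimately have "\<kappa> = 1 \<or> \<kappa> = - 1" "root_count m (q ^ Suc j) = 1 + \<kappa>" using rc1 \<kappa> by metis+
    then show ?thesis by (elim disjE; cases "even j") simp_all
  qed
  have "k = 0 \<or> k = 1 \<or> (\<exists>j. k = Suc (Suc j))" by presburger
  then consider "k = 0" | "k = 1" | j where "k = Suc (Suc j)" by blast
  then show ?case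
  proof cases
    case 1
    have "{g. g\<^sup>2 dvd Suc 0} = {Suc 0}" by (auto simp: power2_eq_square)
    then show ?thesis using 1 by (simp add: ideal_count_def)
  next
    case 2
    have "{g. g\<^sup>2 dvd q} = {Suc 0}"
    proof (intro equalityI subsetI)
      fix g assume "g \<in> {g. g\<^sup>2 dvd q}"
      then have g: "g\<^sup>2 dvd q" by simp
      then have "g dvd q" by (metis dvd_mult_left power2_eq_square)
      then have "g = 1 \<or> g = q" using q prime_nat_iff by blast
      moreover have "g \<noteq> q"
      proof
        assume "g = q"
        then have "q\<^sup>2 \<le> q" using g q1 by (intro dvd_imp_le) auto
        then show False using q1 by (simp add: power2_eq_square)
      qed
      ultimately show "g \<in> {Suc 0}" by simp
    qed simp
    then show ?thesis using 2 rc1 by (simp add: ideal_count_def \<kappa>_def)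
  next
    case (3 j)
    have fin: "finite {g. g\<^sup>2 dvd q ^ j}"
    proof (rule finite_subset)
      show "{g. g\<^sup>2 dvd q ^ j} \<subseteq> {..q ^ j}"
      proof
        fix g assume "g \<in> {g. g\<^sup>2 dvd q ^ j}"
        then have "g\<^sup>2 \<le> q ^ j" using q1 by (auto intro: dvd_imp_le)
        moreover have "g \<le> g\<^sup>2" by (simp add: power2_eq_square)
        ultimately show "g \<in> {..q ^ j}" by simp
      qed
    qed simp
    have split: "{g. g\<^sup>2 dvd q ^ k} = insert 1 ((*) q ` {g. g\<^sup>2 dvd q ^ j})"
    proof (intro equalityI subsetI)
      fix g assume "g \<in> {g. g\<^sup>2 dvd q ^ k}"
      then have g: "g\<^sup>2 dvd q ^ k" by simp
      then have "g dvd q ^ k" by (metis dvd_mult_left power2_eq_square)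
      then obtain i where i: "g = q ^ i" using divides_primepow_nat[OF q] by blast
      show "g \<in> insert 1 ((*) q ` {g. g\<^sup>2 dvd q ^ j})"
      proof (cases i)
        case (Suc i')
        have "(q ^ i)\<^sup>2 = q\<^sup>2 * (q ^ i')\<^sup>2" "q ^ k = q\<^sup>2 * q ^ j"
          unfolding Suc 3 by (simp_all add: power_mult_distrib power2_eq_square)
        then have "q\<^sup>2 * (q ^ i')\<^sup>2 dvd q\<^sup>2 * q ^ j" using g unfolding i by metis
        moreover have "0 < q\<^sup>2" using q1 by simp
        ultimately have "(q ^ i')\<^sup>2 dvd q ^ j" by (simp only: nat_mult_dvd_cancel1)
        then show ?thesis by (auto simp: i Suc)
      qed (simp add: i)
    next
      fix g assume "g \<in> insert 1 ((*) q ` {g. g\<^sup>2 dvd q ^ j})"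
      then consider "g = 1" | h where "g = q * h" "h\<^sup>2 dvd q ^ j" by auto
      then show "g \<in> {g. g\<^sup>2 dvd q ^ k}"
      proof cases
        case (2 h)
        have "q\<^sup>2 * h\<^sup>2 dvd q\<^sup>2 * q ^ j" using 2(2) by (rule mult_dvd_mono[OF dvd_refl])
        moreover have "(q * h)\<^sup>2 = q\<^sup>2 * h\<^sup>2" "q ^ k = q\<^sup>2 * q ^ j"
          unfolding 3 by (simp_all add: power_mult_distrib power2_eq_square)
        ultimately show ?thesis unfolding 2(1) by simp
      qed simp
    qed
    have "ideal_count m (q ^ k) = root_count m (q ^ k) + (\<Sum>g\<in>(*) q ` {g. g\<^sup>2 dvd q ^ j}. root_count m (q ^ k div g\<^sup>2))"
    proof -
      have "1 \<notin> (*) q ` {g. g\<^sup>2 dvd q ^ j}"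
      proof
        assume "1 \<in> (*) q ` {g. g\<^sup>2 dvd q ^ j}"
        then obtain h where "1 = q * h" by (rule imageE)
        then have "q dvd 1" by (rule dvdI)
        then show False using q1 by (metis nat_dvd_1_iff_1 less_irrefl)
      qed
      from sum.insert[OF finite_imageI[OF fin] this, of "\<lambda>g. root_count m (q ^ k div g\<^sup>2)"]
      show ?thesis unfolding ideal_count_def split by (simp only: power_one div_by_1)
    qed
    also have "(\<Sum>g\<in>(*) q ` {g. g\<^sup>2 dvd q ^ j}. root_count m (q ^ k div g\<^sup>2)) =
        (\<Sum>g | g\<^sup>2 dvd q ^ j. root_count m (q ^ k div (q * g)\<^sup>2))"
    proof -
      have "inj_on ((*) q) {g. g\<^sup>2 dvd q ^ j}" using q1 by (simp add: inj_on_def)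
      then show ?thesis by (simp only: sum.reindex o_def)
    qed
    also have "\<dots> = ideal_count m (q ^ j)"
      unfolding ideal_count_def
    proof (intro sum.cong refl)
      fix g
      have "(q * g)\<^sup>2 = q\<^sup>2 * g\<^sup>2" "q ^ k = q\<^sup>2 * q ^ j"
        unfolding 3 by (simp_all add: power_mult_distrib power2_eq_square)
      then have "q ^ k div (q * g)\<^sup>2 = (q\<^sup>2 * q ^ j) div (q\<^sup>2 * g\<^sup>2)" by metis
      also have "\<dots> = q ^ j div g\<^sup>2" using q1 by simp
      finally show "root_count m (q ^ k div (q * g)\<^sup>2) = root_count m (q ^ j div g\<^sup>2)" by simp
    qed
    also have "\<dots> = (\<Sum>i\<le>j. \<kappa> ^ i)" using less.IH[of j] 3 by (simp add: \<kappa>_def)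
    finally have "ideal_count m (q ^ k) = root_count m (q ^ k) + (\<Sum>i\<le>j. \<kappa> ^ i)" .
    moreover have "root_count m (q ^ k) = \<kappa> ^ Suc j + \<kappa> ^ Suc (Suc j)" unfolding 3 by (rule rc) simp
    ultimately show ?thesis unfolding \<kappa>_def[symmetric] 3 by simp
  qed
qed

theorem ideal_count_eq_divisor_sum:
  fixes p m n :: nat
  assumes p: "prime p" and m: "p + 1 = 4 * m" and n: "n > 0"
  shows "ideal_count m n = (\<Sum>d | d dvd n. Legendre (int d) (int p))"
proof -
  have p2: "2 < p" using m prime_gt_1_nat[OF p] by presburger
  have L1: "Legendre 1 (int p) = 1"
    using p2 Legendre_mult[OF p p2, of 1 1] by (auto simp: Legendre_def cong_0_iff QuadRes_def intro!: exI[of _ 1])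
  have Lpow: "Legendre (int (q ^ i)) (int p) = Legendre (int q) (int p) ^ i" for q i
    by (induction i) (use L1 Legendre_mult[OF p p2] in auto)
  define S where "S n = (\<Sum>d | d dvd n. Legendre (int d) (int p))" for n
  have Smult: "S (a * b) = S a * S b" if "a > 0" "b > 0" "coprime a b" for a b
    using sum_power_divisors_mult[OF that(3), of 1 "\<lambda>d. Legendre (int d) (int p)" "\<lambda>d. Legendre (int d) (int p)" "\<lambda>d. Legendre (int d) (int p)"]
      Legendre_mult[OF p p2] by (simp add: S_def)
  have Spp: "S (q ^ k) = (\<Sum>i\<le>k. Legendre (int q) (int p) ^ i)" if q: "prime q" for q k
  proof -
    have "{d. d dvd q ^ k} = (\<lambda>i. q ^ i) ` {..k}"
      using divides_primepow_nat[OF q] by (auto simp: le_imp_power_dvd)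
    moreover have "inj_on (\<lambda>i. q ^ i) {..k}" using prime_gt_1_nat[OF q] by (auto simp: inj_on_def)
    ultimately show ?thesis unfolding S_def by (simp only: sum.reindex o_def Lpow)
  qed
  have "ideal_count m n = S n"
  proof (rule multiplicative_eqI[OF _ _ _ _ n])
    show "ideal_count m 1 = S 1" using ideal_count_prime_power[OF p m two_is_prime_nat, of 0] Spp[OF two_is_prime_nat, of 0] by simp
    show "ideal_count m (q ^ k) = S (q ^ k)" if "prime q" for q k
      unfolding ideal_count_prime_power[OF p m that] Spp[OF that] ..
    show "ideal_count m (a * b) = ideal_count m a * ideal_count m b" if "a > 0" "b > 0" "coprime a b" for a b
      by (rule ideal_count_mult[OF that(3,1,2)])
  qed (rule Smult)
  then show ?thesis by (simp add: S_def)
qed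

section \<open>The ring of integers\<close>

abbreviation subring_record :: "complex set \<Rightarrow> complex ring" where
  "subring_record S \<equiv> \<lparr>carrier = S, monoid.mult = (*), one = 1, zero = 0, add = (+)\<rparr>"

lemma ring_subring_record:
  assumes "0 \<in> S" "1 \<in> S" "\<And>x y. x \<in> S \<Longrightarrow> y \<in> S \<Longrightarrow> x + y \<in> S"
    "\<And>x y. x \<in> S \<Longrightarrow> y \<in> S \<Longrightarrow> x * y \<in> S" "\<And>x. x \<in> S \<Longrightarrow> - x \<in> S"
  shows "ring (subring_record S)"
proof (rule ringI)
  show "abelian_group (subring_record S)"
    by (rule abelian_groupI) (use assms in \<open>auto simp: algebra_simps intro!: bexI[of _ "- _"]\<close>)
  show "monoid (subring_record S)"
    by (rule monoidI) (use assms in \<open>auto simp: algebra_simps\<close>)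
qed (auto simp: algebra_simps)

lemma ideal_subring_record_iff:
  assumes S: "0 \<in> S" "1 \<in> S" "\<And>x y. x \<in> S \<Longrightarrow> y \<in> S \<Longrightarrow> x + y \<in> S"
    "\<And>x y. x \<in> S \<Longrightarrow> y \<in> S \<Longrightarrow> x * y \<in> S" "\<And>x. x \<in> S \<Longrightarrow> - x \<in> S"
  shows "ideal I (subring_record S) \<longleftrightarrow>
    I \<subseteq> S \<and> 0 \<in> I \<and> (\<forall>x\<in>I. \<forall>y\<in>I. x + y \<in> I) \<and> (\<forall>r\<in>S. \<forall>x\<in>I. r * x \<in> I)"
proof
  assume "ideal I (subring_record S)"
  then interpret ideal I "subring_record S" .
  show "I \<subseteq> S \<and> 0 \<in> I \<and> (\<forall>x\<in>I. \<forall>y\<in>I. x + y \<in> I) \<and> (\<forall>r\<in>S. \<forall>x\<in>I. r * x \<in> I)"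
    using a_subset additive_subgroup.zero_closed[OF is_additive_subgroup]
      additive_subgroup.a_closed[OF is_additive_subgroup] I_l_closed by auto
next
  assume I: "I \<subseteq> S \<and> 0 \<in> I \<and> (\<forall>x\<in>I. \<forall>y\<in>I. x + y \<in> I) \<and> (\<forall>r\<in>S. \<forall>x\<in>I. r * x \<in> I)"
  interpret ring "subring_record S" by (rule ring_subring_record) (use S in auto)
  have neg: "- x \<in> I" if "x \<in> I" for x
    using I S(2,5) that by (metis mult_minus1)
  show "ideal I (subring_record S)"
  proof (rule idealI[OF ring_axioms])
    show "subgroup I (add_monoid (subring_record S))"
    proof (rule group.subgroupI)
      show "Group.group (add_monoid (subring_record S))" by (rule add.is_group)
      fix a assume a: "a \<in> I"
      have "inv\<^bsub>add_monoid (subring_record S)\<^esub> a = - a"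
        by (rule group.inv_equality[OF add.is_group]) (use a I S(5) in auto)
      then show "inv\<^bsub>add_monoid (subring_record S)\<^esub> a \<in> I" using neg[OF a] by simp
    qed (use I in auto)
    fix a x assume "a \<in> I" "x \<in> carrier (subring_record S)"
    then have "x * a \<in> I" using I by simp
    then show "x \<otimes>\<^bsub>subring_record S\<^esub> a \<in> I" "a \<otimes>\<^bsub>subring_record S\<^esub> x \<in> I"
      by (simp_all add: mult.commute)
  qed
qed

text \<open>If \<open>q\<close> is the reduced denominator of \<open>x\<close>, every power of
  \<open>q\<close> divides \<open>D\<close>, which forces \<open>q = 1\<close>.\<close>

lemma bounded_denominator_imp_Ints:
  fixes x :: complex and D :: int
  assumes x: "x \<in> \<rat>" and D: "D > 0" and b: "\<And>k. of_int D * x ^ k \<in> \<int>"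
  shows "x \<in> \<int>"
proof -
  obtain r q where rq: "q > 0" "coprime r q" "x = of_int r / of_int q" using Rats_cases'[OF x] by metis
  have dv: "q ^ k dvd D" for k
  proof -
    obtain j where j: "of_int D * x ^ k = of_int j" using b[of k] by (auto elim: Ints_cases)
    have "of_int D * of_int r ^ k = (of_int j * of_int q ^ k :: complex)"
      using j rq(1) by (simp add: rq(3) power_divide divide_eq_eq)
    then have "(of_int (D * r ^ k) :: complex) = of_int (j * q ^ k)" by simp
    then have "D * r ^ k = j * q ^ k" by (simp only: of_int_eq_iff)
    then have "q ^ k dvd D * r ^ k" by simp
    moreover have "coprime (q ^ k) (r ^ k)" using rq(2) by (simp add: coprime_commute)
    ultimately show ?thesis by (simp add: coprime_dvd_mult_left_iff)
  qed
  have "q = 1"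
  proof (rule ccontr)
    assume "q \<noteq> 1"
    then have q2: "q \<ge> 2" using rq(1) by simp
    have "D < 2 ^ nat D" using D less_exp[of "nat D"] by (metis nat_less_iff of_nat_less_iff of_nat_numeral of_nat_power zero_less_imp_eq_int nat_int)
    also have "\<dots> \<le> q ^ nat D" using q2 by (intro power_mono) auto
    also have "\<dots> \<le> D" using dv D by (intro zdvd_imp_le)
    finally show False by simp
  qed
  then show ?thesis using rq(3) by simp
qed

text \<open>A monic integral equation of degree \<open>n\<close> reduces every power of
  \<open>u\<close> to the first \<open>n\<close> of them, and \<open>d ^ n\<close> clears the
  denominators of those.\<close>

lemma power_in_module_of_algebraic_int:
  fixes u :: complex
  assumes u: "algebraic_int u" and d: "of_int d * u \<in> L" "d > 0"
    and L: "\<And>x y. x \<in> L \<Longrightarrow> y \<in> L \<Longrightarrow> x + y \<in> L" "\<And>x y. x \<in> L \<Longrightarrow> y \<in> L \<Longrightarrow> x * y \<in> L" "\<And>n. of_int n \<in> L"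
  shows "\<exists>D>0. \<forall>k. of_int D * u ^ k \<in> L"
proof -
  obtain p where p: "lead_coeff p = 1" "\<forall>i. coeff p i \<in> \<int>" "poly p u = 0" using u by (auto elim: algebraic_int.cases)
  define n where "n = degree p"
  have Lsum: "(\<Sum>i\<in>A. f i) \<in> L" if "finite A" "\<And>i. i \<in> A \<Longrightarrow> f i \<in> L" for A and f :: "nat \<Rightarrow> complex"
    using that by (induction A rule: finite_induct) (use L(1) L(3)[of 0] in auto)
  have Lpow: "x ^ k \<in> L" if "x \<in> L" for x k
    using that by (induction k) (use L(2) L(3)[of 1] in auto)
  have eq: "u ^ n = - (\<Sum>i<n. coeff p i * u ^ i)"
  proof -
    have "0 = (\<Sum>i\<le>n. coeff p i * u ^ i)" using p(3) by (simp add: poly_altdef n_def)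
    also have "\<dots> = (\<Sum>i<n. coeff p i * u ^ i) + u ^ n"
      using p(1) by (simp add: n_def lessThan_Suc_atMost[symmetric])
    finally show ?thesis by (simp add: add_eq_0_iff2)
  qed
  have "of_int (d ^ n) * u ^ k \<in> L" for k
  proof (induction k rule: less_induct)
    case (less k)
    show ?case
    proof (cases "k < n")
      case True
      have "of_int (d ^ n) * u ^ k = of_int (d ^ (n - k)) * (of_int d * u) ^ k"
        using True by (simp add: power_mult_distrib flip: power_add mult.assoc)
      then show ?thesis using L(2)[OF L(3) Lpow[OF d(1)]] by metis
    next
      case False
      have "u ^ k = u ^ (k - n) * u ^ n" using False by (simp flip: power_add)
      also have "\<dots> = (\<Sum>i<n. (- coeff p i) * u ^ (k - n + i))"
        unfolding eq by (simp add: sum_distrib_left sum_negf power_add mult_ac)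
      finally have "of_int (d ^ n) * u ^ k = (\<Sum>i<n. (- coeff p i) * (of_int (d ^ n) * u ^ (k - n + i)))"
        by (simp add: sum_distrib_left mult_ac)
      also have "\<dots> \<in> L"
      proof (rule Lsum)
        fix i assume i: "i \<in> {..<n}"
        obtain c where "coeff p i = of_int c" using p(2) by (metis Ints_cases)
        then have "- coeff p i \<in> L" using L(3)[of "- c"] by simp
        moreover have "of_int (d ^ n) * u ^ (k - n + i) \<in> L" using i False by (intro less) auto
        ultimately show "(- coeff p i) * (of_int (d ^ n) * u ^ (k - n + i)) \<in> L" by (rule L(2))
      qed simp
      finally show ?thesis .
    qed
  qed
  moreover have "d ^ n > 0" using d(2) by simp
  ultimately show ?thesis by blast
qed

text \<open>\<open>m\<close> is the norm of \<open>om = (1 + rt) / 2\<close>. The assumption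
  \<open>m > 1\<close> says \<open>p > 3\<close>, so that the only units are \<open>1\<close> and
  \<open>- 1\<close>.\<close>

locale imaginary_quadratic =
  fixes p m :: nat
  assumes prime_p: "prime p" and p_eq: "p + 1 = 4 * m" and m_gt: "m > 1"
begin

definition rt :: complex where "rt = csqrt (of_int (- int p))"
definition om :: complex where "om = (1 + rt) / 2"
definition el :: "int \<Rightarrow> int \<Rightarrow> complex" where "el x y = of_int x + of_int y * om"
definition OK :: "complex set" where "OK = {el x y | x y. True}"

lemma rt_eq: "rt = \<i> * of_real (sqrt (real p))"
  unfolding rt_def by (subst csqrt_of_real_nonpos) auto

lemma p_pos: "p > 0" using prime_p prime_gt_0_nat by blast

lemma rt_sq: "rt\<^sup>2 = - of_nat p"
  unfolding rt_def by (simp only: power2_csqrt) simp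

lemma cnj_rt [simp]: "cnj rt = - rt" by (simp add: rt_eq)

lemma of_nat_p: "(of_nat p :: 'a :: comm_ring_1) = 4 * of_nat m - 1"
proof -
  have "of_nat (p + 1) = (of_nat (4 * m) :: 'a)" using p_eq by simp
  then show ?thesis by (simp add: algebra_simps)
qed

lemma om_sq: "om * om = om - of_nat m"
proof -
  have "4 * (om * om) = 1 + 2 * rt + rt\<^sup>2" by (simp add: om_def power2_eq_square algebra_simps)
  also have "\<dots> = 4 * (om - of_nat m)" unfolding rt_sq of_nat_p by (simp add: om_def)
  finally show ?thesis by (simp only: mult_cancel_left) simp
qed

lemma cnj_om: "cnj om = 1 - om" by (simp add: om_def field_simps)

lemma Im_om: "Im om > 0" using p_pos by (simp add: om_def rt_eq)

lemma el_inj: "el x y = el x' y' \<longleftrightarrow> x = x' \<and> y = y'"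
proof
  assume e: "el x y = el x' y'"
  then have "Im (el x y) = Im (el x' y')" by simp
  then have "y = y'" using Im_om by (simp add: el_def)
  then show "x = x' \<and> y = y'" using e by (simp add: el_def)
qed simp

lemma el_add: "el x y + el x' y' = el (x + x') (y + y')" by (simp add: el_def algebra_simps)
lemma el_minus: "- el x y = el (- x) (- y)" by (simp add: el_def)
lemma el_of_int: "of_int n = el n 0" by (simp add: el_def)
lemma el_scale: "of_int n * el x y = el (n * x) (n * y)" by (simp add: el_def algebra_simps)

lemma el_mult: "el x y * el x' y' = el (x * x' - int m * (y * y')) (x * y' + y * x' + y * y')"
proof -
  have "el x y * el x' y' = of_int (x * x') + of_int (x * y' + y * x') * om + of_int (y * y') * (om * om)"
    by (simp add: el_def algebra_simps)
  then show ?thesis unfolding om_sq by (simp add: el_def algebra_simps)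
qed

lemma cnj_el: "cnj (el x y) = el (x + y) (- y)"
  by (simp add: el_def cnj_om algebra_simps)

definition nf :: "int \<Rightarrow> int \<Rightarrow> int" where "nf x y = x\<^sup>2 + x * y + int m * y\<^sup>2"

lemma el_mult_cnj: "el x y * cnj (el x y) = of_int (nf x y)"
  unfolding cnj_el el_mult el_of_int nf_def by (simp add: el_inj power2_eq_square algebra_simps)

lemma cmod_el_sq: "(cmod (el x y))\<^sup>2 = of_int (nf x y)"
proof -
  have "complex_of_real ((cmod (el x y))\<^sup>2) = of_real (of_int (nf x y))"
    using complex_norm_square[of "el x y"] el_mult_cnj[of x y] by simp
  then show ?thesis by (simp only: of_real_eq_iff)
qed

lemma el_OK: "el x y \<in> OK" by (auto simp: OK_def)

lemma OK_closed: "0 \<in> OK" "1 \<in> OK" "x \<in> OK \<Longrightarrow> y \<in> OK \<Longrightarrow> x + y \<in> OK"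
    "x \<in> OK \<Longrightarrow> y \<in> OK \<Longrightarrow> x * y \<in> OK" "x \<in> OK \<Longrightarrow> - x \<in> OK"
proof -
  show "0 \<in> OK" "1 \<in> OK" using el_OK[of 0 0] el_OK[of 1 0] el_of_int[of 0] el_of_int[of 1] by auto
  show "x + y \<in> OK" if "x \<in> OK" "y \<in> OK"
    using that el_add el_OK unfolding OK_def by (elim CollectE exE conjE) simp
  show "x * y \<in> OK" if "x \<in> OK" "y \<in> OK"
    using that el_mult el_OK unfolding OK_def by (elim CollectE exE conjE) simp
  show "- x \<in> OK" if "x \<in> OK"
    using that el_minus el_OK unfolding OK_def by (elim CollectE exE conjE) simp
qed

lemma algebraic_int_el: "algebraic_int (el x y)"
proof (rule algebraic_int.intros)
  define P :: "complex poly" where "P = [:of_int (nf x y), of_int (- (2 * x + y)), 1:]"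
  show "lead_coeff P = 1" by (simp add: P_def)
  show "\<forall>i. coeff P i \<in> \<int>" by (auto simp: P_def coeff_pCons split: nat.splits)
  have "el x y + cnj (el x y) = of_int (2 * x + y)" unfolding cnj_el el_add el_of_int by (simp add: el_inj)
  then have "poly P (el x y) = el x y * cnj (el x y) - el x y * (el x y + cnj (el x y)) + el x y * el x y"
    unfolding el_mult_cnj by (simp add: P_def algebra_simps)
  then show "poly P (el x y) = 0" by (simp add: algebra_simps)
qed

lemma el_in_field: "el x y \<in> quadratic_field (- int p)"
proof -
  have "el x y = (of_int (2 * x + y) / of_int 2) + (of_int y / of_int 2) * rt"
    by (simp add: el_def om_def field_simps)
  then have "el x y = (of_int (2 * x + y) / of_int 2) + (of_int y / of_int 2) * csqrt (of_int (- int p))"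
    unfolding rt_def .
  moreover have "(of_int (2 * x + y) / of_int 2 :: complex) \<in> \<rat>" "(of_int y / of_int 2 :: complex) \<in> \<rat>"
    by (intro Rats_divide Rats_of_int)+
  ultimately show ?thesis unfolding quadratic_field_def by blast
qed

text \<open>For \<open>u = a + b * rt\<close> the trace \<open>2 * a\<close> and the norm
  \<open>a\<^sup>2 + p * b\<^sup>2\<close> are rational with bounded denominators of all powers,
  because this holds for \<open>u\<close> and \<open>cnj u\<close>; hence they are integers. As
  \<open>p\<close> is squarefree, \<open>2 * b\<close> is an integer too, and \<open>p\<close> being
  3 modulo 4 makes \<open>2 * a\<close> and \<open>2 * b\<close> congruent modulo 2.\<close>

lemma algebraic_int_in_OK:
  assumes K: "u \<in> quadratic_field (- int p)" and u: "algebraic_int u"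
  shows "u \<in> OK"
proof -
  obtain a b where ab: "u = a + b * rt" "a \<in> \<rat>" "b \<in> \<rat>" using K by (auto simp: quadratic_field_def rt_def)
  obtain r q where rq: "q > 0" "a = of_int r / of_int q" using Rats_cases'[OF ab(2)] by metis
  obtain r' q' where rq': "q' > 0" "b = of_int r' / of_int q'" using Rats_cases'[OF ab(3)] by metis
  \<comment> \<open>The order spanned by 1 and \<open>rt\<close>. It is closed under conjugation and
    its real elements are integers, which converts membership in \<open>L\<close> into
    integrality.\<close>
  define L where "L = {of_int x + of_int y * rt | x y. True}"
  have L1: "x + y \<in> L" if "x \<in> L" "y \<in> L" for x y
  proof -
    obtain a b c d where "x = of_int a + of_int b * rt" "y = of_int c + of_int d * rt" using \<open>x \<in> L\<close> \<open>y \<in> L\<close> by (auto simp: L_def)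
    then have "x + y = of_int (a + c) + of_int (b + d) * rt" by (simp add: algebra_simps)
    then show ?thesis unfolding L_def by blast
  qed
  have L2: "x * y \<in> L" if "x \<in> L" "y \<in> L" for x y
  proof -
    obtain a b c d where xy: "x = of_int a + of_int b * rt" "y = of_int c + of_int d * rt" using \<open>x \<in> L\<close> \<open>y \<in> L\<close> by (auto simp: L_def)
    have "x * y = of_int (a * c) + of_int (a * d + b * c) * rt + of_int (b * d) * rt\<^sup>2"
      unfolding xy by (simp add: algebra_simps power2_eq_square)
    then have "x * y = of_int (a * c - b * d * int p) + of_int (a * d + b * c) * rt"
      unfolding rt_sq by (simp add: algebra_simps)
    then show ?thesis unfolding L_def by blast
  qed
  have L3: "of_int n \<in> L" for n
  proof -
    have "of_int n = of_int n + of_int 0 * rt" by simp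
    then show ?thesis unfolding L_def by blast
  qed
  have Lc: "cnj x \<in> L" if "x \<in> L" for x
  proof -
    obtain a b where "x = of_int a + of_int b * rt" using \<open>x \<in> L\<close> by (auto simp: L_def)
    then have "cnj x = of_int a + of_int (- b) * rt" by simp
    then show ?thesis unfolding L_def by blast
  qed
  have Lreal: "x \<in> \<int>" if x: "x \<in> L" "Im x = 0" for x
  proof -
    obtain a b where ab: "x = of_int a + of_int b * rt" using x by (auto simp: L_def)
    then have "of_int b * sqrt (real p) = 0" using x(2) by (simp add: rt_eq)
    then have "b = 0" using p_pos by simp
    then show ?thesis using ab by simp
  qed
  have Lsum: "(\<Sum>i\<in>A. f i) \<in> L" if "finite A" "\<And>i. i \<in> A \<Longrightarrow> f i \<in> L" for A and f :: "nat \<Rightarrow> complex"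
    using that by (induction A rule: finite_induct) (use L1 L3[of 0] in auto)
  have "of_int (q * q') * u = of_int (r * q') + of_int (r' * q) * rt"
    using rq(1) rq'(1) unfolding ab(1) rq(2) rq'(2) by (simp add: field_simps)
  then have "of_int (q * q') * u \<in> L" unfolding L_def by blast
  moreover have "q * q' > 0" using rq rq' by simp
  ultimately obtain D where D: "D > 0" "\<And>k. of_int D * u ^ k \<in> L"
    using power_in_module_of_algebraic_int[OF u _ _ L1 L2 L3, of "q * q'"] by blast
  have Dc: "of_int D * cnj u ^ k \<in> L" for k
    using Lc[OF D(2)[of k]] by simp
  have ca: "cnj a = a" and cb: "cnj b = b" using rq(2) rq'(2) by simp_all
  have T: "u + cnj u = 2 * a" and N: "u * cnj u = a\<^sup>2 + of_nat p * b\<^sup>2"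
  proof -
    show "u + cnj u = 2 * a" by (simp add: ab(1) ca cb)
    have "u * cnj u = a\<^sup>2 - b\<^sup>2 * rt\<^sup>2" by (simp add: ab(1) ca cb algebra_simps power2_eq_square)
    then show "u * cnj u = a\<^sup>2 + of_nat p * b\<^sup>2" by (simp add: rt_sq)
  qed
  have powreal: "Im (of_int D * of_int D * w ^ k) = 0" if "cnj w = w" for w k
  proof -
    have "cnj (of_int D * of_int D * w ^ k) = of_int D * of_int D * w ^ k" using that by simp
    then have "Im (cnj (of_int D * of_int D * w ^ k)) = Im (of_int D * of_int D * w ^ k)" by (rule arg_cong)
    then show ?thesis unfolding cnj.simps by simp
  qed
  have "2 * a \<in> \<int>"
  proof (rule bounded_denominator_imp_Ints[of _ "D * D"])
    show "2 * a \<in> \<rat>" using ab(2) by (intro Rats_mult) auto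
    show "D * D > 0" using D(1) by simp
    fix k
    have "of_int D * of_int D * (2 * a) ^ k = (\<Sum>i\<le>k. of_int (int (k choose i)) * ((of_int D * u ^ i) * (of_int D * cnj u ^ (k - i))))"
      unfolding T[symmetric] binomial_ring by (simp add: sum_distrib_left mult_ac)
    also have "\<dots> \<in> L" by (intro Lsum L2[OF L3 L2[OF D(2) Dc]]) auto
    finally have "of_int D * of_int D * (2 * a) ^ k \<in> L" .
    then show "of_int (D * D) * (2 * a) ^ k \<in> \<int>" using Lreal[OF _ powreal[of "2 * a" k]] ca by simp
  qed
  then obtain x where x: "2 * a = of_int x" by (auto elim: Ints_cases)
  have "a\<^sup>2 + of_nat p * b\<^sup>2 \<in> \<int>"
  proof (rule bounded_denominator_imp_Ints[of _ "D * D"])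
    show "a\<^sup>2 + of_nat p * b\<^sup>2 \<in> \<rat>" using ab(2,3) by (intro Rats_add Rats_mult Rats_power Rats_of_nat) auto
    show "D * D > 0" using D(1) by simp
    fix k
    have "of_int D * of_int D * (a\<^sup>2 + of_nat p * b\<^sup>2) ^ k = (of_int D * u ^ k) * (of_int D * cnj u ^ k)"
      unfolding N[symmetric] by (simp add: power_mult_distrib mult_ac)
    also have "\<dots> \<in> L" by (rule L2[OF D(2) Dc])
    finally show "of_int (D * D) * (a\<^sup>2 + of_nat p * b\<^sup>2) ^ k \<in> \<int>"
      using Lreal[OF _ powreal[of "a\<^sup>2 + of_nat p * b\<^sup>2" k]] ca cb by simp
  qed
  then obtain n where n: "a\<^sup>2 + of_nat p * b\<^sup>2 = of_int n" by (auto elim: Ints_cases)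
  have pb: "of_nat p * (2 * b)\<^sup>2 = (of_int (4 * n - x\<^sup>2) :: complex)"
  proof -
    have "of_nat p * (2 * b)\<^sup>2 = 4 * (a\<^sup>2 + of_nat p * b\<^sup>2) - (2 * a)\<^sup>2" by (simp add: algebra_simps power2_eq_square)
    then show ?thesis unfolding n x by simp
  qed
  obtain r s where rs: "s > 0" "coprime r s" "2 * b = of_int r / of_int s"
    using Rats_cases'[of "2 * b"] ab(3) by (metis Rats_mult Rats_number_of)
  have "of_nat p * of_int r ^ 2 = (of_int (4 * n - x\<^sup>2) * of_int s ^ 2 :: complex)"
    using pb rs(1) unfolding rs(3) by (simp add: power_divide field_simps)
  then have "(of_int (int p * r\<^sup>2) :: complex) = of_int ((4 * n - x\<^sup>2) * s\<^sup>2)" by simp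
  then have "int p * r\<^sup>2 = (4 * n - x\<^sup>2) * s\<^sup>2" by (simp only: of_int_eq_iff)
  then have "s\<^sup>2 dvd int p * r\<^sup>2" by simp
  moreover have "coprime (s\<^sup>2) (r\<^sup>2)" using rs(2) by (simp add: coprime_commute)
  ultimately have sp: "s\<^sup>2 dvd int p" by (simp add: coprime_dvd_mult_left_iff)
  have "s = 1"
  proof (rule ccontr)
    assume s1: "s \<noteq> 1"
    have "s dvd int p" using sp by (metis dvd_mult_left power2_eq_square)
    moreover have "prime (int p)" using prime_p by simp
    ultimately have "s = int p" using s1 rs(1) by (metis prime_int_iff less_imp_le)
    then have "int p * int p \<le> int p" using sp p_pos by (auto simp: power2_eq_square intro!: zdvd_imp_le)
    then show False using p_eq m_gt by (simp add: mult_le_cancel_left1)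
  qed
  then have b: "2 * b = of_int r" using rs(3) by simp
  have "(of_int (x\<^sup>2 + int p * r\<^sup>2) :: complex) = of_int (4 * n)"
    using pb unfolding b by (simp add: algebra_simps)
  then have eq: "x\<^sup>2 + int p * r\<^sup>2 = 4 * n" by (simp only: of_int_eq_iff)
  have "int p * r\<^sup>2 = 4 * (int m * r\<^sup>2) - r\<^sup>2" by (simp add: of_nat_p algebra_simps)
  then have "x\<^sup>2 - r\<^sup>2 = 4 * (n - int m * r\<^sup>2)" using eq by simp
  then have "even (x\<^sup>2 - r\<^sup>2)" by simp
  then have "2 dvd x - r" by simp
  then obtain j where "x - r = 2 * j" by (rule dvdE)
  then have j: "x = r + 2 * j" by simp
  have "2 * u = of_int x + of_int r * rt" unfolding ab(1) x[symmetric] b[symmetric] by (simp add: algebra_simps)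
  also have "\<dots> = 2 * el j r" by (simp add: el_def om_def j field_simps)
  finally have "u = el j r" by simp
  then show ?thesis by (simp add: el_OK)
qed

lemma ring_of_integers_eq: "ring_of_integers (quadratic_field (- int p)) = subring_record OK"
proof -
  have "{x \<in> quadratic_field (- int p). algebraic_int x} = OK"
    using algebraic_int_in_OK el_in_field algebraic_int_el by (auto simp: OK_def)
  then show ?thesis by (simp add: ring_of_integers_def)
qed

end

section \<open>Ideals of the ring of integers\<close>

lemma int_subgroup_principal:
  fixes A :: "int set"
  assumes 0: "0 \<in> A" and add: "\<And>x y. x \<in> A \<Longrightarrow> y \<in> A \<Longrightarrow> x + y \<in> A" and minus: "\<And>x. x \<in> A \<Longrightarrow> - x \<in> A"
    and nz: "\<exists>x\<in>A. x \<noteq> 0"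
  obtains d where "d > 0" "\<And>x. x \<in> A \<longleftrightarrow> d dvd x"
proof -
  define P where "P n \<longleftrightarrow> n > 0 \<and> int n \<in> A" for n
  obtain x where x: "x \<in> A" "x \<noteq> 0" using nz by blast
  have "P (nat \<bar>x\<bar>)" using x minus[of x] by (auto simp: P_def abs_if)
  then have PL: "P (LEAST n. P n)" by (rule LeastI)
  define d where "d = int (LEAST n. P n)"
  have d: "d > 0" "d \<in> A" using PL by (auto simp: P_def d_def)
  have mult: "int k * d \<in> A" for k by (induction k) (use 0 add d(2) in \<open>auto simp: algebra_simps\<close>)
  have mult': "k * d \<in> A" for k
  proof (cases "k \<ge> 0")
    case True then show ?thesis using mult[of "nat k"] by simp
  next
    case False then show ?thesis using minus[OF mult[of "nat (- k)"]] by simp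
  qed
  have dv: "d dvd x" if "x \<in> A" for x
  proof -
    have "x + (- (x div d)) * d \<in> A" by (rule add[OF that mult'])
    then have r: "x mod d \<in> A" by (simp add: minus_div_mult_eq_mod[symmetric] algebra_simps)
    have "x mod d = 0"
    proof (rule ccontr)
      assume "x mod d \<noteq> 0"
      then have "x mod d > 0" using pos_mod_sign[OF d(1), of x] by linarith
      then have "P (nat (x mod d))" using r by (simp add: P_def)
      then have "(LEAST n. P n) \<le> nat (x mod d)" by (rule Least_le)
      then have "d \<le> x mod d" using \<open>x mod d > 0\<close> unfolding d_def by linarith
      then show False using pos_mod_bound[OF d(1), of x] by linarith
    qed
    then show ?thesis by (simp add: dvd_eq_mod_eq_0)
  qed
  have "x \<in> A" if "d dvd x" for x
    using that mult' by (auto elim!: dvdE simp: mult.commute)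
  with dv d(1) that show thesis by blast
qed

context imaginary_quadratic
begin

definition NI :: "complex set set" where "NI = nonzero_ideals (subring_record OK)"

lemma NI_iff: "I \<in> NI \<longleftrightarrow> I \<subseteq> OK \<and> 0 \<in> I \<and> (\<forall>x\<in>I. \<forall>y\<in>I. x + y \<in> I) \<and> (\<forall>r\<in>OK. \<forall>x\<in>I. r * x \<in> I) \<and> I \<noteq> {0}"
  unfolding NI_def nonzero_ideals_def using ideal_subring_record_iff[OF OK_closed] by auto

text \<open>A triple \<open>(g, a, b)\<close> encodes the ideal \<open>g (a \<int> + (b + om) \<int>)\<close>; requiring \<open>b < a\<close> makes it unique.\<close>

definition T :: "(nat \<times> nat \<times> nat) set" where
  "T = {(g, a, b). g > 0 \<and> a > 0 \<and> b < a \<and> a dvd b\<^sup>2 + b + m}"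

definition cid :: "nat \<Rightarrow> nat \<Rightarrow> nat \<Rightarrow> complex set" where
  "cid g a b = {el (int g * (int a * x + int b * y)) (int g * y) | x y. True}"

lemma el_in_cid_iff: "el X Y \<in> cid g a b \<longleftrightarrow> (\<exists>x y. X = int g * (int a * x + int b * y) \<and> Y = int g * y)"
  by (auto simp: cid_def el_inj)

lemma T_obtain_c:
  assumes "(g, a, b) \<in> T"
  obtains c :: nat where "b\<^sup>2 + b + m = a * c" "int b * int b + int b + int m = int a * int c" "c > 0" "a > 0" "g > 0" "b < a"
proof -
  from assms obtain c where c: "b\<^sup>2 + b + m = a * c" and o: "a > 0" "g > 0" "b < a" by (auto simp: T_def elim!: dvdE)
  have "int (b\<^sup>2 + b + m) = int (a * c)" using c by (rule arg_cong)
  then have "int b * int b + int b + int m = int a * int c" by (simp add: power2_eq_square)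
  moreover have "c > 0" using c m_gt by (cases c) auto
  ultimately show thesis using that c o by blast
qed

lemma nf_pos: "nf x y \<ge> 0" "nf x y = 0 \<longleftrightarrow> x = 0 \<and> y = 0"
proof -
  have 4: "4 * nf x y = (2 * x + y)\<^sup>2 + int p * y\<^sup>2"
    by (simp add: nf_def of_nat_p power2_eq_square algebra_simps)
  have "0 \<le> int p * y\<^sup>2" "0 \<le> (2 * x + y)\<^sup>2" by simp_all
  then show "nf x y \<ge> 0" using 4 by linarith
  show "nf x y = 0 \<longleftrightarrow> x = 0 \<and> y = 0"
  proof
    assume "nf x y = 0"
    then have "(2 * x + y)\<^sup>2 + int p * y\<^sup>2 = 0" using 4 by simp
    then have "(2 * x + y)\<^sup>2 = 0" "int p * y\<^sup>2 = 0" using \<open>0 \<le> int p * y\<^sup>2\<close> \<open>0 \<le> (2 * x + y)\<^sup>2\<close> by linarith+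
    then have "2 * x + y = 0" "y = 0" using p_pos by simp_all
    then show "x = 0 \<and> y = 0" by simp
  qed (simp add: nf_def)
qed

lemma cid_NI:
  assumes T: "(g, a, b) \<in> T"
  shows "cid g a b \<in> NI"
proof -
  obtain c where c: "int b * int b + int b + int m = int a * int c" and o: "a > 0" "g > 0" using T_obtain_c[OF T] by metis
  have mul: "r * z \<in> cid g a b" if r: "r \<in> OK" and z: "z \<in> cid g a b" for r z
  proof -
    obtain u v where r: "r = el u v" using r by (auto simp: OK_def)
    obtain x y where z: "z = el (int g * (int a * x + int b * y)) (int g * y)" using z by (auto simp: cid_def)
    \<comment> \<open>Coordinates of the product in the basis of the ideal: \<open>y'\<close> is
      read off from the coefficient of \<open>om\<close>, and \<open>x'\<close> is then solved for,
      with \<open>b\<^sup>2 + b + m = a * c\<close> eliminating \<open>m\<close>.\<close>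
    define y' where "y' = u * y + v * (int a * x + int b * y) + v * y"
    define x' where "x' = u * x - int b * v * x - v * y * int c"
    have "u * (int g * (int a * x + int b * y)) - int m * (v * (int g * y)) = int g * (int a * x' + int b * y')"
    proof -
      have "int a * x' + int b * y' = int a * u * x + u * int b * y + v * y * (int b * int b + int b - int a * int c)"
        by (simp add: x'_def y'_def algebra_simps)
      also have "int b * int b + int b - int a * int c = - int m" using c by simp
      finally have key: "int a * x' + int b * y' = u * (int a * x + int b * y) - v * y * int m" by (simp add: algebra_simps)
      show ?thesis unfolding key by (simp add: algebra_simps)
    qed
    moreover have "u * (int g * y) + v * (int g * (int a * x + int b * y)) + v * (int g * y) = int g * y'"
      by (simp add: y'_def algebra_simps)
    ultimately show ?thesis unfolding r z el_mult el_in_cid_iff by blast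
  qed
  have add: "z + w \<in> cid g a b" if z: "z \<in> cid g a b" and w: "w \<in> cid g a b" for z w
  proof -
    obtain x y where z: "z = el (int g * (int a * x + int b * y)) (int g * y)" using z by (auto simp: cid_def)
    obtain x' y' where w: "w = el (int g * (int a * x' + int b * y')) (int g * y')" using w by (auto simp: cid_def)
    show ?thesis unfolding z w el_add el_in_cid_iff by (intro exI[of _ "x + x'"] exI[of _ "y + y'"]) (simp add: algebra_simps)
  qed
  have "0 \<in> cid g a b" using el_in_cid_iff[of 0 0 g a b] el_of_int[of 0] by (auto intro!: exI[of _ 0])
  moreover have "cid g a b \<noteq> {0}"
  proof
    assume e: "cid g a b = {0}"
    have "el (int g * int a) 0 \<in> cid g a b" unfolding el_in_cid_iff by (intro exI[of _ 1] exI[of _ 0]) simp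
    then have "el (int g * int a) 0 = el 0 0" using e el_of_int[of 0] by simp
    then show False using o by (simp add: el_inj)
  qed
  moreover have "cid g a b \<subseteq> OK" by (auto simp: cid_def el_OK)
  ultimately show ?thesis unfolding NI_iff using mul add by blast
qed

text \<open>The triple can be read off from the ideal: \<open>g\<close> generates the coefficients
  of \<open>om\<close>, \<open>g * a\<close> generates the rational integers in the ideal, and
  \<open>b\<close> is fixed modulo \<open>a\<close> by any element whose
  \<open>om\<close>-coefficient is \<open>g\<close>.\<close>

lemma cid_inj:
  assumes T: "(g, a, b) \<in> T" "(g', a', b') \<in> T" and e: "cid g a b = cid g' a' b'"
  shows "g = g' \<and> a = a' \<and> b = b'"
proof -
  have gg: "g' dvd g" if "cid g a b = cid g' a' b'" for g g' a a' b b'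
  proof -
    have "el (int g * int b) (int g) \<in> cid g a b" unfolding el_in_cid_iff by (intro exI[of _ 0] exI[of _ 1]) simp
    then obtain y where "int g = int g' * y" unfolding \<open>cid g a b = cid g' a' b'\<close> el_in_cid_iff by blast
    then have "int g' dvd int g" by (rule dvdI)
    then show ?thesis by simp
  qed
  have g: "g = g'" using gg[OF e] gg[OF e[symmetric]] by (rule dvd_antisym[rotated])
  have g0: "g > 0" using T(1) by (simp add: T_def)
  have aa: "a' dvd a" if "cid g a b = cid g a' b'" for a a' b b'
  proof -
    have "el (int g * int a) 0 \<in> cid g a b" unfolding el_in_cid_iff by (intro exI[of _ 1] exI[of _ 0]) simp
    then obtain x y where xy: "int g * int a = int g * (int a' * x + int b' * y)" "0 = int g * y"
      unfolding \<open>cid g a b = cid g a' b'\<close> el_in_cid_iff by blast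
    then have "int a = int a' * x" using g0 by simp
    then have "int a' dvd int a" by (rule dvdI)
    then show ?thesis by simp
  qed
  have e': "cid g a b = cid g a' b'" using e g by simp
  have a: "a = a'" using aa[OF e'] aa[OF e'[symmetric]] by (rule dvd_antisym[rotated])
  have "el (int g * int b) (int g) \<in> cid g a b" unfolding el_in_cid_iff by (intro exI[of _ 0] exI[of _ 1]) simp
  then obtain x where "int g * int b = int g * (int a * x + int b')" unfolding e' a[symmetric] el_in_cid_iff using g0 by auto
  then have "int b = int a * x + int b'" using g0 by simp
  then have "int b mod int a = int b' mod int a" by simp
  then have "b = b'" using T a by (simp add: T_def flip: zmod_int)
  then show ?thesis using g a by simp
qed

text \<open>Hermite normal form of the lattice \<open>I\<close>: \<open>A\<close> collects the
  \<open>om\<close>-coefficients, with generator \<open>g\<close>, and \<open>B\<close> the rational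
  integers in \<open>I\<close>, with generator \<open>k\<close>. The ideal property enters through
  multiplication by \<open>om\<close>, which shows that \<open>g\<close> divides all coordinates,
  and by a conjugate, which shows that \<open>a\<close> divides a norm.\<close>

lemma NI_is_cid:
  assumes I: "I \<in> NI"
  obtains g a b where "(g, a, b) \<in> T" "I = cid g a b"
proof -
  have sub: "I \<subseteq> OK" and z0: "0 \<in> I" and add: "\<And>x y. x \<in> I \<Longrightarrow> y \<in> I \<Longrightarrow> x + y \<in> I"
    and mul: "\<And>r x. r \<in> OK \<Longrightarrow> x \<in> I \<Longrightarrow> r * x \<in> I" and nz: "I \<noteq> {0}" using I unfolding NI_iff by blast+
  have smul: "el (n * x) (n * y) \<in> I" if "el x y \<in> I" for n x y
    using mul[OF el_OK[of n 0] that] by (simp add: el_scale flip: el_of_int)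
  have ommul: "el (- int m * y) (x + y) \<in> I" if "el x y \<in> I" for x y
    using mul[OF el_OK[of 0 1] that] by (simp add: el_mult)
  define A where "A = {y. \<exists>x. el x y \<in> I}"
  define B where "B = {x. el x 0 \<in> I}"
  obtain z where z: "z \<in> I" "z \<noteq> 0" using nz z0 by blast
  obtain x0 y0 where xy0: "z = el x0 y0" using z(1) sub by (auto simp: OK_def)
  have "cnj z \<in> OK" unfolding xy0 cnj_el by (rule el_OK)
  \<comment> \<open>The norm of a nonzero element is a nonzero rational integer in \<open>I\<close>,
    so \<open>B\<close> is not trivial.\<close>
  then have "cnj z * z \<in> I" using z(1) by (rule mul)
  then have nB: "nf x0 y0 \<in> B" unfolding B_def xy0 using el_mult_cnj[of x0 y0] by (simp add: mult.commute el_of_int)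
  have "x0 \<noteq> 0 \<or> y0 \<noteq> 0" using z(2) xy0 el_of_int[of 0] by auto
  then have nB0: "nf x0 y0 \<noteq> 0" using nf_pos(2) by blast
  obtain k where k: "k > 0" "\<And>x. x \<in> B \<longleftrightarrow> k dvd x"
  proof (rule int_subgroup_principal[of B])
    show "0 \<in> B" using z0 el_of_int[of 0] by (simp add: B_def)
    show "x + y \<in> B" if "x \<in> B" "y \<in> B" for x y using add[of "el x 0" "el y 0"] that by (simp add: B_def el_add)
    show "- x \<in> B" if "x \<in> B" for x using smul[of x 0 "- 1"] that by (simp add: B_def)
  qed (use nB nB0 in auto)
  have kA: "k \<in> A"
  proof -
    have "el k 0 \<in> I" using k(2)[of k] by (simp add: B_def)
    from ommul[OF this] show ?thesis by (auto simp: A_def)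
  qed
  obtain g where g: "g > 0" "\<And>x. x \<in> A \<longleftrightarrow> g dvd x"
  proof (rule int_subgroup_principal[of A])
    show "0 \<in> A" using z0 el_of_int[of 0] by (auto simp: A_def intro!: exI[of _ 0])
    show "x + y \<in> A" if "x \<in> A" "y \<in> A" for x y
    proof -
      obtain u v where "el u x \<in> I" "el v y \<in> I" using \<open>x \<in> A\<close> \<open>y \<in> A\<close> by (auto simp: A_def)
      from add[OF this] show ?thesis by (auto simp: A_def el_add)
    qed
    show "- x \<in> A" if "x \<in> A" for x
    proof -
      obtain u where "el u x \<in> I" using \<open>x \<in> A\<close> by (auto simp: A_def)
      from smul[OF this, of "- 1"] show ?thesis by (auto simp: A_def)
    qed
    show "\<exists>x\<in>A. x \<noteq> 0" using kA k(1) by (intro bexI[of _ k]) auto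
  qed blast
  obtain a where a: "k = g * a" using g(2) kA by (auto elim: dvdE)
  have a0: "a > 0" using k(1) g(1) unfolding a by (simp add: zero_less_mult_iff)
  have "g \<in> A" using g(2) by simp
  then obtain be where be: "el be g \<in> I" by (auto simp: A_def)
  \<comment> \<open>\<open>be + g\<close> is the \<open>om\<close>-coefficient of
    \<open>om * (be + g * om)\<close>, because \<open>om * om = om - m\<close>.\<close>
  have "be + g \<in> A" using ommul[OF be] by (auto simp: A_def)
  then have "g dvd be + g" using g(2) by blast
  then have "g dvd be" by simp
  then obtain b0 where b0: "be = g * b0" by (auto elim: dvdE)
  define b where "b = b0 mod a"
  have b: "0 \<le> b" "b < a" using a0 by (auto simp: b_def)
  have kI: "el (k * n) 0 \<in> I" for n using k(2)[of "k * n"] by (simp add: B_def)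
  have bI: "el (g * b) g \<in> I"
  proof -
    have "el be g + el (k * (- (b0 div a))) 0 \<in> I" by (rule add[OF be kI])
    moreover have "be + k * (- (b0 div a)) = g * b"
      by (simp add: b0 a b_def minus_mult_div_eq_mod[symmetric] algebra_simps)
    ultimately show ?thesis by (simp add: el_add)
  qed
  \<comment> \<open>The product is the rational integer \<open>g * nf b 1\<close>, so it is
    divisible by \<open>k = g * a\<close>.\<close>
  have "el (g * b) g * cnj (el b 1) \<in> I"
    using mul[OF _ bI, of "cnj (el b 1)"] by (simp add: cnj_el el_OK mult.commute)
  also have "el (g * b) g = of_int g * el b 1" by (simp add: el_scale)
  finally have "of_int (g * nf b 1) \<in> I" by (simp add: el_mult_cnj mult.assoc)
  then have "g * nf b 1 \<in> B" by (simp only: B_def el_of_int mem_Collect_eq)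
  then have "g * a dvd g * nf b 1" using k(2) unfolding a by blast
  then have adv: "a dvd nf b 1" using g(1) by simp
  define G A' B' where "G = nat g" and "A' = nat a" and "B' = nat b"
  have i: "g = int G" "a = int A'" "b = int B'" using g(1) a0 b by (simp_all add: G_def A'_def B'_def)
  have "int A' dvd int (B'\<^sup>2 + B' + m)" using adv unfolding i by (simp add: nf_def)
  then have "(G, A', B') \<in> T" using g(1) a0 b(2) unfolding i by (simp add: T_def del: of_nat_add)
  moreover have "I = cid G A' B'"
  proof (intro equalityI subsetI)
    fix w assume w: "w \<in> I"
    then obtain x y where xy: "w = el x y" using sub by (auto simp: OK_def)
    have "y \<in> A" using w xy by (auto simp: A_def)
    then obtain y' where y': "y = g * y'" using g(2) by (auto elim: dvdE)
    have "el x y + el ((- y') * (g * b)) ((- y') * g) \<in> I" using add[OF w smul[OF bI]] xy by blast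
    then have "el (x - y' * (g * b)) 0 \<in> I" by (simp add: el_add y' mult.commute)
    then have "k dvd x - y' * (g * b)" using k(2) by (simp add: B_def)
    then obtain x' where "x - y' * (g * b) = k * x'" by (auto elim: dvdE)
    then have "x = g * (a * x' + b * y')" by (simp add: a algebra_simps)
    then show "w \<in> cid G A' B'" unfolding xy el_in_cid_iff i[symmetric] using y' by blast
  next
    fix w assume "w \<in> cid G A' B'"
    then obtain x y where w: "w = el (g * (a * x + b * y)) (g * y)" unfolding cid_def i by blast
    have "el (k * x) 0 + el (y * (g * b)) (y * g) \<in> I" by (rule add[OF kI smul[OF bI]])
    then show "w \<in> I" unfolding w by (simp add: el_add a algebra_simps)
  qed
  ultimately show thesis by (rule that)
qed

lemma bij_cid: "bij_betw (\<lambda>(g, a, b). cid g a b) T NI"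
  unfolding bij_betw_def
proof
  show "inj_on (\<lambda>(g, a, b). cid g a b) T" using cid_inj by (auto simp: inj_on_def)
  show "(\<lambda>(g, a, b). cid g a b) ` T = NI"
  proof (intro equalityI subsetI)
    fix I assume "I \<in> NI"
    then obtain g a b where "(g, a, b) \<in> T" "I = cid g a b" by (rule NI_is_cid)
    then show "I \<in> (\<lambda>(g, a, b). cid g a b) ` T" by (auto intro!: rev_image_eqI[of "(g, a, b)"])
  qed (use cid_NI in auto)
qed

text \<open>On \<open>OK\<close> the squared modulus is an integer already; the floor only changes
  the type.\<close>

definition nn :: "complex \<Rightarrow> int" where "nn z = \<lfloor>(cmod z)\<^sup>2\<rfloor>"

lemma nn_el: "nn (el x y) = nf x y" by (simp add: nn_def cmod_el_sq)

lemma nn_mult: "z \<in> OK \<Longrightarrow> w \<in> OK \<Longrightarrow> nn (z * w) = nn z * nn w"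
proof -
  assume "z \<in> OK" "w \<in> OK"
  then obtain x y x' y' where e: "z = el x y" "w = el x' y'" by (auto simp: OK_def)
  have "(cmod (z * w))\<^sup>2 = of_int (nf x y * nf x' y')" by (simp add: norm_mult power_mult_distrib e cmod_el_sq)
  then have "nn (z * w) = nf x y * nf x' y'" unfolding nn_def by (simp only: floor_of_int)
  then show ?thesis by (simp add: e nn_el)
qed

lemma nn_pos: "z \<in> OK \<Longrightarrow> z \<noteq> 0 \<Longrightarrow> nn z > 0"
proof -
  assume z: "z \<in> OK" "z \<noteq> 0"
  then obtain x y where e: "z = el x y" by (auto simp: OK_def)
  then have "nf x y \<noteq> 0" using z(2) nf_pos(2) el_of_int[of 0] by auto
  then show ?thesis using nf_pos(1)[of x y] by (simp add: e nn_el)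
qed

text \<open>The ideal norm as the gcd of the norms of the elements: this makes \<open>Nm (al I) = N(al) Nm I\<close> immediate.\<close>

definition Nm :: "complex set \<Rightarrow> int" where "Nm I = Gcd (nn ` I)"

lemma Nm_scale:
  assumes "al \<in> OK" "I \<subseteq> OK"
  shows "Nm ((*) al ` I) = nn al * Nm I"
proof -
  have "nn ` ((*) al ` I) = (*) (nn al) ` (nn ` I)"
    using assms nn_mult unfolding image_image by (intro image_cong refl) auto
  moreover have "nn al \<ge> 0" unfolding nn_def by simp
  ultimately show ?thesis unfolding Nm_def by (simp add: Gcd_mult abs_mult)
qed

text \<open>The square of the gcd of the three coefficients divides the discriminant, which is
  \<open>- p\<close> and squarefree.\<close>

lemma primitive_form:
  assumes "int b * int b + int b + int m = int a * int c"
  obtains r s t :: int where "r * int a + s * (2 * int b + 1) + t * int c = 1"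
proof -
  define h where "h = gcd (gcd (int a) (2 * int b + 1)) (int c)"
  have hd: "h dvd int a" "h dvd 2 * int b + 1" "h dvd int c" by (auto simp: h_def intro: dvd_trans[OF gcd_dvd1])
  have disc: "4 * (int a * int c) - (2 * int b + 1) * (2 * int b + 1) = int p"
    unfolding assms[symmetric] by (simp add: of_nat_p algebra_simps)
  have "h * h dvd 4 * (int a * int c) - (2 * int b + 1) * (2 * int b + 1)"
    using hd by (intro dvd_diff dvd_mult mult_dvd_mono)
  then have hp: "h * h dvd int p" unfolding disc .
  have h0: "h \<ge> 0" by (simp add: h_def)
  have "h dvd int p" using hp by (rule dvd_mult_left)
  moreover have "prime (int p)" using prime_p by simp
  ultimately have "h = 1 \<or> h = int p" using h0 by (metis prime_int_iff)
  moreover have "h \<noteq> int p"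
  proof
    assume "h = int p"
    then have "int p * int p \<le> int p" using hp p_pos by (auto intro!: zdvd_imp_le)
    then show False using p_eq m_gt by (simp add: mult_le_cancel_left1)
  qed
  ultimately have h1: "h = 1" by blast
  obtain u v where uv: "u * int a + v * (2 * int b + 1) = gcd (int a) (2 * int b + 1)" using bezout_int by blast
  obtain u' v' where uv': "u' * gcd (int a) (2 * int b + 1) + v' * int c = h" using bezout_int unfolding h_def by blast
  have "(u' * u) * int a + (u' * v) * (2 * int b + 1) + v' * int c = 1"
    using uv' unfolding uv[symmetric] h1 by (simp add: algebra_simps)
  then show thesis by (rule that)
qed

lemma nf_cid:
  assumes "int b * int b + int b + int m = int a * int c"
  shows "nf (int g * (int a * x + int b * y)) (int g * y) =
    int g * int g * int a * (int a * x\<^sup>2 + (2 * int b + 1) * x * y + int c * y\<^sup>2)"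
proof -
  have "nf (int g * (int a * x + int b * y)) (int g * y) = int g * int g *
      (int a * int a * x\<^sup>2 + (2 * int b + 1) * int a * x * y + (int b * int b + int b + int m) * y\<^sup>2)"
    by (simp add: nf_def power2_eq_square algebra_simps)
  then show ?thesis unfolding assms by (simp add: algebra_simps)
qed

text \<open>Norms of elements are \<open>g\<^sup>2 * a\<close> times values of the form with
  coefficients \<open>a\<close>, \<open>2 * b + 1\<close>, \<open>c\<close>. Its values at
  \<open>(1, 0)\<close>, \<open>(0, 1)\<close> and \<open>(1, 1)\<close> generate the coefficients,
  which have gcd 1.\<close>

lemma Nm_cid:
  assumes T: "(g, a, b) \<in> T"
  shows "Nm (cid g a b) = int g * int g * int a"
proof -
  obtain c where c: "int b * int b + int b + int m = int a * int c" and o: "a > 0" "g > 0" using T_obtain_c[OF T] by metis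
  define M where "M = int g * int g * int a"
  obtain r s t where bez: "r * int a + s * (2 * int b + 1) + t * int c = 1" using primitive_form[OF c] by blast
  have val: "nn (el (int g * (int a * x + int b * y)) (int g * y)) = M * (int a * x\<^sup>2 + (2 * int b + 1) * x * y + int c * y\<^sup>2)" for x y
    unfolding nn_el nf_cid[OF c] M_def ..
  have dv: "d dvd M * (int a * x\<^sup>2 + (2 * int b + 1) * x * y + int c * y\<^sup>2)" if "\<And>z. z \<in> cid g a b \<Longrightarrow> d dvd nn z" for d x y
  proof -
    have "el (int g * (int a * x + int b * y)) (int g * y) \<in> cid g a b" by (auto simp: cid_def)
    from that[OF this] show ?thesis unfolding val .
  qed
  have MG: "M dvd Gcd (nn ` cid g a b)"
  proof (rule Gcd_greatest)
    fix n assume "n \<in> nn ` cid g a b"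
    then obtain x y where "n = nn (el (int g * (int a * x + int b * y)) (int g * y))" by (auto simp: cid_def)
    then show "M dvd n" unfolding val by simp
  qed
  have GM: "Gcd (nn ` cid g a b) dvd M"
  proof -
    define d where "d = Gcd (nn ` cid g a b)"
    have d: "\<And>n. n \<in> nn ` cid g a b \<Longrightarrow> d dvd n" unfolding d_def by (rule Gcd_dvd)
    have 1: "d dvd M * int a" and 2: "d dvd M * int c" and 3: "d dvd M * (int a + (2 * int b + 1) + int c)"
      using dv[of d 1 0] dv[of d 0 1] dv[of d 1 1] d by auto
    have "d dvd M * (int a + (2 * int b + 1) + int c) - M * int a - M * int c" by (intro dvd_diff 1 2 3)
    then have 4: "d dvd M * (2 * int b + 1)" by (simp add: algebra_simps)
    have "d dvd r * (M * int a) + s * (M * (2 * int b + 1)) + t * (M * int c)" by (intro dvd_add dvd_mult 1 2 4)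
    also have "\<dots> = M * (r * int a + s * (2 * int b + 1) + t * int c)" by (simp add: algebra_simps)
    finally show ?thesis unfolding bez d_def by simp
  qed
  have "Gcd (nn ` cid g a b) = M"
    by (rule zdvd_antisym_nonneg[OF _ _ GM MG]) (simp_all add: M_def)
  then show ?thesis unfolding Nm_def by (simp add: M_def)
qed

end

section \<open>Ideal classes\<close>

context imaginary_quadratic
begin

definition crel :: "(complex set \<times> complex set) set" where "crel = ideal_class_rel (subring_record OK)"

lemma crel_iff: "(I, J) \<in> crel \<longleftrightarrow> I \<in> NI \<and> J \<in> NI \<and> (\<exists>al\<in>OK - {0}. \<exists>be\<in>OK - {0}. (*) al ` I = (*) be ` J)"
  by (simp add: crel_def ideal_class_rel_def NI_def)

lemma crel_refl: "I \<in> NI \<Longrightarrow> (I, I) \<in> crel"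
  unfolding crel_iff using OK_closed(2) by (intro conjI bexI[of _ 1]) auto

lemma crel_sym: "(I, J) \<in> crel \<Longrightarrow> (J, I) \<in> crel"
  unfolding crel_iff by metis

lemma image_times_times: "(*) al ` ((*) be ` I) = (*) (al * be) ` (I :: complex set)"
  by (simp add: image_image mult.assoc)

lemma crel_trans:
  assumes "(I, J) \<in> crel" "(J, K) \<in> crel"
  shows "(I, K) \<in> crel"
proof -
  obtain al be where 1: "al \<in> OK - {0}" "be \<in> OK - {0}" "(*) al ` I = (*) be ` J" using assms(1) unfolding crel_iff by metis
  obtain ga de where 2: "ga \<in> OK - {0}" "de \<in> OK - {0}" "(*) ga ` J = (*) de ` K" using assms(2) unfolding crel_iff by metis
  have "(*) (ga * al) ` I = (*) ga ` ((*) be ` J)" using 1(3) image_times_times by metis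
  also have "\<dots> = (*) be ` ((*) ga ` J)" unfolding image_times_times by (simp add: mult.commute)
  also have "\<dots> = (*) (be * de) ` K" unfolding 2(3) image_times_times ..
  finally have e: "(*) (ga * al) ` I = (*) (be * de) ` K" .
  have "ga * al \<in> OK - {0}" "be * de \<in> OK - {0}" using 1 2 OK_closed(4) by auto
  then show ?thesis unfolding crel_iff using e assms unfolding crel_iff by blast
qed

lemma equiv_crel: "equiv NI crel"
proof (rule equivI)
  show "crel \<subseteq> NI \<times> NI" unfolding crel_iff[abs_def] by (auto simp: crel_iff)
  show "refl_on NI crel" by (rule refl_onI) (use crel_refl in auto)
  show "sym crel" by (rule symI) (rule crel_sym)
  show "trans crel" by (rule transI) (rule crel_trans)
qed

text \<open>In \<open>(2 * s + t)\<^sup>2 + p * t\<^sup>2 = 4\<close> the bound \<open>p > 4\<close>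
  forces \<open>t = 0\<close>. It is the reason why an ideal of a class comes from exactly two
  vectors.\<close>

lemma unit_OK:
  assumes "nf s t = 1" shows "el s t = 1 \<or> el s t = - 1"
proof -
  have 4: "(2 * s + t)\<^sup>2 + int p * t\<^sup>2 = 4"
  proof -
    have "(2 * s + t)\<^sup>2 + int p * t\<^sup>2 = 4 * nf s t" by (simp add: nf_def of_nat_p power2_eq_square algebra_simps)
    then show ?thesis using assms by simp
  qed
  have t: "t = 0"
  proof (rule ccontr)
    assume "t \<noteq> 0"
    then have "t\<^sup>2 > 0" by simp
    then have "t\<^sup>2 \<ge> 1" by linarith
    then have "int p * 1 \<le> int p * t\<^sup>2" by (intro mult_left_mono) auto
    moreover have "0 \<le> (2 * s + t)\<^sup>2" by simp
    ultimately have "int p \<le> 4" using 4 by linarith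
    then show False using p_eq m_gt by linarith
  qed
  then have "s\<^sup>2 = 1" using 4 by (simp add: power2_eq_square)
  then have "s = 1 \<or> s = - 1" by (simp add: power2_eq_1_iff)
  then show ?thesis using t el_of_int[of 1] el_of_int[of "- 1"] by auto
qed

lemma cid_scale:
  assumes "(g, a, b) \<in> T"
  shows "(1, a, b) \<in> T" "(cid g a b, cid 1 a b) \<in> crel"
proof -
  show T1: "(1, a, b) \<in> T" using assms by (simp add: T_def)
  have g: "g > 0" using assms by (simp add: T_def)
  have s: "of_nat g * el (int a * x + int b * y) y = el (int g * (int a * x + int b * y)) (int g * y)" for x y
    using el_scale[of "int g" "int a * x + int b * y" y] by simp
  have "(*) (of_nat g) ` cid 1 a b = cid g a b"
  proof (intro equalityI subsetI)
    fix w assume "w \<in> (*) (of_nat g) ` cid 1 a b"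
    then obtain x y where "w = of_nat g * el (int a * x + int b * y) y" by (auto simp: cid_def)
    then show "w \<in> cid g a b" unfolding s by (auto simp: cid_def)
  next
    fix w assume "w \<in> cid g a b"
    then obtain x y where w: "w = of_nat g * el (int a * x + int b * y) y" unfolding s by (auto simp: cid_def)
    have "el (int a * x + int b * y) y \<in> cid 1 a b" unfolding el_in_cid_iff by auto
    then show "w \<in> (*) (of_nat g) ` cid 1 a b" using w by blast
  qed
  then have "(*) 1 ` cid g a b = (*) (of_nat g) ` cid 1 a b" by simp
  moreover have "of_nat g \<in> OK - {0}" using g el_of_int[of "int g"] el_OK by auto
  ultimately show "(cid g a b, cid 1 a b) \<in> crel"
    unfolding crel_iff using cid_NI[OF assms] cid_NI[OF T1] OK_closed(2) by (intro conjI bexI[of _ 1] bexI[of _ "of_nat g"]) auto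
qed

end

section \<open>The ideals of one class and their norm form\<close>

locale class_representative = imaginary_quadratic +
  fixes a b c :: nat
  assumes T1: "(1, a, b) \<in> T" and c_eq: "int b * int b + int b + int m = int a * int c"
begin

definition J0 :: "complex set" where "J0 = cid 1 a b"
definition w0 :: complex where "w0 = el (int b) 1"
definition wb :: complex where "wb = el (int b + 1) (- 1)"
text \<open>Runs through the conjugate of \<open>J0\<close>, in the basis \<open>of_nat a\<close>,
  \<open>wb\<close>.\<close>

definition A :: "int \<Rightarrow> int \<Rightarrow> complex" where "A x y = el (int a * x + (int b + 1) * y) (- y)"
text \<open>\<open>J0\<close> times its conjugate is the principal ideal of \<open>a\<close>. Hence
  \<open>z * J0\<close> is integral exactly for \<open>z = \<alpha> / a\<close> with
  \<open>\<alpha>\<close> in the conjugate of \<open>J0\<close>, and these multiples are all the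
  integral ideals in the class.\<close>

definition \<Psi> :: "int \<Rightarrow> int \<Rightarrow> complex set" where "\<Psi> x y = (\<lambda>z. A x y * z / of_nat a) ` J0"
definition Q :: "int \<Rightarrow> int \<Rightarrow> int" where "Q x y = int a * x\<^sup>2 + (2 * int b + 1) * x * y + int c * y\<^sup>2"

lemma a_pos: "a > 0" using T1 by (simp add: T_def)

lemma a_nz: "(of_nat a :: complex) \<noteq> 0" using a_pos by simp

lemma J0_NI: "J0 \<in> NI" unfolding J0_def by (rule cid_NI[OF T1])

lemma J0_sub: "J0 \<subseteq> OK" and J0_add: "z \<in> J0 \<Longrightarrow> w \<in> J0 \<Longrightarrow> z + w \<in> J0"
  and J0_mul: "r \<in> OK \<Longrightarrow> z \<in> J0 \<Longrightarrow> r * z \<in> J0"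
  using J0_NI unfolding NI_iff by blast+

lemma cnj_w0: "cnj w0 = wb" by (simp add: w0_def wb_def cnj_el)

lemma w0_wb: "w0 * wb = of_nat a * of_nat c"
proof -
  have "w0 * wb = of_int (nf (int b) 1)" unfolding cnj_w0[symmetric] w0_def by (rule el_mult_cnj)
  also have "nf (int b) 1 = int a * int c" using c_eq by (simp add: nf_def power2_eq_square)
  finally show ?thesis by simp
qed

lemma w0_add_wb: "w0 + wb = of_int (2 * int b + 1)"
  by (simp add: w0_def wb_def el_add el_of_int el_inj)

lemma A_eq: "A x y = of_nat a * of_int x + of_int y * wb"
  by (simp add: A_def wb_def el_def algebra_simps)

lemma J0_elem: "z \<in> J0 \<longleftrightarrow> (\<exists>x y. z = of_nat a * of_int x + of_int y * w0)"
proof -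
  have "el (int 1 * (int a * x + int b * y)) (int 1 * y) = of_nat a * of_int x + of_int y * w0" for x y
    by (simp add: w0_def el_def algebra_simps)
  then show ?thesis unfolding J0_def cid_def by auto
qed

lemma a_J0: "of_nat a \<in> J0" unfolding J0_elem by (intro exI[of _ 1] exI[of _ 0]) simp

lemma w0_J0: "w0 \<in> J0" unfolding J0_elem by (intro exI[of _ 0] exI[of _ 1]) simp

lemma w_OK: "w0 \<in> OK" "wb \<in> OK" by (simp_all add: w0_def wb_def el_OK)

lemma int_OK: "of_int n \<in> OK" "of_nat k \<in> OK"
  using el_of_int[of n] el_of_int[of "int k"] el_OK by auto

lemma A_OK: "A x y \<in> OK" by (simp add: A_def el_OK)

text \<open>The products of the basis elements of \<open>J0\<close> and of its conjugate are
  \<open>a * a\<close>, \<open>a * w0\<close>, \<open>a * wb\<close> and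
  \<open>w0 * wb = a * c\<close>, all multiples of \<open>a\<close>.\<close>

lemma A_mult_J0:
  assumes "z \<in> J0"
  shows "A x y * z / of_nat a \<in> OK"
proof -
  obtain x' y' where z: "z = of_nat a * of_int x' + of_int y' * w0" using assms J0_elem by blast
  have "A x y * z = of_nat a * (of_nat a * of_int x * of_int x' + of_int x * of_int y' * w0 + of_int x' * of_int y * wb)
      + of_int y * of_int y' * (w0 * wb)"
    unfolding A_eq z by (simp add: algebra_simps)
  also have "\<dots> = of_nat a * (of_nat a * of_int x * of_int x' + of_int x * of_int y' * w0 + of_int x' * of_int y * wb
      + of_int y * of_int y' * of_nat c)"
    unfolding w0_wb by (simp add: algebra_simps)
  finally have "A x y * z / of_nat a = of_nat a * of_int x * of_int x' + of_int x * of_int y' * w0 + of_int x' * of_int y * wb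
      + of_int y * of_int y' * of_nat c"
    using a_nz by simp
  also have "\<dots> \<in> OK" by (intro OK_closed(3,4) int_OK w_OK)
  finally show ?thesis .
qed

lemma \<Psi>_scale: "(*) (of_nat a) ` \<Psi> x y = (*) (A x y) ` J0"
  unfolding \<Psi>_def image_image using a_nz by (intro image_cong refl) simp

lemma A_nz: "A x y = 0 \<longleftrightarrow> x = 0 \<and> y = 0"
proof -
  have "A x y = 0 \<longleftrightarrow> A x y = el 0 0" using el_of_int[of 0] by simp
  then show ?thesis unfolding A_def el_inj using a_pos by auto
qed

lemma \<Psi>_NI:
  assumes "(x, y) \<noteq> (0, 0)"
  shows "\<Psi> x y \<in> NI" "(\<Psi> x y, J0) \<in> crel"
proof -
  have An: "A x y \<noteq> 0" using assms A_nz by auto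
  have sub: "\<Psi> x y \<subseteq> OK" unfolding \<Psi>_def using A_mult_J0 by auto
  have "0 \<in> J0" using J0_NI NI_iff by blast
  then have "A x y * 0 / of_nat a \<in> \<Psi> x y" unfolding \<Psi>_def by (rule imageI)
  then have zero: "0 \<in> \<Psi> x y" by simp
  have add: "z + w \<in> \<Psi> x y" if zw: "z \<in> \<Psi> x y" "w \<in> \<Psi> x y" for z w
  proof -
    obtain z' w' where "z' \<in> J0" "w' \<in> J0" and e: "z = A x y * z' / of_nat a" "w = A x y * w' / of_nat a"
      using zw by (auto simp: \<Psi>_def)
    then have "z' + w' \<in> J0" by (intro J0_add)
    then have "A x y * (z' + w') / of_nat a \<in> \<Psi> x y" unfolding \<Psi>_def by (rule imageI)
    then show ?thesis unfolding e by (simp add: distrib_left add_divide_distrib)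
  qed
  have mul: "r * z \<in> \<Psi> x y" if rz: "r \<in> OK" "z \<in> \<Psi> x y" for r z
  proof -
    obtain z' where z': "z' \<in> J0" and e: "z = A x y * z' / of_nat a" using rz by (auto simp: \<Psi>_def)
    have "A x y * (r * z') / of_nat a \<in> \<Psi> x y" unfolding \<Psi>_def by (intro imageI J0_mul rz(1) z')
    then show ?thesis unfolding e by (simp add: mult_ac)
  qed
  have "A x y * of_nat a / of_nat a \<in> \<Psi> x y" unfolding \<Psi>_def by (intro imageI a_J0)
  then have "A x y \<in> \<Psi> x y" using a_nz by simp
  then have "\<Psi> x y \<noteq> {0}" using An by auto
  then show NI: "\<Psi> x y \<in> NI" unfolding NI_iff using sub zero add mul by blast
  have "of_nat a \<in> OK - {0}" "A x y \<in> OK - {0}" using int_OK(2) a_nz A_OK An by auto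
  then show "(\<Psi> x y, J0) \<in> crel" unfolding crel_iff using NI J0_NI \<Psi>_scale by blast
qed

lemma nn_A: "nn (A x y) = int a * Q x y"
proof -
  have "nn (A x y) = int a * int a * x\<^sup>2 + int a * (2 * int b + 1) * x * y + (int b * int b + int b + int m) * y\<^sup>2"
    unfolding A_def nn_el nf_def by (simp add: power2_eq_square algebra_simps)
  then show ?thesis unfolding c_eq Q_def by (simp add: algebra_simps)
qed

lemma Nm_J0: "Nm J0 = int a" unfolding J0_def Nm_cid[OF T1] by simp

text \<open>Multiplying by \<open>a\<close> turns the ideal into \<open>A x y\<close> times
  \<open>J0\<close>, of norm \<open>a * Q x y * a\<close>; the norm \<open>a * a\<close> of the
  multiplier cancels.\<close>

lemma Nm_\<Psi>:
  assumes "(x, y) \<noteq> (0, 0)"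
  shows "Nm (\<Psi> x y) = Q x y"
proof -
  have "\<Psi> x y \<subseteq> OK" using \<Psi>_NI(1)[OF assms] unfolding NI_iff by (rule conjunct1)
  then have "nn (of_nat a) * Nm (\<Psi> x y) = Nm ((*) (of_nat a) ` \<Psi> x y)"
    by (intro Nm_scale[symmetric] int_OK(2))
  also have "\<dots> = nn (A x y) * int a" unfolding \<Psi>_scale using Nm_scale[OF A_OK J0_sub] Nm_J0 by simp
  also have "\<dots> = int a * int a * Q x y" unfolding nn_A by simp
  finally have "nn (of_nat a) * Nm (\<Psi> x y) = int a * int a * Q x y" .
  moreover have "nn (of_nat a) = int a * int a"
    using nn_el[of "int a" 0] el_of_int[of "int a"] by (simp add: nf_def power2_eq_square)
  ultimately have "(int a * int a) * Nm (\<Psi> x y) = (int a * int a) * Q x y" by (simp only:)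
  moreover have "int a * int a \<noteq> 0" using a_pos by simp
  ultimately show ?thesis by (simp only: mult_cancel_left) blast
qed

text \<open>The inclusion of \<open>a\<close> in the product of \<open>J0\<close> and its conjugate,
  made explicit: \<open>a * a\<close>, \<open>a * (w0 + wb)\<close> and \<open>w0 * wb\<close> are
  \<open>a\<close> times the coefficients of \<open>Q\<close>, which combine to 1.\<close>

lemma bezout_identity:
  assumes "r * int a + s * (2 * int b + 1) + t * int c = 1"
  shows "z * of_nat a = of_nat a * (of_int r * (z * of_nat a) + of_int s * (z * w0)) + wb * (of_int s * (z * of_nat a) + of_int t * (z * w0))"
proof -
  have "of_nat a * (of_int r * (z * of_nat a) + of_int s * (z * w0)) + wb * (of_int s * (z * of_nat a) + of_int t * (z * w0))
    = z * (of_nat a * of_nat a * of_int r + of_nat a * of_int s * (w0 + wb) + of_int t * (w0 * wb))"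
    by (simp add: algebra_simps)
  also have "\<dots> = z * of_nat a * of_int (r * int a + s * (2 * int b + 1) + t * int c)"
    unfolding w0_add_wb w0_wb by (simp add: algebra_simps)
  finally show ?thesis unfolding assms by simp
qed

text \<open>If \<open>I = z * J0\<close> is integral, then \<open>z * a\<close> and
  \<open>z * w0\<close> are, and the Bezout identity places \<open>z * a\<close> in the conjugate of
  \<open>J0\<close>, so it is some \<open>A x y\<close>.\<close>

lemma \<Psi>_surj:
  assumes "(I, J0) \<in> crel"
  obtains x y where "(x, y) \<noteq> (0, 0)" "I = \<Psi> x y"
proof -
  obtain al be where ab: "al \<in> OK - {0}" "be \<in> OK - {0}" and e: "(*) al ` I = (*) be ` J0" and I: "I \<in> NI"
    using assms unfolding crel_iff by blast
  obtain r s t where bez: "r * int a + s * (2 * int b + 1) + t * int c = 1" using primitive_form[OF c_eq] by blast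
  define z where "z = be / al"
  have z0: "z \<noteq> 0" using ab by (simp add: z_def)
  have "(\<lambda>w. w / al) ` ((*) al ` I) = (\<lambda>w. w / al) ` ((*) be ` J0)" unfolding e ..
  then have Iz: "I = (*) z ` J0" using ab by (simp add: image_image z_def)
  have "I \<subseteq> OK" using I unfolding NI_iff by (rule conjunct1)
  then have uv: "z * of_nat a \<in> OK" "z * w0 \<in> OK"
    using imageI[OF a_J0, of "(*) z"] imageI[OF w0_J0, of "(*) z"] unfolding Iz by blast+
  define e where "e = of_int r * (z * of_nat a) + of_int s * (z * w0)"
  define f where "f = of_int s * (z * of_nat a) + of_int t * (z * w0)"
  have ef: "e \<in> OK" "f \<in> OK" unfolding e_def f_def by (intro OK_closed(3,4) int_OK uv)+
  have cnjOK: "cnj w \<in> OK" if "w \<in> OK" for w using that el_OK cnj_el unfolding OK_def by (elim CollectE exE conjE) simp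
  have za: "z * of_nat a = of_nat a * e + wb * f" unfolding e_def f_def by (rule bezout_identity[OF bez])
  \<comment> \<open>Conjugation moves the statement into \<open>J0\<close>, whose closure properties
    are available, and is undone afterwards.\<close>
  have "cnj wb = w0" unfolding cnj_w0[symmetric] by simp
  then have "cnj (of_nat a * e + wb * f) = cnj e * of_nat a + cnj f * w0" by (simp add: mult.commute)
  then have "cnj (z * of_nat a) = cnj e * of_nat a + cnj f * w0" unfolding za .
  also have "\<dots> \<in> J0" by (intro J0_add J0_mul cnjOK ef a_J0 w0_J0)
  finally obtain x y where "cnj (z * of_nat a) = of_nat a * of_int x + of_int y * w0" using J0_elem by blast
  then have "cnj (cnj (z * of_nat a)) = cnj (of_nat a * of_int x + of_int y * w0)" by (rule arg_cong)
  then have zA: "z * of_nat a = A x y" unfolding A_eq by (simp add: cnj_w0)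
  have "A x y \<noteq> 0" unfolding zA[symmetric] using z0 a_nz by (rule no_zero_divisors)
  then have "(x, y) \<noteq> (0, 0)" unfolding A_nz by simp
  moreover have "I = \<Psi> x y" unfolding Iz \<Psi>_def zA[symmetric] using a_nz by (intro image_cong refl) simp
  ultimately show thesis by (rule that)
qed

lemma A_minus: "A (- x) (- y) = - A x y" by (simp add: A_eq)

lemma A_inj: "A x y = A x' y' \<longleftrightarrow> x = x' \<and> y = y'"
  unfolding A_def el_inj using a_pos by auto

text \<open>The quotient \<open>u\<close> of the two multipliers maps \<open>J0\<close> into itself
  and is therefore integral by the Bezout identity. Equal ideals have equal norms, so
  \<open>u\<close> has norm 1 and is a unit.\<close>

lemma \<Psi>_inj:
  assumes n: "(x, y) \<noteq> (0, 0)" "(x', y') \<noteq> (0, 0)" and e: "\<Psi> x y = \<Psi> x' y'"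
  shows "(x = x' \<and> y = y') \<or> (x = - x' \<and> y = - y')"
proof -
  have eA: "(*) (A x y) ` J0 = (*) (A x' y') ` J0" using \<Psi>_scale e by metis
  have A0: "A x y \<noteq> 0" "A x' y' \<noteq> 0" using n A_nz by auto
  obtain r s t where bez: "r * int a + s * (2 * int b + 1) + t * int c = 1" using primitive_form[OF c_eq] by blast
  obtain j1 where j1: "j1 \<in> J0" "A x y * of_nat a = A x' y' * j1" using eA a_J0 by (metis imageE imageI)
  obtain j2 where j2: "j2 \<in> J0" "A x y * w0 = A x' y' * j2" using eA w0_J0 by (metis imageE imageI)
  define u where "u = A x y / A x' y'"
  have u1: "u * of_nat a = j1" and u2: "u * w0 = j2" using j1 j2 A0 by (simp_all add: u_def divide_eq_eq mult.commute)
  have wbA: "A 0 1 = wb" by (simp add: A_eq)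
  have "u * of_nat a = of_nat a * (of_int r * j1 + of_int s * j2) + wb * (of_int s * j1 + of_int t * j2)"
    using bezout_identity[OF bez, of u] unfolding u1 u2 .
  then have "u = (of_int r * j1 + of_int s * j2) + wb * (of_int s * j1 + of_int t * j2) / of_nat a"
    using a_nz by (simp add: field_simps)
  also have "\<dots> \<in> OK"
  proof (intro OK_closed(3))
    show "of_int r * j1 \<in> OK" "of_int s * j2 \<in> OK" using j1 j2 J0_sub by (auto intro!: OK_closed(4) int_OK)
    have "of_int s * j1 + of_int t * j2 \<in> J0" using j1 j2 by (intro J0_add J0_mul int_OK)
    from A_mult_J0[OF this, of 0 1] show "wb * (of_int s * j1 + of_int t * j2) / of_nat a \<in> OK" unfolding wbA .
  qed
  finally have uOK: "u \<in> OK" .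
  have "nn (A x y) = nn (A x' y')"
    unfolding nn_A using Nm_\<Psi>[OF n(1)] Nm_\<Psi>[OF n(2)] e by simp
  moreover have "A x y = u * A x' y'" using A0 by (simp add: u_def)
  ultimately have "nn u * nn (A x' y') = nn (A x' y')" using nn_mult[OF uOK A_OK] by metis
  then have "nn u = 1" using nn_pos[OF A_OK A0(2)] by simp
  moreover obtain s' t' where st: "u = el s' t'" using uOK by (auto simp: OK_def)
  ultimately have "u = 1 \<or> u = - 1" using unit_OK by (simp add: nn_el)
  then have "A x y = A x' y' \<or> A x y = A (- x') (- y')" using \<open>A x y = u * A x' y'\<close> unfolding A_minus by auto
  then show ?thesis unfolding A_inj .
qed

lemma \<Psi>_minus: "\<Psi> (- x) (- y) = \<Psi> x y"
proof -
  have neg: "- z \<in> J0" if "z \<in> J0" for z using J0_mul[OF int_OK(1)[of "- 1"] that] by simp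
  have "\<Psi> (- x) (- y) = (\<lambda>z. A x y * z / of_nat a) ` (uminus ` J0)" unfolding \<Psi>_def A_minus image_image by simp
  also have "uminus ` J0 = J0" using neg by (auto intro!: rev_image_eqI[of "- _"])
  finally show ?thesis by (simp add: \<Psi>_def)
qed

text \<open>One vector from each pair of nonzero vectors \<open>v\<close>, \<open>- v\<close>, since
  the two give the same ideal.\<close>

definition H :: "(int \<times> int) set" where "H = {(x, y). y > 0 \<or> (y = 0 \<and> x > 0)}"

lemma bij_\<Psi>: "bij_betw (\<lambda>(x, y). \<Psi> x y) H {I. (J0, I) \<in> crel}"
  unfolding bij_betw_def
proof
  show "inj_on (\<lambda>(x, y). \<Psi> x y) H"
  proof (rule inj_onI)
    fix v w assume v: "v \<in> H" and w: "w \<in> H" and e: "(case v of (x, y) \<Rightarrow> \<Psi> x y) = (case w of (x, y) \<Rightarrow> \<Psi> x y)"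
    obtain x y x' y' where vw: "v = (x, y)" "w = (x', y')" by (cases v, cases w) blast
    have "(x = x' \<and> y = y') \<or> (x = - x' \<and> y = - y')"
      using v w e unfolding vw by (intro \<Psi>_inj) (auto simp: H_def)
    then show "v = w" using v w unfolding vw H_def by auto
  qed
  show "(\<lambda>(x, y). \<Psi> x y) ` H = {I. (J0, I) \<in> crel}"
  proof (intro equalityI subsetI)
    fix I assume "I \<in> (\<lambda>(x, y). \<Psi> x y) ` H"
    then obtain x y where xy: "(x, y) \<in> H" "I = \<Psi> x y" by auto
    have "(x, y) \<noteq> (0, 0)" using xy(1) by (auto simp: H_def)
    then show "I \<in> {I. (J0, I) \<in> crel}" using crel_sym[OF \<Psi>_NI(2)] xy(2) by simp
  next
    fix I assume "I \<in> {I. (J0, I) \<in> crel}"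
    then have "(I, J0) \<in> crel" using crel_sym by simp
    then obtain x y where xy: "(x, y) \<noteq> (0, 0)" "I = \<Psi> x y" by (rule \<Psi>_surj)
    show "I \<in> (\<lambda>(x, y). \<Psi> x y) ` H"
    proof (cases "(x, y) \<in> H")
      case True then show ?thesis using xy(2) by (intro rev_image_eqI[of "(x, y)"]) auto
    next
      case False
      then have "(- x, - y) \<in> H" using xy(1) by (auto simp: H_def)
      then show ?thesis using xy(2) \<Psi>_minus by (intro rev_image_eqI[of "(- x, - y)"]) auto
    qed
  qed
qed

definition \<theta> :: "real \<Rightarrow> real" where
  "\<theta> t = (\<Sum>\<^sub>\<infinity>(x::int, y::int). exp (- t * (real a * of_int x ^ 2 + real (2 * b + 1) * of_int x * of_int y + real c * of_int y ^ 2)))"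

lemma discriminant: "4 * real a * real c - (real (2 * b + 1))\<^sup>2 = real p"
proof -
  have "4 * (int a * int c) - (2 * int b + 1) * (2 * int b + 1) = int p"
    unfolding c_eq[symmetric] by (simp add: of_nat_p algebra_simps)
  then have "real_of_int (4 * (int a * int c) - (2 * int b + 1) * (2 * int b + 1)) = real_of_int (int p)" by (rule arg_cong)
  then show ?thesis by (simp add: power2_eq_square algebra_simps)
qed

lemma \<theta>_limit: "((\<lambda>t. \<theta> t - 2 * \<theta> (2 * t)) \<longlongrightarrow> 0) (at_right 0)"
  unfolding \<theta>_def by (rule theta_scaling_limit[OF _ _ discriminant]) (use a_pos p_pos in auto)

text \<open>The ideals of the class correspond to \<open>H\<close>. The theta series runs over
  \<open>H\<close>, its negative with the same sum, and the origin, which contributes 1.\<close>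

lemma class_sum:
  assumes t: "t > 0"
  shows "((\<lambda>I. exp (- t * of_int (Nm I))) has_sum (\<theta> t - 1) / 2) {I. (J0, I) \<in> crel}"
proof -
  define f where "f = (\<lambda>(x::int, y::int). exp (- t * of_int (Q x y)))"
  have f_eq: "f = (\<lambda>(x::int, y::int). exp (- t * (real a * of_int x ^ 2 + real (2 * b + 1) * of_int x * of_int y + real c * of_int y ^ 2)))"
    unfolding f_def Q_def by (simp add: fun_eq_iff)
  have "f summable_on UNIV"
  proof (rule theta_summable_asymp)
    assume sm: "\<And>a b c D t :: real. a > 0 \<Longrightarrow> D > 0 \<Longrightarrow> 4 * a * c - b\<^sup>2 = D \<Longrightarrow> t > 0 \<Longrightarrow>
       (\<lambda>(x::int, y::int). exp (- t * (a * of_int x ^ 2 + b * of_int x * of_int y + c * of_int y ^ 2))) summable_on UNIV"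
    show ?thesis unfolding f_eq by (rule sm[OF _ _ discriminant t]) (use a_pos p_pos in simp_all)
  qed
  then have sub: "f summable_on X" for X using summable_on_subset_banach by blast
  define S where "S = infsum f H"
  have H: "(f has_sum S) H" unfolding S_def using sub by simp
  have "bij_betw (\<lambda>(x, y). (- x, - y)) H {(x, y). (- x, - y) \<in> H}"
    by (rule bij_betwI[of _ _ _ "\<lambda>(x, y). (- x, - y)"]) auto
  from has_sum_reindex_bij_betw[OF this, of f S]
  have H': "(f has_sum S) {(x, y). (- x, - y) \<in> H}"
    using H by (simp add: f_def Q_def case_prod_unfold)
  have "(f has_sum (S + S)) (H \<union> {(x, y). (- x, - y) \<in> H})"
    by (rule has_sum_Un_disjoint[OF H H']) (auto simp: H_def)
  then have "(f has_sum (f (0, 0) + (S + S))) (insert (0, 0) (H \<union> {(x, y). (- x, - y) \<in> H}))"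
    by (subst has_sum_insert) (auto simp: H_def)
  moreover have "insert (0, 0) (H \<union> {(x, y). (- x, - y) \<in> H}) = UNIV" by (auto simp: H_def)
  moreover have "f (0, 0) = 1" by (simp add: f_def Q_def)
  ultimately have "(f has_sum (1 + 2 * S)) UNIV" by simp
  then have "\<theta> t = 1 + 2 * S" unfolding \<theta>_def f_eq by (rule infsumI)
  then have S: "S = (\<theta> t - 1) / 2" by simp
  have "((\<lambda>v. exp (- t * of_int (Nm (case v of (x, y) \<Rightarrow> \<Psi> x y)))) has_sum S) H"
  proof (subst has_sum_cong)
    fix v assume "v \<in> H"
    then show "exp (- t * of_int (Nm (case v of (x, y) \<Rightarrow> \<Psi> x y))) = f v"
      by (cases v) (auto simp: f_def H_def Nm_\<Psi>)
  qed (rule H)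
  then show ?thesis unfolding has_sum_reindex_bij_betw[OF bij_\<Psi>, of "\<lambda>I. exp (- t * of_int (Nm I))"] S .
qed

text \<open>Completing the square,
  \<open>4 * a * Q x 1 = (2 * a * x + 2 * b + 1)\<^sup>2 + p\<close>. Multiples of
  \<open>2 * a\<close> bring \<open>2 * b + 1\<close> to absolute value at most \<open>a\<close>; as
  \<open>b < a\<close>, \<open>x = 0\<close> or \<open>x = - 1\<close> does it.\<close>

lemma small_value: "\<exists>x. 4 * int a * Q x 1 \<le> int a * int a + int p"
proof -
  have *: "4 * int a * Q x 1 = (2 * int a * x + 2 * int b + 1)\<^sup>2 + int p" for x
  proof -
    have "4 * int a * Q x 1 = (2 * int a * x + 2 * int b + 1)\<^sup>2 + (4 * (int a * int c) - (2 * int b + 1) * (2 * int b + 1))"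
      by (simp add: Q_def power2_eq_square algebra_simps)
    also have "4 * (int a * int c) - (2 * int b + 1) * (2 * int b + 1) = int p"
      unfolding c_eq[symmetric] by (simp add: of_nat_p algebra_simps)
    finally show ?thesis .
  qed
  have b: "b < a" using T1 by (simp add: T_def)
  have "\<exists>x. \<bar>2 * int a * x + 2 * int b + 1\<bar> \<le> int a"
  proof (cases "2 * b + 1 \<le> a")
    case True then show ?thesis by (intro exI[of _ 0]) auto
  next
    case False then show ?thesis using b by (intro exI[of _ "- 1"]) auto
  qed
  then obtain x where "\<bar>2 * int a * x + 2 * int b + 1\<bar> \<le> int a" by blast
  then have "(2 * int a * x + 2 * int b + 1)\<^sup>2 \<le> (int a)\<^sup>2" using abs_le_square_iff[of "2 * int a * x + 2 * int b + 1" "int a"] by simp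
  then show ?thesis using * by (intro exI[of _ x]) (simp add: power2_eq_square)
qed

end

section \<open>Finiteness of the class group and the generating function of all ideals\<close>

context imaginary_quadratic
begin

lemma class_representativeI:
  assumes "(1, a, b) \<in> T"
  obtains c where "class_representative p m a b c"
proof -
  obtain c where "int b * int b + int b + int m = int a * int c" using T_obtain_c[OF assms] by metis
  then have "class_representative p m a b c" using assms by unfold_locales
  then show thesis by (rule that)
qed

text \<open>Reduction of forms by minimality: take \<open>a\<close> least in the class. The ideal
  \<open>\<Psi> x 1\<close> belonging to a small value of \<open>Q\<close> lies in the same class,
  so \<open>a \<le> Q x 1\<close>, hence \<open>4 * a\<^sup>2 \<le> a\<^sup>2 + p\<close>.\<close>

lemma small_representative:
  assumes I: "I \<in> NI"
  obtains a b where "(1, a, b) \<in> T" "(I, cid 1 a b) \<in> crel" "a \<le> p"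
proof -
  define P where "P a \<longleftrightarrow> (\<exists>b. (1, a, b) \<in> T \<and> (I, cid 1 a b) \<in> crel)" for a
  obtain g0 a0 b0 where "(g0, a0, b0) \<in> T" "I = cid g0 a0 b0" using NI_is_cid[OF I] .
  then have "P a0" unfolding P_def using cid_scale by blast
  then have "P (LEAST a. P a)" by (rule LeastI)
  moreover define a where "a = (LEAST a. P a)"
  ultimately obtain b where b: "(1, a, b) \<in> T" "(I, cid 1 a b) \<in> crel" unfolding P_def by blast
  have min: "a \<le> a'" if "P a'" for a' unfolding a_def using that by (rule Least_le)
  obtain c where "class_representative p m a b c" using class_representativeI[OF b(1)] .
  then interpret class_representative p m a b c .
  obtain x where x: "4 * int a * Q x 1 \<le> int a * int a + int p" using small_value by blast
  have ne: "(x, 1) \<noteq> (0, 0 :: int)" by simp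
  obtain g' a' b' where T': "(g', a', b') \<in> T" and \<Psi>: "\<Psi> x 1 = cid g' a' b'" using NI_is_cid[OF \<Psi>_NI(1)[OF ne]] .
  have "(I, \<Psi> x 1) \<in> crel" using crel_trans[OF b(2)] crel_sym[OF \<Psi>_NI(2)[OF ne]] unfolding J0_def .
  then have "(I, cid 1 a' b') \<in> crel" unfolding \<Psi> using crel_trans cid_scale(2)[OF T'] by blast
  then have "P a'" unfolding P_def using cid_scale(1)[OF T'] by blast
  then have "a \<le> a'" by (rule min)
  also have "int a' \<le> Q x 1"
  proof -
    have "Q x 1 = int g' * int g' * int a'" using Nm_\<Psi>[OF ne] Nm_cid[OF T'] \<Psi> by simp
    moreover have "g' > 0" using T' by (simp add: T_def)
    then have "1 * int a' \<le> (int g' * int g') * int a'" by (intro mult_right_mono) (simp_all add: Suc_le_eq flip: of_nat_mult)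
    ultimately show ?thesis by simp
  qed
  finally have aQ: "int a \<le> Q x 1" by simp
  have "4 * int a * int a \<le> 4 * int a * Q x 1" using aQ by (intro mult_left_mono) auto
  then have "3 * (int a * int a) \<le> int p" using x by (simp add: algebra_simps)
  moreover have "int a \<le> int a * int a" using a_pos by (simp add: mult_le_cancel_left1)
  ultimately have "a \<le> p" by linarith
  with b show thesis by (rule that)
qed

lemma finite_classes: "finite (NI // crel)"
proof (rule finite_subset)
  show "NI // crel \<subseteq> (\<lambda>(a, b). crel `` {cid 1 a b}) ` ({..p} \<times> {..p})"
  proof
    fix C assume "C \<in> NI // crel"
    then obtain I where I: "I \<in> NI" "C = crel `` {I}" by (rule quotientE)
    obtain a b where ab: "(1, a, b) \<in> T" "(I, cid 1 a b) \<in> crel" "a \<le> p" using small_representative[OF I(1)] .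
    have "C = crel `` {cid 1 a b}" unfolding I(2) using ab(2) equiv_class_eq[OF equiv_crel] by blast
    moreover have "b \<le> p" using ab by (simp add: T_def)
    ultimately show "C \<in> (\<lambda>(a, b). crel `` {cid 1 a b}) ` ({..p} \<times> {..p})"
      using ab(3) by (intro rev_image_eqI[of "(a, b)"]) auto
  qed
qed simp

lemma class_generating_function:
  assumes C: "C \<in> NI // crel"
  obtains \<theta> :: "real \<Rightarrow> real" where
    "\<And>t. t > 0 \<Longrightarrow> ((\<lambda>I. exp (- t * of_int (Nm I))) has_sum (\<theta> t - 1) / 2) C"
    "((\<lambda>t. \<theta> t - 2 * \<theta> (2 * t)) \<longlongrightarrow> 0) (at_right 0)"
proof -
  obtain I where I: "I \<in> NI" "C = crel `` {I}" using C by (rule quotientE)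
  obtain a b where ab: "(1, a, b) \<in> T" "(I, cid 1 a b) \<in> crel" "a \<le> p" using small_representative[OF I(1)] .
  have CC: "C = crel `` {cid 1 a b}" unfolding I(2) using ab(2) equiv_class_eq[OF equiv_crel] by blast
  obtain c where "class_representative p m a b c" using class_representativeI[OF ab(1)] .
  then interpret class_representative p m a b c .
  have "C = {I. (J0, I) \<in> crel}" unfolding CC J0_def by auto
  then show thesis using that[of \<theta>] class_sum \<theta>_limit by simp
qed

lemma ideal_generating_function_classes:
  obtains G :: "real \<Rightarrow> real" where
    "\<And>t. t > 0 \<Longrightarrow> ((\<lambda>I. exp (- t * of_int (Nm I))) has_sum G t) NI"
    "((\<lambda>t. G t - 2 * G (2 * t)) \<longlongrightarrow> real (card (NI // crel)) / 2) (at_right 0)"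
proof -
  define P where "P C \<theta> \<longleftrightarrow> (\<forall>t>0. ((\<lambda>I. exp (- t * of_int (Nm I))) has_sum (\<theta> t - 1) / 2) C) \<and>
      ((\<lambda>t. \<theta> t - 2 * \<theta> (2 * t)) \<longlongrightarrow> 0) (at_right 0)" for C and \<theta> :: "real \<Rightarrow> real"
  have "\<forall>C\<in>NI // crel. \<exists>\<theta>. P C \<theta>"
  proof
    fix C assume C: "C \<in> NI // crel"
    show "\<exists>\<theta>. P C \<theta>"
    proof (rule class_generating_function[OF C])
      fix \<theta> :: "real \<Rightarrow> real"
      assume "\<And>t. t > 0 \<Longrightarrow> ((\<lambda>I. exp (- t * of_int (Nm I))) has_sum (\<theta> t - 1) / 2) C"
        "((\<lambda>t. \<theta> t - 2 * \<theta> (2 * t)) \<longlongrightarrow> 0) (at_right 0)"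
      then have "P C \<theta>" by (simp add: P_def)
      then show "\<exists>\<theta>. P C \<theta>" by (intro exI[of _ \<theta>])
    qed
  qed
  from bchoice[OF this] obtain th where "\<forall>C\<in>NI // crel. P C (th C)" by (rule exE)
  then have th: "\<And>C t. C \<in> NI // crel \<Longrightarrow> t > 0 \<Longrightarrow> ((\<lambda>I. exp (- t * of_int (Nm I))) has_sum (th C t - 1) / 2) C"
      "\<And>C. C \<in> NI // crel \<Longrightarrow> ((\<lambda>t. th C t - 2 * th C (2 * t)) \<longlongrightarrow> 0) (at_right 0)"
    unfolding P_def by simp_all
  define G where "G t = (\<Sum>C\<in>NI // crel. (th C t - 1) / 2)" for t
  have "((\<lambda>I. exp (- t * of_int (Nm I))) has_sum G t) NI" if "t > 0" for t
  proof -
    have "((\<lambda>I. exp (- t * of_int (Nm I))) has_sum G t) (\<Union>C\<in>NI // crel. C)"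
      unfolding G_def
    proof (rule sum_has_sum[OF finite_classes])
      show "C \<inter> C' = {}" if "C \<in> NI // crel" "C' \<in> NI // crel" "C \<noteq> C'" for C C'
        using quotient_disj[OF equiv_crel that(1,2)] that(3) by blast
      show "((\<lambda>I. exp (- t * of_int (Nm I))) has_sum (th C t - 1) / 2) C" if "C \<in> NI // crel" for C
        by (rule th(1)[OF that \<open>t > 0\<close>])
    qed
    then show ?thesis using Union_quotient[OF equiv_crel] by simp
  qed
  moreover have "((\<lambda>t. G t - 2 * G (2 * t)) \<longlongrightarrow> real (card (NI // crel)) / 2) (at_right 0)"
  proof -
    \<comment> \<open>The constants \<open>- 1 / 2\<close> at \<open>t\<close> and
      \<open>- 1 / 2\<close>, taken \<open>- 2\<close> times, at \<open>2 * t\<close> leave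
      \<open>1 / 2\<close> per class; this is what counts the classes.\<close>
    have "((\<lambda>t. (\<Sum>C\<in>NI // crel. (th C t - 2 * th C (2 * t) + 1) / 2)) \<longlongrightarrow> (\<Sum>C\<in>NI // crel. (0 + 1) / 2)) (at_right 0)"
      by (intro tendsto_sum tendsto_divide tendsto_add th(2) tendsto_const) auto
    moreover have "G t - 2 * G (2 * t) = (\<Sum>C\<in>NI // crel. (th C t - 2 * th C (2 * t) + 1) / 2)" for t
      unfolding G_def sum_distrib_left sum_subtractf[symmetric] by (intro sum.cong refl) (simp add: field_simps)
    ultimately show ?thesis by simp
  qed
  ultimately show thesis by (rule that)
qed

end

section \<open>The class number formula\<close>

text \<open>With \<open>q = exp (- t)\<close>, expand \<open>q ^ d / (1 - q ^ d)\<close> as a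
  geometric series over \<open>k\<close> and group the pairs \<open>(d, k)\<close> by
  \<open>n = d * k\<close>. Boundedness of \<open>c\<close> gives absolute convergence of the double
  series, which justifies the regrouping.\<close>

lemma Lambert_series_regroup:
  fixes c :: "nat \<Rightarrow> real"
  assumes c: "\<And>d. \<bar>c d\<bar> \<le> 1" and t: "t > 0"
    and S: "((\<lambda>n. (\<Sum>d | d dvd n. c d) * exp (- t * real n)) has_sum S) {1..}"
  shows "((\<lambda>d. c d * (exp (- t * real d) / (1 - exp (- t * real d)))) has_sum S) {1..}"
proof -
  define q where "q = exp (- t)"
  have q: "0 < q" "q < 1" using t by (auto simp: q_def)
  have qn: "exp (- t * real n) = q ^ n" for n by (simp add: q_def flip: exp_of_nat2_mult)
  have qd: "0 < q ^ d" "q ^ d < 1" "q ^ d \<le> q" if "d \<in> {1..}" for d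
    using q that power_decreasing[of 1 d q] by (auto simp: power_less_one_iff)
  have geo: "((\<lambda>k. (q ^ d) ^ k) has_sum q ^ d / (1 - q ^ d)) {1..}" if "d \<in> {1..}" for d
    using has_sum_geometric_from_1[of "q ^ d"] qd[OF that] by simp
  have gs: "(\<lambda>d. q ^ d / (1 - q ^ d)) summable_on {1..}"
  proof (rule summable_on_comparison_test)
    have "((\<lambda>d. q ^ d) has_sum q / (1 - q)) {1..}" using has_sum_geometric_from_1[of q] q by simp
    then show "(\<lambda>d. q ^ d * (1 / (1 - q))) summable_on {1..}"
      by (intro summable_on_cmult_left) (rule has_sum_imp_summable)
    show "q ^ d / (1 - q ^ d) \<le> q ^ d * (1 / (1 - q))" if "d \<in> {1..}" for d
      using qd[OF that] q by (simp add: frac_le)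
    show "0 \<le> q ^ d / (1 - q ^ d)" if "d \<in> {1..}" for d using qd[OF that] by simp
  qed
  define F where "F = (\<lambda>(d, k). c d * (q ^ d) ^ k)"
  have "(\<lambda>(d, k). (q ^ d) ^ k) summable_on (SIGMA d:{1..}. {1..})"
    by (rule summable_on_SigmaI[where g = "\<lambda>d. q ^ d / (1 - q ^ d)"]) (use geo gs q in auto)
  then have "(\<lambda>v. norm (F v)) summable_on (SIGMA d:{1..}. {1..})"
  proof (rule summable_on_comparison_test)
    show "norm (F v) \<le> (case v of (d, k) \<Rightarrow> (q ^ d) ^ k)" for v
      using c q by (cases v) (simp add: F_def abs_mult mult_left_le_one_le)
  qed simp
  then have Fs: "F summable_on (SIGMA d:{1..}. {1..})" by (rule abs_summable_summable)
  define S' where "S' = infsum F (SIGMA d:{1..}. {1..})"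
  have S': "(F has_sum S') (SIGMA d:{1..}. {1..})" unfolding S'_def using Fs by simp
  have 1: "((\<lambda>d. c d * (q ^ d / (1 - q ^ d))) has_sum S') {1..}"
  proof (rule has_sum_SigmaD[OF S'])
    fix d :: nat assume "d \<in> {1..}"
    from has_sum_cmult_right[OF geo[OF this], of "c d"]
    show "((\<lambda>k. F (d, k)) has_sum c d * (q ^ d / (1 - q ^ d))) {1..}" by (simp add: F_def)
  qed
  have bij: "bij_betw (\<lambda>(n, d). (d, n div d)) (SIGMA n:{1..}. {d. d dvd n}) (SIGMA d:{1..}. {1::nat..})"
    by (rule bij_betwI[of _ _ _ "\<lambda>(d, k). (d * k, d)"])
      (auto simp: Suc_le_eq intro!: Nat.gr0I elim!: dvdE)
  have "((\<lambda>v. F (case v of (n, d) \<Rightarrow> (d, n div d))) has_sum S') (SIGMA n:{1..}. {d. d dvd n})"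
    using S' has_sum_reindex_bij_betw[OF bij, of F S'] by simp
  then have "((\<lambda>(n, d). c d * q ^ n) has_sum S') (SIGMA n:{1..}. {d. d dvd n})"
  proof (rule has_sum_cong[THEN iffD1, rotated])
    fix v :: "nat \<times> nat" assume v: "v \<in> (SIGMA n:{1..}. {d. d dvd n})"
    obtain n d where nd: "v = (n, d)" by (cases v)
    have "d * (n div d) = n" using v nd by simp
    then have "(q ^ d) ^ (n div d) = q ^ n" by (simp flip: power_mult)
    then show "F (case v of (n, d) \<Rightarrow> (d, n div d)) = (case v of (n, d) \<Rightarrow> c d * q ^ n)" by (simp add: F_def nd)
  qed
  then have "((\<lambda>n. (\<Sum>d | d dvd n. c d) * q ^ n) has_sum S') {1..}"
  proof (rule has_sum_SigmaD)
    fix n :: nat assume "n \<in> {1..}"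
    then have "finite {d. d dvd n}" by simp
    then show "((\<lambda>d. case (n, d) of (n, d) \<Rightarrow> c d * q ^ n) has_sum (\<Sum>d | d dvd n. c d) * q ^ n) {d. d dvd n}"
      by (intro has_sum_finiteI) (simp_all add: sum_distrib_right)
  qed
  then have "S' = S" using S unfolding qn by (rule has_sum_unique)
  then show ?thesis using 1 unfolding qn by simp
qed

lemma finite_square_divisors: "n > 0 \<Longrightarrow> finite {g::nat. g\<^sup>2 dvd n}"
proof (rule finite_subset)
  assume n: "n > 0"
  show "{g::nat. g\<^sup>2 dvd n} \<subseteq> {..n}"
  proof
    fix g assume "g \<in> {g::nat. g\<^sup>2 dvd n}"
    then have "g\<^sup>2 \<le> n" using n by (auto intro: dvd_imp_le)
    moreover have "g \<le> g\<^sup>2" by (simp add: power2_eq_square)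
    ultimately show "g \<in> {..n}" by simp
  qed
qed simp

context imaginary_quadratic
begin

text \<open>For fixed norm the pair \<open>(g, b)\<close> already determines
  \<open>a = n div g\<^sup>2\<close>.\<close>

lemma card_norm_fibre:
  assumes n: "n > 0"
  shows "finite {v \<in> T. (case v of (g, a, b) \<Rightarrow> g * g * a) = n}"
    "int (card {v \<in> T. (case v of (g, a, b) \<Rightarrow> g * g * a) = n}) = ideal_count m n"
proof -
  define X where "X = (SIGMA g:{g. g\<^sup>2 dvd n}. {b. b < n div g\<^sup>2 \<and> n div g\<^sup>2 dvd b\<^sup>2 + b + m})"
  define h where "h = (\<lambda>(g, b). (g, n div g\<^sup>2, b :: nat))"
  have im: "h ` X = {v \<in> T. (case v of (g, a, b) \<Rightarrow> g * g * a) = n}"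
  proof (intro equalityI subsetI)
    fix v assume "v \<in> h ` X"
    then obtain g b where v: "v = (g, n div g\<^sup>2, b)" and g: "g\<^sup>2 dvd n" and b: "b < n div g\<^sup>2" "n div g\<^sup>2 dvd b\<^sup>2 + b + m"
      by (auto simp: h_def X_def)
    have "g > 0" using g n by (intro Nat.gr0I) auto
    moreover have "g * g * (n div g\<^sup>2) = n" using g by (simp flip: power2_eq_square)
    ultimately show "v \<in> {v \<in> T. (case v of (g, a, b) \<Rightarrow> g * g * a) = n}"
      using b by (simp add: v T_def)
  next
    fix v assume v: "v \<in> {v \<in> T. (case v of (g, a, b) \<Rightarrow> g * g * a) = n}"
    obtain g a b where gab: "v = (g, a, b)" by (cases v)
    have na: "g\<^sup>2 * a = n" and T: "g > 0" "b < a" "a dvd b\<^sup>2 + b + m" using v by (auto simp: gab T_def power2_eq_square)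
    have "n div g\<^sup>2 = a" using na T(1) by (metis nonzero_mult_div_cancel_left zero_less_power not_gr_zero)
    moreover have "g\<^sup>2 dvd n" using na by (metis dvd_triv_left)
    ultimately have "(g, b) \<in> X" "h (g, b) = v" using T by (simp_all add: X_def h_def gab)
    then show "v \<in> h ` X" by (metis imageI)
  qed
  have inj: "inj_on h X" by (auto simp: inj_on_def h_def)
  have fin: "finite X" unfolding X_def
    by (intro finite_SigmaI finite_square_divisors n) (rule finite_subset[of _ "{..<n div _}"], auto)
  then show "finite {v \<in> T. (case v of (g, a, b) \<Rightarrow> g * g * a) = n}" unfolding im[symmetric] by (rule finite_imageI)
  have "card {v \<in> T. (case v of (g, a, b) \<Rightarrow> g * g * a) = n} = card X"
    unfolding im[symmetric] by (rule card_image[OF inj])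
  also have "\<dots> = (\<Sum>g | g\<^sup>2 dvd n. card {b. b < n div g\<^sup>2 \<and> n div g\<^sup>2 dvd b\<^sup>2 + b + m})"
    unfolding X_def by (intro card_SigmaI finite_square_divisors n ballI) simp
  finally show "int (card {v \<in> T. (case v of (g, a, b) \<Rightarrow> g * g * a) = n}) = ideal_count m n"
    by (simp add: ideal_count_def root_count_def)
qed

lemma ideal_generating_function_norms:
  assumes G: "((\<lambda>I. exp (- t * of_int (Nm I))) has_sum G) NI"
  shows "((\<lambda>n. of_int (ideal_count m n) * exp (- t * real n)) has_sum G) {1..}"
proof -
  define N where "N = (\<lambda>(g, a, b :: nat). g * g * a :: nat)"
  have "((\<lambda>v. exp (- t * of_int (Nm (case v of (g, a, b) \<Rightarrow> cid g a b)))) has_sum G) T"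
    using G has_sum_reindex_bij_betw[OF bij_cid, of "\<lambda>I. exp (- t * of_int (Nm I))"] by simp
  then have "((\<lambda>v. exp (- t * real (N v))) has_sum G) T"
  proof (rule has_sum_cong[THEN iffD1, rotated])
    fix v assume "v \<in> T"
    then show "exp (- t * of_int (Nm (case v of (g, a, b) \<Rightarrow> cid g a b))) = exp (- t * real (N v))"
      by (cases v) (simp add: Nm_cid N_def)
  qed
  moreover have bij: "bij_betw snd (SIGMA n:{1..}. {v \<in> T. N v = n}) T"
    by (rule bij_betwI[of _ _ _ "\<lambda>v. (N v, v)"]) (auto simp: N_def T_def Suc_le_eq)
  ultimately have "((\<lambda>w. exp (- t * real (N (snd w)))) has_sum G) (SIGMA n:{1..}. {v \<in> T. N v = n})"
    using has_sum_reindex_bij_betw[OF bij, of "\<lambda>v. exp (- t * real (N v))"] by simp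
  then show ?thesis
  proof (rule has_sum_SigmaD)
    fix n :: nat assume "n \<in> {1..}"
    then have n: "n > 0" by simp
    have fin: "finite {v \<in> T. N v = n}" and card: "int (card {v \<in> T. N v = n}) = ideal_count m n"
      using card_norm_fibre[OF n] unfolding N_def by simp_all
    have "(\<Sum>v\<in>{v \<in> T. N v = n}. exp (- t * real (N v))) = (\<Sum>v\<in>{v \<in> T. N v = n}. exp (- t * real n))"
      by (intro sum.cong refl) simp
    also have "\<dots> = of_int (ideal_count m n) * exp (- t * real n)" unfolding card[symmetric] by simp
    finally show "((\<lambda>v. exp (- t * real (N (snd (n, v))))) has_sum of_int (ideal_count m n) * exp (- t * real n)) {v \<in> T. N v = n}"
      using fin by (intro has_sum_finiteI) simp_all
  qed
qed

end

section \<open>Squares modulo p, the class number formula and the conclusion\<close>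

lemma Legendre_periodic: "Legendre (int (n + p)) (int p) = Legendre (int n) (int p)"
  unfolding Legendre_def QuadRes_def unique_euclidean_semiring_class.cong_def by simp

lemma card_square_roots_mod:
  fixes p a :: nat
  assumes p: "prime p" "2 < p" and a: "a \<in> {1..<p}"
  shows "int (card {k \<in> {1..<p}. k\<^sup>2 mod p = a}) = 1 + Legendre (int a) (int p)"
proof -
  have nz: "\<not> [int a = 0] (mod int p)" using a by (simp add: cong_0_iff) (auto dest: nat_dvd_not_less)
  have QR: "QuadRes (int p) (int a) \<longleftrightarrow> (\<exists>k\<in>{1..<p}. k\<^sup>2 mod p = a)"
  proof
    assume "QuadRes (int p) (int a)"
    then obtain y where y: "[y\<^sup>2 = int a] (mod int p)" by (auto simp: QuadRes_def)
    define k where "k = nat (y mod int p)"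
    have k: "int k = y mod int p" using p by (simp add: k_def)
    have "int (k\<^sup>2 mod p) = (y mod int p)\<^sup>2 mod int p" by (simp add: zmod_int k)
    also have "\<dots> = int a" using y a by (simp add: power_mod unique_euclidean_semiring_class.cong_def)
    finally have k2: "k\<^sup>2 mod p = a" by simp
    have "k < p" using k p by (simp add: k_def nat_less_iff)
    moreover have "k \<noteq> 0" using k2 a by (intro notI) simp
    ultimately show "\<exists>k\<in>{1..<p}. k\<^sup>2 mod p = a" using k2 by (intro bexI[of _ k]) auto
  next
    assume "\<exists>k\<in>{1..<p}. k\<^sup>2 mod p = a"
    then obtain k where k: "k\<^sup>2 mod p = a" by blast
    have "[(int k)\<^sup>2 = int a] (mod int p)" unfolding unique_euclidean_semiring_class.cong_def k[symmetric] by (simp add: zmod_int)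
    then show "QuadRes (int p) (int a)" unfolding QuadRes_def by blast
  qed
  show ?thesis
  proof (cases "\<exists>k\<in>{1..<p}. k\<^sup>2 mod p = a")
    case False
    then have "{k \<in> {1..<p}. k\<^sup>2 mod p = a} = {}" by blast
    then have "card {k \<in> {1..<p}. k\<^sup>2 mod p = a} = 0" by (simp only: card.empty)
    then show ?thesis using False QR nz by (simp add: Legendre_def)
  next
    case True
    then obtain k where k: "k \<in> {1..<p}" "k\<^sup>2 mod p = a" by blast
    have "{k \<in> {1..<p}. k\<^sup>2 mod p = a} = {k, p - k}"
    proof (intro equalityI subsetI)
      fix j assume j: "j \<in> {k \<in> {1..<p}. k\<^sup>2 mod p = a}"
      then have "[j\<^sup>2 = k\<^sup>2] (mod p)" using k by (simp add: unique_euclidean_semiring_class.cong_def)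
      then have "[int (j\<^sup>2) = int (k\<^sup>2)] (mod int p)" by (simp only: cong_int_iff)
      then have "int p dvd (int j)\<^sup>2 - (int k)\<^sup>2" by (simp add: cong_iff_dvd_diff)
      also have "(int j)\<^sup>2 - (int k)\<^sup>2 = (int j - int k) * (int j + int k)" by (simp add: power2_eq_square algebra_simps)
      finally have "int p dvd int j - int k \<or> int p dvd int j + int k" using p by (simp add: prime_dvd_mult_iff)
      then show "j \<in> {k, p - k}"
      proof
        assume "int p dvd int j - int k"
        then have "[int j = int k] (mod int p)" by (simp add: cong_iff_dvd_diff)
        then have "j = k" using j k by (auto simp: cong_int_iff intro: cong_less_modulus_unique_nat)
        then show ?thesis by simp
      next
        assume "int p dvd int j + int k"
        then have "p dvd j + k" by (simp flip: of_nat_add)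
        then obtain i where i: "j + k = p * i" by (auto elim: dvdE)
        have "i < 2"
        proof (rule ccontr)
          assume "\<not> i < 2"
          then have "p * 2 \<le> p * i" by (intro mult_le_mono2) simp
          moreover have "j < p" "k < p" using j k by simp_all
          ultimately show False using i by linarith
        qed
        moreover have "i \<noteq> 0" using i k by (intro notI) auto
        ultimately have "i = 1" by simp
        then show ?thesis using i by auto
      qed
    next
      fix j assume "j \<in> {k, p - k}"
      then consider "j = k" | "j = p - k" by blast
      then show "j \<in> {k \<in> {1..<p}. k\<^sup>2 mod p = a}"
      proof cases
        case 2
        have "int p dvd (int p - int k)\<^sup>2 - (int k)\<^sup>2"
          by (simp add: power2_eq_square algebra_simps)
        then have "[(int p - int k)\<^sup>2 = (int k)\<^sup>2] (mod int p)" by (simp only: cong_iff_dvd_diff)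
        moreover have "int p - int k = int j" using 2 k by (simp add: of_nat_diff)
        ultimately have "[int (j\<^sup>2) = int (k\<^sup>2)] (mod int p)" by simp
        then have "[j\<^sup>2 = k\<^sup>2] (mod p)" unfolding cong_int_iff .
        then have "j\<^sup>2 mod p = k\<^sup>2 mod p" unfolding unique_euclidean_semiring_class.cong_def .
        then show ?thesis using 2 k by auto
      qed (use k in simp)
    qed
    moreover have "k \<noteq> p - k"
    proof
      assume "k = p - k"
      then have "even p" using k by (metis atLeastLessThan_iff dvd_triv_left le_add_diff_inverse less_imp_le mult_2)
      then show False using p prime_odd_nat by blast
    qed
    ultimately have "card {k \<in> {1..<p}. k\<^sup>2 mod p = a} = 2" by simp
    then show ?thesis using True QR nz by (simp add: Legendre_def)
  qed
qed

lemma sum_over_squares_mod: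
  fixes p :: nat and f :: "nat \<Rightarrow> int"
  assumes p: "prime p" "2 < p"
  shows "(\<Sum>k\<in>{1..<p}. f (k\<^sup>2 mod p)) = (\<Sum>a\<in>{1..<p}. f a * (1 + Legendre (int a) (int p)))"
proof -
  have "k\<^sup>2 mod p \<in> {1..<p}" if k: "k \<in> {1..<p}" for k
  proof -
    have "\<not> p dvd k" using k by (auto dest: dvd_imp_le)
    then have "\<not> p dvd k\<^sup>2" using p(1) prime_dvd_power_nat by blast
    then have "k\<^sup>2 mod p \<noteq> 0" by (simp add: dvd_eq_mod_eq_0)
    moreover have "k\<^sup>2 mod p < p" using p by simp
    ultimately show ?thesis by simp
  qed
  then have sub: "(\<lambda>k. k\<^sup>2 mod p) ` {1..<p} \<subseteq> {1..<p}" by blast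
  have "(\<Sum>k\<in>{1..<p}. f (k\<^sup>2 mod p)) = (\<Sum>a\<in>{1..<p}. \<Sum>k\<in>{k \<in> {1..<p}. k\<^sup>2 mod p = a}. f (k\<^sup>2 mod p))"
    by (rule sum.group[symmetric, OF _ _ sub]) simp_all
  also have "\<dots> = (\<Sum>a\<in>{1..<p}. f a * (1 + Legendre (int a) (int p)))"
  proof (intro sum.cong refl)
    fix a assume a: "a \<in> {1..<p}"
    have "(\<Sum>k\<in>{k \<in> {1..<p}. k\<^sup>2 mod p = a}. f (k\<^sup>2 mod p)) = (\<Sum>k\<in>{k \<in> {1..<p}. k\<^sup>2 mod p = a}. f a)"
      by (intro sum.cong refl) simp
    then show "(\<Sum>k\<in>{k \<in> {1..<p}. k\<^sup>2 mod p = a}. f (k\<^sup>2 mod p)) = f a * (1 + Legendre (int a) (int p))"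
      using card_square_roots_mod[OF p a] by simp
  qed
  finally show ?thesis .
qed

text \<open>Take the constant weight 1 in the sum over squares: both sides then start with
  \<open>p - 1\<close>.\<close>

lemma sum_Legendre_zero:
  fixes p :: nat
  assumes p: "prime p" "2 < p"
  shows "(\<Sum>a\<in>{1..<p}. Legendre (int a) (int p)) = 0"
  using sum_over_squares_mod[OF p, of "\<lambda>_. 1"] by (simp add: sum.distrib)

lemma sum_lessThan_eq_from_1: "p > 0 \<Longrightarrow> f 0 = 0 \<Longrightarrow> (\<Sum>k<p. f k) = (\<Sum>k\<in>{1..<p}. f (k::nat) :: 'a :: comm_monoid_add)"
  by (rule sum.mono_neutral_right) (auto simp: not_less_eq_eq Suc_le_eq)

theorem (in imaginary_quadratic) class_number_formula:
  "int p * int (class_number (quadratic_field (- int p))) = - (\<Sum>a\<in>{1..<p}. int a * Legendre (int a) (int p))"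
proof -
  have p2: "2 < p" using p_eq m_gt by linarith
  define c where "c d = real_of_int (Legendre (int d) (int p))" for d
  have c1: "\<bar>c d\<bar> \<le> 1" for d by (simp add: c_def Legendre_def)
  have c0: "c 0 = 0" by (simp add: c_def Legendre_def)
  obtain G :: "real \<Rightarrow> real" where
    G: "\<And>t. t > 0 \<Longrightarrow> ((\<lambda>I. exp (- t * of_int (Nm I))) has_sum G t) NI" and
    Glim: "((\<lambda>t. G t - 2 * G (2 * t)) \<longlongrightarrow> real (card (NI // crel)) / 2) (at_right 0)"
    using ideal_generating_function_classes by blast
  have L: "((\<lambda>d. c d * (exp (- t * real d) / (1 - exp (- t * real d)))) has_sum G t) {1..}" if t: "t > 0" for t
  proof (rule Lambert_series_regroup[OF c1 t])
    show "((\<lambda>n. (\<Sum>d | d dvd n. c d) * exp (- t * real n)) has_sum G t) {1..}"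
    proof (rule has_sum_cong[THEN iffD1, OF _ ideal_generating_function_norms[OF G[OF t]]])
      fix n :: nat assume "n \<in> {1..}"
      then have "n > 0" by simp
      from ideal_count_eq_divisor_sum[OF prime_p p_eq this]
      show "of_int (ideal_count m n) * exp (- t * real n) = (\<Sum>d | d dvd n. c d) * exp (- t * real n)"
        by (simp add: c_def)
    qed
  qed
  have s: "(\<lambda>d. c d / (1 + exp (real d * t))) sums (G t - 2 * G (2 * t))" if t: "t > 0" for t
  proof -
    have t2: "2 * t > 0" using t by simp
    have "((\<lambda>d. c d * (exp (- t * real d) / (1 - exp (- t * real d))) +
        (- 2) * (c d * (exp (- (2 * t) * real d) / (1 - exp (- (2 * t) * real d))))) has_sum
        (G t + (- 2) * G (2 * t))) {1..}"
      by (intro has_sum_add has_sum_cmult_right L t t2)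
    then have "((\<lambda>d. c d / (1 + exp (real d * t))) has_sum (G t + (- 2) * G (2 * t))) {1..}"
    proof (rule has_sum_cong[THEN iffD1, rotated])
      fix d :: nat assume "d \<in> {1..}"
      define q where "q = exp (- t * real d)"
      have q: "0 < q" "q < 1" using t \<open>d \<in> {1..}\<close> by (auto simp: q_def)
      have qq: "exp (- (2 * t) * real d) = q * q" by (simp add: q_def flip: exp_add)
      have qi: "exp (real d * t) = 1 / q" by (simp add: q_def exp_minus field_simps)
      \<comment> \<open>The factor \<open>1 - q\<close>, which vanishes as \<open>t\<close> tends to
        0, cancels from numerator and denominator.\<close>
      have "1 - q * q = (1 - q) * (1 + q)" by (simp add: algebra_simps)
      then have "q / (1 - q) - 2 * (q * q / (1 - q * q)) = (q * (1 + q) - 2 * (q * q)) / ((1 - q) * (1 + q))"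
        using q by (simp add: diff_divide_distrib)
      also have "q * (1 + q) - 2 * (q * q) = (1 - q) * q" by (simp add: algebra_simps)
      also have "(1 - q) * q / ((1 - q) * (1 + q)) = q / (1 + q)" using q by simp
      also have "\<dots> = 1 / (1 + 1 / q)" using q by (simp add: field_simps)
      finally have e: "q / (1 - q) - 2 * (q * q / (1 - q * q)) = 1 / (1 + 1 / q)" .
      have "c d * (q / (1 - q)) + - 2 * (c d * (q * q / (1 - q * q))) = c d * (q / (1 - q) - 2 * (q * q / (1 - q * q)))"
        by (simp add: algebra_simps)
      then show "c d * (exp (- t * real d) / (1 - exp (- t * real d))) +
        - 2 * (c d * (exp (- (2 * t) * real d) / (1 - exp (- (2 * t) * real d)))) = c d / (1 + exp (real d * t))"
        unfolding q_def[symmetric] qq qi e by simp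
    qed
    \<comment> \<open>Index 0 may be added because \<open>c 0 = 0\<close>; the convex sequence has
      to start there, with value \<open>1 / 2\<close>.\<close>
    then have "((\<lambda>d. c d / (1 + exp (real d * t))) has_sum (G t + (- 2) * G (2 * t))) UNIV"
    proof (rule has_sum_cong_neutral[THEN iffD1, rotated 3])
      fix d :: nat assume "d \<in> UNIV - {1..}"
      then have "d = 0" by auto
      then show "c d / (1 + exp (real d * t)) = 0" using c0 by simp
    qed simp_all
    from has_sum_imp_sums[OF this] show ?thesis by simp
  qed
  have zero: "(\<Sum>k<p. c k) = 0"
  proof -
    have "(\<Sum>k<p. c k) = (\<Sum>k\<in>{1..<p}. c k)" using p_pos c0 by (rule sum_lessThan_eq_from_1)
    also have "\<dots> = real_of_int (\<Sum>k\<in>{1..<p}. Legendre (int k) (int p))" by (simp add: c_def)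
    finally show ?thesis unfolding sum_Legendre_zero[OF prime_p p2] by simp
  qed
  have per: "c (n + p) = c n" for n unfolding c_def Legendre_periodic ..
  have "((\<lambda>t. G t - 2 * G (2 * t)) \<longlongrightarrow> ((\<Sum>d<p. \<Sum>j\<le>d. c j) / real p) / 2) (at_right 0)"
    by (rule logistic_series_limit[OF per p_pos zero s])
  then have "real (card (NI // crel)) / 2 = ((\<Sum>d<p. \<Sum>j\<le>d. c j) / real p) / 2"
    using Glim by (intro tendsto_unique[OF trivial_limit_at_right_real])
  then have h: "real p * real (card (NI // crel)) = (\<Sum>d<p. \<Sum>j\<le>d. c j)" using p_pos by (simp add: field_simps)
  \<comment> \<open>Each \<open>j\<close> is counted by the \<open>p - j\<close> indices
    \<open>d\<close> from \<open>j\<close> to \<open>p - 1\<close>. The part with \<open>p\<close>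
    then drops out since \<open>c\<close> sums to zero over a period.\<close>
  have "(\<Sum>d<p. \<Sum>j\<le>d. c j) = (\<Sum>j<p. real (p - j) * c j)"
  proof -
    have "(\<Sum>d<n. \<Sum>j\<le>d. c j) = (\<Sum>j<n. real (n - j) * c j)" for n
    proof (induction n)
      case (Suc n)
      have "(\<Sum>j<Suc n. real (Suc n - j) * c j) = (\<Sum>j<Suc n. real (n - j) * c j + c j)"
        by (intro sum.cong refl) (auto simp: Suc_diff_le algebra_simps)
      then show ?case using Suc by (simp add: sum.distrib flip: lessThan_Suc_atMost)
    qed simp
    then show ?thesis .
  qed
  also have "\<dots> = (\<Sum>j<p. real p * c j - real j * c j)"
    by (intro sum.cong refl) (auto simp: of_nat_diff algebra_simps)
  also have "\<dots> = - (\<Sum>j<p. real j * c j)"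
    unfolding sum_subtractf sum_distrib_left[symmetric] zero by simp
  also have "(\<Sum>j<p. real j * c j) = (\<Sum>j\<in>{1..<p}. real j * c j)"
    by (rule sum_lessThan_eq_from_1[OF p_pos]) simp
  finally have "real_of_int (int p * int (card (NI // crel))) = real_of_int (- (\<Sum>a\<in>{1..<p}. int a * Legendre (int a) (int p)))"
    using h by (simp add: c_def)
  then have "int p * int (card (NI // crel)) = - (\<Sum>a\<in>{1..<p}. int a * Legendre (int a) (int p))"
    by (simp only: of_int_eq_iff)
  moreover have "class_number (quadratic_field (- int p)) = card (NI // crel)"
    unfolding class_number_def Let_def ring_of_integers_eq NI_def crel_def ..
  ultimately show ?thesis by simp
qed

text \<open>\<open>- 1\<close> is a square, so the symbol is invariant under
  \<open>a \<mapsto> p - a\<close>. This reflection turns the sum into its negative, up to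
  \<open>p\<close> times the vanishing sum of the symbols.\<close>

lemma sum_id_Legendre_1_mod_4:
  fixes p :: nat
  assumes p: "prime p" "2 < p" and p4: "p mod 4 = 1"
  shows "(\<Sum>a\<in>{1..<p}. int a * Legendre (int a) (int p)) = 0"
proof -
  define A where "A = (\<Sum>a\<in>{1..<p}. int a * Legendre (int a) (int p))"
  have "even ((p - 1) div 2)" using p4 by presburger
  then have m1: "Legendre (- 1) (int p) = 1" using Legendre_minus_one[OF p] by simp
  have refl': "Legendre (int (p - a)) (int p) = Legendre (int a) (int p)" if "a \<in> {1..<p}" for a
  proof -
    have "Legendre (int (p - a)) (int p) = Legendre (- int a) (int p)"
    proof -
      have "int (p - a) mod int p = (- int a) mod int p"
      proof -
        have "int (p - a) = - int a + int p" using that by (simp add: of_nat_diff)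
        then show ?thesis by (simp only: mod_add_self2)
      qed
      then show ?thesis unfolding Legendre_def QuadRes_def unique_euclidean_semiring_class.cong_def by simp
    qed
    also have "\<dots> = Legendre (int a) (int p)" using Legendre_mult[OF p, of "- 1" "int a"] m1 by simp
    finally show ?thesis .
  qed
  have "A = (\<Sum>a\<in>{1..<p}. int (p - a) * Legendre (int (p - a)) (int p))"
    unfolding A_def by (rule sum.reindex_bij_witness[of _ "\<lambda>a. p - a" "\<lambda>a. p - a"]) auto
  also have "\<dots> = (\<Sum>a\<in>{1..<p}. int p * Legendre (int a) (int p) - int a * Legendre (int a) (int p))"
  proof (intro sum.cong refl)
    fix a assume a: "a \<in> {1..<p}"
    then have "int (p - a) = int p - int a" by (simp add: of_nat_diff)
    then show "int (p - a) * Legendre (int (p - a)) (int p) = int p * Legendre (int a) (int p) - int a * Legendre (int a) (int p)"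
      unfolding refl'[OF a] by (simp add: left_diff_distrib)
  qed
  also have "\<dots> = - A" unfolding sum_subtractf sum_distrib_left[symmetric] sum_Legendre_zero[OF p] A_def by simp
  finally show ?thesis unfolding A_def by simp
qed

theorem mainTheorem1:
  fixes p :: nat
    and \<zeta> :: complex
    and Q :: "'p::prime_card mod_ring \<Rightarrow> 'p mod_ring point"
  assumes "prime p" and "CARD('p) = p" and "[p = 1] (mod 3)"
    and "\<zeta> ^ 3 = 1" and "\<forall>k\<in>{1, 2}. \<zeta> ^ k \<noteq> 1"
    and "\<And>z. z \<noteq> 0 \<Longrightarrow> Q z \<in> curve (- 27 * fiber_param z) - tau (fiber_param z) ` curve (fiber_param z)"
  shows "1 / of_nat p * S_tau \<zeta> Q = of_nat (h_star p) - (of_nat p - 1) / 2"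
proof -
  have p3: "p mod 3 = 1" using assms(3) by (simp add: unique_euclidean_semiring_class.cong_def)
  have p2: "2 < p"
  proof -
    have "p \<noteq> 2" using p3 by auto
    then show ?thesis using prime_gt_1_nat[OF assms(1)] by linarith
  qed
  have podd: "odd p" using assms(1) p2 prime_odd_nat by blast
  have \<zeta>1: "\<zeta> \<noteq> 1" using assms(5) by (metis insertI1 power_one_right)
  have card3: "CARD('p) mod 3 = 1" unfolding assms(2) by (rule p3)
  define A where "A = (\<Sum>a\<in>{1..<p}. int a * Legendre (int a) (int p))"
  \<comment> \<open>A nonzero residue \<open>a\<close> is the square of
    \<open>1 + Legendre a p\<close> elements, so the sum of squares splits into an arithmetic series
    and the sum in the class number formula.\<close>
  have "(\<Sum>k\<in>{1..<p}. int (k\<^sup>2 mod p)) = (\<Sum>a\<in>{1..<p}. int a) + A"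
    unfolding sum_over_squares_mod[OF assms(1) p2] A_def sum.distrib[symmetric]
    by (intro sum.cong refl) (simp add: algebra_simps)
  moreover have "2 * (\<Sum>a\<in>{1..<p}. int a) = int p * (int p - 1)"
  proof -
    have "2 * (\<Sum>a\<in>{1..<n}. int a) = int n * (int n - 1)" if "n \<ge> 1" for n
      using that by (induction n rule: dec_induct) (auto simp: algebra_simps)
    then show ?thesis using p2 by simp
  qed
  moreover have A: "A = - (int p * int (h_star p))"
  proof (cases "[p = 3] (mod 4)")
    case True
    then have "p mod 4 = 3" by (simp add: unique_euclidean_semiring_class.cong_def)
    define m where "m = (p + 1) div 4"
    have "p + 1 = 4 * m" using \<open>p mod 4 = 3\<close> unfolding m_def by presburger
    moreover have "m > 1"
    proof -
      \<comment> \<open>The congruence modulo 3 excludes the field with six units.\<close>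
      have "p \<noteq> 3" using p3 by auto
      then show ?thesis using \<open>p + 1 = 4 * m\<close> p2 by linarith
    qed
    ultimately interpret imaginary_quadratic p m using assms(1) by unfold_locales
    show ?thesis using class_number_formula True by (simp add: A_def h_star_def)
  next
    case False
    then have "p mod 4 = 1" using podd unfolding unique_euclidean_semiring_class.cong_def by presburger
    then have "A = 0" unfolding A_def by (rule sum_id_Legendre_1_mod_4[OF assms(1) p2])
    then show ?thesis using False by (simp add: h_star_def)
  qed
  ultimately have sq: "2 * (\<Sum>k\<in>{1..<p}. int (k\<^sup>2 mod p)) = int p * (int p - 1) - 2 * (int p * int (h_star p))"
    by linarith
  have "S_tau \<zeta> Q = - of_int (\<Sum>t\<in>-{0}. to_int_mod_ring ((t :: 'p mod_ring)\<^sup>2))"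
    using S_tau_eq_sum_squares[OF card3 assms(4) \<zeta>1, of Q] assms(6) by simp
  also have "(\<Sum>t\<in>-{0}. to_int_mod_ring ((t :: 'p mod_ring)\<^sup>2)) = (\<Sum>k\<in>{1..<p}. int (k\<^sup>2 mod p))"
    by (rule sum_squares_mod_ring[OF assms(2)])
  finally have "2 * S_tau \<zeta> Q = - of_int (2 * (\<Sum>k\<in>{1..<p}. int (k\<^sup>2 mod p)))" by simp
  also have "\<dots> = of_nat p * (2 * of_nat (h_star p) - (of_nat p - 1))"
    unfolding sq by (simp add: algebra_simps)
  finally have S2: "2 * S_tau \<zeta> Q = of_nat p * (2 * of_nat (h_star p) - (of_nat p - 1))" .
  have p0: "(of_nat p :: complex) \<noteq> 0" using p2 by simp
  have solve: "1 / P * s = h - (P - 1) / 2" if "2 * s = P * (2 * h - (P - 1))" "P \<noteq> 0" for s h P :: complex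
  proof -
    have "s = (2 * s) / 2" by simp
    also have "\<dots> = P * ((2 * h - (P - 1)) / 2)" unfolding that(1) by simp
    finally have "1 / P * s = (2 * h - (P - 1)) / 2" using that(2) by simp
    also have "\<dots> = h - (P - 1) / 2" unfolding diff_divide_distrib by simp
    finally show ?thesis .
  qed
  show ?thesis by (rule solve[OF S2 p0])
qed

end
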